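(* Let $\mathbb C\{x\}=\mathbb C\{x_1,\dots,x_d\}$ be the ring of convergent power series, and let $f,g\in\mathbb C[x]$ with $f(\mathbf 0)=g(\mathbf 0)=0$. Suppose $f$ is contact equivalent to $g$ at $\mathbf 0$, i.e. there exist a $\mathbb C$-algebra automorphism $\varphi$ of $\mathbb C\{x\}$ and a unit $u\in\mathbb C\{x\}$ with $g=u\cdot\varphi(f)$. Then for every integer $n\geq 1$, the $\mathbb C$-algebras $\mathbb C\{x\}/\langle f,\mathcal J_n(f)\rangle$ and $\mathbb C\{x\}/\langle g,\mathcal J_n(g)\rangle$ are isomorphic.
   Context: Multi-index notation: for $\alpha,\beta\in\mathbb N^d$, $|\alpha|=\sum\alpha_i$, $\alpha!=\prod\alpha_i!$, $\alpha\geq\beta$ means $\alpha_i\ge\beta_i$ for all $i$, $\alpha>\beta$ means $\alpha\ge\beta$ and $\alpha\neq\beta$, and $\partial^\alpha f=\partial^{|\alpha|}f/\partial x_1^{\alpha_1}\cdots\partial x_d^{\alpha_d}$. For $h\in\mathbb C\{x\}$ and $n\geq1$, the $n$-th Jacobian matrix $\mathrm{Jac}_n(h)$ is the matrix with rows indexed by $\beta\in\mathbb N^d$ with $0\le|\beta|\le n-1$ and columns indexed by $\alpha\in\mathbb N^d$ with $1\le|\alpha|\le n$ (both in graded lexicographic order), whose $(\beta,\alpha)$-entry is $\partial^{\alpha-\beta}h/(\alpha-\beta)!$ if $\alpha>\beta$, and $0$ otherwise. It has $\binom{d-1+n}{d}$ rows and $\binom{d+n}{d}-1$ columns. $\mathcal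 J_n(h)$ denotes the ideal of $\mathbb C\{x\}$ generated by all maximal minors (of size $\binom{d-1+n}{d}$) of $\mathrm{Jac}_n(h)$ (the $n$-th Jacobian ideal of $h$). *)

theory Defs
  imports "HOL-Analysis.Infinite_Sum" "HOL-Combinatorics.Permutations"
          "HOL-Algebra.QuotRing"
begin

text \<open>Multi-indices in d variables: functions nat => nat vanishing from d on.
  A power series in x_1..x_d is its coefficient function on multi-indices
  (zero outside the d-variable multi-indices).\<close>

type_synonym mindex = "nat \<Rightarrow> nat"
type_synonym pseries = "mindex \<Rightarrow> complex"

definition MI :: "nat \<Rightarrow> mindex set" where
  "MI d = {\<alpha>. \<forall>i\<ge>d. \<alpha> i = 0}"

definition mdeg :: "nat \<Rightarrow> mindex \<Rightarrow> nat" where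
  "mdeg d \<alpha> = (\<Sum>i<d. \<alpha> i)"

definition conv_series :: "nat \<Rightarrow> pseries set" where
  "conv_series d = {c. (\<forall>\<alpha>. c \<alpha> \<noteq> 0 \<longrightarrow> \<alpha> \<in> MI d) \<and>
      (\<exists>r>0. (\<lambda>\<alpha>. norm (c \<alpha>) * r ^ mdeg d \<alpha>) summable_on UNIV)}"

definition cst :: "complex \<Rightarrow> pseries" where
  "cst a = (\<lambda>\<alpha>. if \<alpha> = (\<lambda>_. 0) then a else 0)"

definition ps_mult :: "pseries \<Rightarrow> pseries \<Rightarrow> pseries" where
  "ps_mult a b = (\<lambda>\<alpha>. \<Sum>\<beta>\<in>{\<beta>. \<beta> \<le> \<alpha>}. a \<beta> * b (\<lambda>i. \<alpha> i - \<beta> i))"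

definition Cx :: "nat \<Rightarrow> pseries ring" where
  "Cx d = \<lparr>carrier = conv_series d, mult = ps_mult, one = cst 1,
           zero = (\<lambda>_. 0), add = (\<lambda>a b \<alpha>. a \<alpha> + b \<alpha>)\<rparr>"

definition is_poly :: "nat \<Rightarrow> pseries \<Rightarrow> bool" where
  "is_poly d f \<longleftrightarrow> f \<in> conv_series d \<and> finite {\<alpha>. f \<alpha> \<noteq> 0}"

text \<open>Divided derivative  partial^gamma h / gamma!  (coefficientwise).\<close>
definition dder :: "nat \<Rightarrow> mindex \<Rightarrow> pseries \<Rightarrow> pseries" where
  "dder d \<gamma> h = (\<lambda>\<alpha>. of_nat (\<Prod>i<d. (\<alpha> i + \<gamma> i) choose (\<gamma> i)) * h (\<lambda>i. \<alpha> i + \<gamma> i))"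

definition jac_rows :: "nat \<Rightarrow> nat \<Rightarrow> mindex set" where
  "jac_rows d n = {\<beta>\<in>MI d. mdeg d \<beta> \<le> n - 1}"

definition jac_cols :: "nat \<Rightarrow> nat \<Rightarrow> mindex set" where
  "jac_cols d n = {\<alpha>\<in>MI d. 1 \<le> mdeg d \<alpha> \<and> mdeg d \<alpha> \<le> n}"

definition Jac :: "nat \<Rightarrow> pseries \<Rightarrow> mindex \<Rightarrow> mindex \<Rightarrow> pseries" where
  "Jac d h \<beta> \<alpha> = (if \<beta> < \<alpha> then dder d (\<lambda>i. \<alpha> i - \<beta> i) h else (\<lambda>_. 0))"

definition rdet :: "('a, 'b) ring_scheme \<Rightarrow> nat \<Rightarrow> (nat \<Rightarrow> nat \<Rightarrow> 'a) \<Rightarrow> 'a" where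
  "rdet R m A = (\<Oplus>\<^bsub>R\<^esub> \<pi>\<in>{\<pi>. \<pi> permutes {..<m}}.
      (if sign \<pi> = 1 then (\<lambda>x. x) else a_inv R) (\<Otimes>\<^bsub>R\<^esub> i\<in>{..<m}. A i (\<pi> i)))"

text \<open>Maximal minors of Jac_n(h): determinants of the square submatrices given by
  choosing as many columns as there are rows, listed in any order of rows and columns
  (reordering only changes the sign, so the generated ideal is the same).\<close>
definition max_minors :: "nat \<Rightarrow> nat \<Rightarrow> pseries \<Rightarrow> pseries set" where
  "max_minors d n h = {rdet (Cx d) (card (jac_rows d n)) (\<lambda>i j. Jac d h (b i) (c j)) | b c.
      bij_betw b {..<card (jac_rows d n)} (jac_rows d n) \<and>
      inj_on c {..<card (jac_rows d n)} \<and> c ` {..<card (jac_rows d n)} \<subseteq> jac_cols d n}"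

definition Jn_ideal :: "nat \<Rightarrow> nat \<Rightarrow> pseries \<Rightarrow> pseries set" where
  "Jn_ideal d n h = genideal (Cx d) (max_minors d n h)"

definition alg_aut :: "nat \<Rightarrow> (pseries \<Rightarrow> pseries) \<Rightarrow> bool" where
  "alg_aut d \<phi> \<longleftrightarrow> \<phi> \<in> ring_iso (Cx d) (Cx d) \<and> (\<forall>a. \<phi> (cst a) = cst a)"

definition contact_equiv :: "nat \<Rightarrow> pseries \<Rightarrow> pseries \<Rightarrow> bool" where
  "contact_equiv d f g \<longleftrightarrow>
     (\<exists>\<phi> u. alg_aut d \<phi> \<and> u \<in> Units (Cx d) \<and> g = u \<otimes>\<^bsub>Cx d\<^esub> \<phi> f)"

definition quot_alg_iso :: "nat \<Rightarrow> pseries set \<Rightarrow> pseries set \<Rightarrow> bool" where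
  "quot_alg_iso d I J \<longleftrightarrow> (\<exists>\<psi>. \<psi> \<in> ring_iso (Cx d Quot I) (Cx d Quot J) \<and>
      (\<forall>a. \<psi> (I +>\<^bsub>Cx d\<^esub> cst a) = J +>\<^bsub>Cx d\<^esub> cst a))"

end

theory Submission
  imports Defs "HOL-Library.Function_Algebras"
begin

text \<open>The rows of \<open>Jac\<^sub>n(h)\<close> are the coefficient vectors of \<open>t\<^sup>\<beta> (h(x + t) - h(x))\<close> modulo \<open>(t)\<^sup>n\<^sup>+\<^sup>1\<close>.
  An automorphism \<open>\<phi>\<close> extends to \<open>\<Phi> : \<Sum> a\<^sub>\<gamma> t\<^sup>\<gamma> \<mapsto> \<Sum> \<phi>(a\<^sub>\<gamma>) s\<^sup>\<gamma>\<close> with \<open>s\<^sub>i = \<phi>(x\<^sub>i)(x + t) - \<phi>(x\<^sub>i)\<close>,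
  and \<open>\<Phi>\<close> commutes with Taylor expansion modulo \<open>(t)\<^sup>n\<^sup>+\<^sup>1\<close>. Hence, for \<open>g = u \<phi>(f)\<close>, one has
  \<open>Jac\<^sub>n(g) = P \<phi>(Jac\<^sub>n(f)) Q\<close> modulo \<open>\<phi>(f)\<close> for suitable matrices \<open>P\<close> and \<open>Q\<close>, and by
  multilinearity the maximal minors of \<open>Jac\<^sub>n(g)\<close> lie in the image under \<open>\<phi>\<close> of the ideal
  \<open>\<langle>f, J\<^sub>n(f)\<rangle>\<close>. The reverse inclusion follows from \<open>f = u' \<phi>\<inverse>(g)\<close>, so \<open>\<phi>\<close> induces the isomorphism
  of the quotients.\<close>

section \<open>Formal power series in countably many variables\<close>

text \<open>An automorphism is given only algebraically, neither as a substitution nor as a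
  continuous map, so its compatibility with Taylor expansion needs an argument. It holds for
  constants and, by the choice of the s_i, for the variables. For any other series one splits off
  variables repeatedly; the defect then lies in every power of the ideal (x, t) and must vanish.
  This requires that \<phi> preserve the maximal ideal, which holds because x_i - c is a unit for c
  \<noteq> 0.

  \<Phi> is cut off after degree n. It is then a finite sum and no convergence in t arises, but it
  respects products only modulo (t)^(n+1).

  The matrix Q records the powers of the s_i. The matrix P comes from surjectivity: with \<phi>(y_i)
  = x_i, the increment y_i(x + t) - y_i is sent to t_i, so multiplication by t^\<beta> u(x + t) on
  the target can be imitated on the source.

  Formal series form a type in the class of commutative rings, which can be iterated to obtain
  series in t over series in x; convergent series are a subset of it. The ring records of the
  theorem are reached only by a final transfer.\<close>

lemma mindex_diff_apply: "(\<alpha> - \<beta>) i = \<alpha> i - \<beta> i" for \<alpha> \<beta> :: mindex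
  by simp

lemma mindex_add_diff: "\<beta> \<le> \<alpha> \<Longrightarrow> \<beta> + (\<alpha> - \<beta>) = \<alpha>" for \<alpha> \<beta> :: mindex
  by (auto simp: le_fun_def fun_eq_iff)

lemma mindex_add_le_iff: "\<gamma> + \<delta> \<le> \<alpha> \<longleftrightarrow> \<gamma> \<le> \<alpha> \<and> \<delta> \<le> \<alpha> - \<gamma>" for \<alpha> \<gamma> \<delta> :: mindex
proof -
  have "\<gamma> i + \<delta> i \<le> \<alpha> i \<longleftrightarrow> \<gamma> i \<le> \<alpha> i \<and> \<delta> i \<le> \<alpha> i - \<gamma> i" for i
    by linarith
  then show ?thesis unfolding le_fun_def by auto
qed

lemma mindex_le_add: "\<gamma> \<le> \<gamma> + \<delta>" for \<gamma> \<delta> :: mindex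
  by (simp add: le_fun_def)

lemma mindex_diff_mono: "\<beta> \<le> \<alpha> \<Longrightarrow> \<beta> - \<gamma> \<le> \<alpha> - \<gamma>" for \<alpha> \<beta> \<gamma> :: mindex
  by (simp add: le_fun_def diff_le_mono)

lemma mindex_diff_add: "\<gamma> + \<delta> - \<gamma> = \<delta>" for \<gamma> \<delta> :: mindex
  by (simp add: fun_eq_iff)

lemma mindex_diff_diff: "\<beta> \<le> \<alpha> \<Longrightarrow> \<alpha> - (\<alpha> - \<beta>) = \<beta>" for \<alpha> \<beta> :: mindex
  by (auto simp: le_fun_def fun_eq_iff)

lemma mindex_diff_le: "\<alpha> - \<beta> \<le> \<alpha>" for \<alpha> \<beta> :: mindex
  by (simp add: le_fun_def)

text \<open>Multi-indices below \<alpha> vanish off its finite support, so they are covered by the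
  image of a finite product of intervals.\<close>

lemma finite_mindex_le:
  fixes \<alpha> :: mindex
  assumes "finite {i. \<alpha> i \<noteq> 0}"
  shows "finite {\<beta>. \<beta> \<le> \<alpha>}"
proof -
  let ?S = "{i. \<alpha> i \<noteq> 0}"
  have "finite (PiE ?S (\<lambda>i. {..\<alpha> i}))"
    using assms by (rule finite_PiE) (rule finite_atMost)
  moreover have "{\<beta>. \<beta> \<le> \<alpha>} \<subseteq> (\<lambda>g i. if i \<in> ?S then g i else 0) ` PiE ?S (\<lambda>i. {..\<alpha> i})"
  proof
    fix \<beta> assume "\<beta> \<in> {\<beta>. \<beta> \<le> \<alpha>}"
    then have le: "\<beta> i \<le> \<alpha> i" for i by (simp add: le_funD)
    have "\<beta> i = (if i \<in> ?S then restrict \<beta> ?S i else 0)" for i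
      using le[of i] by (cases "\<alpha> i = 0") simp_all
    then have "\<beta> = (\<lambda>i. if i \<in> ?S then restrict \<beta> ?S i else 0)" by (rule ext)
    moreover have "restrict \<beta> ?S \<in> PiE ?S (\<lambda>i. {..\<alpha> i})"
      by (rule restrict_PiE_iff[THEN iffD2]) (simp add: le)
    ultimately show "\<beta> \<in> (\<lambda>g i. if i \<in> ?S then g i else 0) ` PiE ?S (\<lambda>i. {..\<alpha> i})"
      by (rule image_eqI)
  qed
  ultimately show ?thesis by (meson finite_imageI finite_subset)
qed

lemma finite_support_le:
  fixes \<alpha> \<beta> :: mindex
  assumes "finite {i. \<alpha> i \<noteq> 0}" "\<beta> \<le> \<alpha>"
  shows "finite {i. \<beta> i \<noteq> 0}"
proof (rule finite_subset[OF _ assms(1)])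
  show "{i. \<beta> i \<noteq> 0} \<subseteq> {i. \<alpha> i \<noteq> 0}"
    using le_funD[OF assms(2)] by (metis (mono_tags, lifting) Collect_mono le_zero_eq)
qed

text \<open>The support of \<alpha> is contained in the union of those of \<beta> and \<alpha> -
  \<beta>. Hence every term of a Cauchy product at an infinitely supported \<alpha> has a zero
  factor.\<close>

lemma infinite_support_diff:
  fixes \<alpha> \<beta> :: mindex
  assumes "infinite {i. \<alpha> i \<noteq> 0}"
  shows "infinite {i. \<beta> i \<noteq> 0} \<or> infinite {i. (\<alpha> - \<beta>) i \<noteq> 0}"
proof (rule ccontr)
  assume "\<not> ?thesis"
  then have "finite ({i. \<beta> i \<noteq> 0} \<union> {i. (\<alpha> - \<beta>) i \<noteq> 0})" by simp
  moreover have "{i. \<alpha> i \<noteq> 0} \<subseteq> {i. \<beta> i \<noteq> 0} \<union> {i. (\<alpha> - \<beta>) i \<noteq> 0}" by auto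
  ultimately show False using assms finite_subset by blast
qed

text \<open>At a multi-index of infinite support the sum defining the Cauchy product ranges over an infinite
  set and is \<open>0\<close>; excluding such multi-indices makes \<open>1\<close> neutral.\<close>

typedef (overloaded) 'a mps = "{f :: mindex \<Rightarrow> 'a::zero. \<forall>\<alpha>. infinite {i. \<alpha> i \<noteq> 0} \<longrightarrow> f \<alpha> = 0}"
  morphisms coef MPS
  by (rule exI[of _ "\<lambda>_. 0"]) simp

setup_lifting type_definition_mps

lemma coef_infinite: "infinite {i. \<alpha> i \<noteq> 0} \<Longrightarrow> coef a \<alpha> = 0"
  using coef[of a] by auto

lemma mps_eqI: "(\<And>\<alpha>. finite {i. \<alpha> i \<noteq> 0} \<Longrightarrow> coef a \<alpha> = coef b \<alpha>) \<Longrightarrow> a = b"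
  by (metis coef_infinite coef_inject ext)

lift_definition mconst :: "'a::zero \<Rightarrow> 'a mps" is "\<lambda>a \<alpha>. if \<alpha> = 0 then a else 0"
  by auto

text \<open>The guard gives the value \<open>0\<close> when \<beta> has infinite support, so that
  the support condition of the type holds for all \<beta>.\<close>

lift_definition mmonom :: "mindex \<Rightarrow> 'a::{zero,one} mps" is
  "\<lambda>\<beta> \<alpha>. if \<alpha> = \<beta> \<and> finite {i. \<beta> i \<noteq> 0} then 1 else 0"
  by auto

section \<open>The ring structure on formal power series\<close>

instantiation mps :: (comm_ring_1) comm_ring_1
begin

lift_definition zero_mps :: "'a mps" is "\<lambda>_. 0" by simp
lift_definition one_mps :: "'a mps" is "\<lambda>\<alpha>. if \<alpha> = 0 then 1 else 0" by auto
lift_definition plus_mps :: "'a mps \<Rightarrow> 'a mps \<Rightarrow> 'a mps" is "\<lambda>a b \<alpha>. a \<alpha> + b \<alpha>" by auto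
lift_definition minus_mps :: "'a mps \<Rightarrow> 'a mps \<Rightarrow> 'a mps" is "\<lambda>a b \<alpha>. a \<alpha> - b \<alpha>" by auto
lift_definition uminus_mps :: "'a mps \<Rightarrow> 'a mps" is "\<lambda>a \<alpha>. - a \<alpha>" by auto
lift_definition times_mps :: "'a mps \<Rightarrow> 'a mps \<Rightarrow> 'a mps" is
  "\<lambda>a b \<alpha>. \<Sum>\<beta> | \<beta> \<le> \<alpha>. a \<beta> * b (\<alpha> - \<beta>)"
proof -
  fix a b :: "mindex \<Rightarrow> 'a" and \<alpha> :: mindex
  assume ab: "\<And>\<alpha>. infinite {i. \<alpha> i \<noteq> 0} \<Longrightarrow> a \<alpha> = 0" "\<And>\<alpha>. infinite {i. \<alpha> i \<noteq> 0} \<Longrightarrow> b \<alpha> = 0"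
    and \<alpha>: "infinite {i. \<alpha> i \<noteq> 0}"
  have "a \<beta> * b (\<alpha> - \<beta>) = 0" for \<beta>
    using infinite_support_diff[OF \<alpha>, of \<beta>] ab(1)[of \<beta>] ab(2)[of "\<alpha> - \<beta>"] by (elim disjE) simp_all
  then show "(\<Sum>\<beta> | \<beta> \<le> \<alpha>. a \<beta> * b (\<alpha> - \<beta>)) = 0"
    by (simp only: sum.neutral_const)
qed

instance
proof
  fix a b c :: "'a mps"
  show "a + b + c = a + (b + c)" by (rule mps_eqI) (simp add: plus_mps.rep_eq minus_mps.rep_eq uminus_mps.rep_eq zero_mps.rep_eq add.assoc)
  show "a + b = b + a" by (rule mps_eqI) (simp add: plus_mps.rep_eq minus_mps.rep_eq uminus_mps.rep_eq zero_mps.rep_eq add.commute)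
  show "0 + a = a" by (rule mps_eqI) (simp add: plus_mps.rep_eq minus_mps.rep_eq uminus_mps.rep_eq zero_mps.rep_eq)
  show "- a + a = 0" by (rule mps_eqI) (simp add: plus_mps.rep_eq minus_mps.rep_eq uminus_mps.rep_eq zero_mps.rep_eq)
  show "a - b = a + - b" by (rule mps_eqI) (simp add: plus_mps.rep_eq minus_mps.rep_eq uminus_mps.rep_eq zero_mps.rep_eq)
  have "coef (1 :: 'a mps) 0 \<noteq> coef 0 0"
    unfolding one_mps.rep_eq zero_mps.rep_eq by simp
  then show "0 \<noteq> (1 :: 'a mps)" by metis
  show "a * b = b * a"
  proof (rule mps_eqI)
    fix \<alpha> :: mindex
    show "coef (a * b) \<alpha> = coef (b * a) \<alpha>"
      unfolding times_mps.rep_eq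
      by (rule sum.reindex_bij_witness[of _ "\<lambda>\<beta>. \<alpha> - \<beta>" "\<lambda>\<beta>. \<alpha> - \<beta>"])
         (auto simp: mindex_diff_diff mindex_diff_le mult.commute)
  qed
  show "(a + b) * c = a * c + b * c"
    by (rule mps_eqI) (simp add: plus_mps.rep_eq times_mps.rep_eq distrib_right sum.distrib)
  show "1 * a = a"
  proof (rule mps_eqI)
    fix \<alpha> :: mindex assume "finite {i. \<alpha> i \<noteq> 0}"
    then have fin: "finite {\<beta>. \<beta> \<le> \<alpha>}" by (rule finite_mindex_le)
    have "coef (1 * a) \<alpha> = (\<Sum>\<beta> | \<beta> \<le> \<alpha>. if \<beta> = 0 then coef a (\<alpha> - \<beta>) else 0)"
      unfolding times_mps.rep_eq one_mps.rep_eq by (rule sum.cong) auto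
    also have "\<dots> = coef a (\<alpha> - 0)" using fin by (subst sum.delta) (auto simp: le_fun_def)
    finally show "coef (1 * a) \<alpha> = coef a \<alpha>" by (simp add: fun_diff_def)
  qed
  show "a * b * c = a * (b * c)"
  proof (rule mps_eqI)
    fix \<alpha> :: mindex assume f\<alpha>: "finite {i. \<alpha> i \<noteq> 0}"
    then have fin: "finite {\<beta>. \<beta> \<le> \<alpha>}" by (rule finite_mindex_le)
    have fin1: "\<beta> \<le> \<alpha> \<Longrightarrow> finite {\<gamma>. \<gamma> \<le> \<beta>}" for \<beta>
      by (rule finite_mindex_le) (rule finite_support_le[OF f\<alpha>])
    have fin2: "finite {\<gamma>. \<gamma> \<le> \<alpha> - \<beta>}" for \<beta>
      by (rule fin1) (rule mindex_diff_le)
    have "coef (a * b * c) \<alpha> = (\<Sum>\<beta> | \<beta> \<le> \<alpha>. \<Sum>\<gamma> | \<gamma> \<le> \<beta>. coef a \<gamma> * coef b (\<beta> - \<gamma>) * coef c (\<alpha> - \<beta>))"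
      unfolding times_mps.rep_eq by (simp add: sum_distrib_right)
    also have "\<dots> = (\<Sum>(\<beta>,\<gamma>)\<in>(SIGMA \<beta>:{\<beta>. \<beta> \<le> \<alpha>}. {\<gamma>. \<gamma> \<le> \<beta>}). coef a \<gamma> * coef b (\<beta> - \<gamma>) * coef c (\<alpha> - \<beta>))"
      using fin fin1 by (subst sum.Sigma) auto
    \<comment> \<open>Both sums run over decompositions of \<alpha> into three parts: the pair
      (\<beta>, \<gamma>) stands for the parts \<gamma>, \<beta> - \<gamma> and \<alpha> -
      \<beta>.\<close>
    also have "\<dots> = (\<Sum>(\<gamma>,\<delta>)\<in>(SIGMA \<gamma>:{\<gamma>. \<gamma> \<le> \<alpha>}. {\<delta>. \<delta> \<le> \<alpha> - \<gamma>}). coef a \<gamma> * (coef b \<delta> * coef c (\<alpha> - \<gamma> - \<delta>)))"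
    proof (rule sum.reindex_bij_witness[of _ "\<lambda>(\<gamma>,\<delta>). (\<gamma> + \<delta>, \<gamma>)" "\<lambda>(\<beta>,\<gamma>). (\<gamma>, \<beta> - \<gamma>)"], goal_cases)
      case (1 x) then show ?case by (auto simp: mindex_add_diff)
    next
      case (2 x) then show ?case using mindex_diff_mono order_trans by auto
    next
      case (3 x) then show ?case by (auto simp: mindex_diff_add)
    next
      case (4 x) then show ?case by (auto simp: mindex_add_le_iff mindex_le_add)
    next
      case (5 x)
      then obtain \<beta> \<gamma> where x: "x = (\<beta>, \<gamma>)" "\<beta> \<le> \<alpha>" "\<gamma> \<le> \<beta>" by auto
      then have "\<alpha> - \<gamma> - (\<beta> - \<gamma>) = \<alpha> - \<beta>" by (auto simp: le_fun_def fun_eq_iff)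
      then show ?case using x by (simp add: mult.assoc)
    qed
    also have "\<dots> = (\<Sum>\<gamma> | \<gamma> \<le> \<alpha>. \<Sum>\<delta> | \<delta> \<le> \<alpha> - \<gamma>. coef a \<gamma> * (coef b \<delta> * coef c (\<alpha> - \<gamma> - \<delta>)))"
      using fin fin2 by (subst sum.Sigma) auto
    also have "\<dots> = coef (a * (b * c)) \<alpha>"
      unfolding times_mps.rep_eq by (simp add: sum_distrib_left)
    finally show "coef (a * b * c) \<alpha> = coef (a * (b * c)) \<alpha>" .
  qed
qed

end

lemma coef_zero [simp]: "coef 0 \<alpha> = 0" by (simp add: zero_mps.rep_eq)
lemma coef_add [simp]: "coef (a + b) \<alpha> = coef a \<alpha> + coef b \<alpha>" by (simp add: plus_mps.rep_eq)
lemma coef_diff [simp]: "coef (a - b) \<alpha> = coef a \<alpha> - coef b \<alpha>" by (simp add: minus_mps.rep_eq)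
lemma coef_sum [simp]: "coef (sum f S) \<alpha> = (\<Sum>x\<in>S. coef (f x) \<alpha>)"
  by (induction S rule: infinite_finite_induct) auto

lemma coef_mconst: "coef (mconst a) \<alpha> = (if \<alpha> = 0 then a else 0)"
  by (simp add: mconst.rep_eq)

lemma one_eq_mconst: "1 = mconst 1"
  by (rule mps_eqI) (simp add: one_mps.rep_eq mconst.rep_eq)

lemma mconst_add: "mconst (a + b) = mconst a + mconst b" for a b :: "'a::comm_ring_1"
  by (rule mps_eqI) (simp add: mconst.rep_eq)

lemma mconst_diff: "mconst (a - b) = mconst a - mconst b" for a b :: "'a::comm_ring_1"
  by (rule mps_eqI) (simp add: mconst.rep_eq)

lemma mconst_0 [simp]: "mconst 0 = (0 :: 'a::comm_ring_1 mps)"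
  by (rule mps_eqI) (simp add: mconst.rep_eq)

lemma coef_mconst_mult [simp]: "coef (mconst a * b) \<alpha> = a * coef b \<alpha>" for a :: "'a::comm_ring_1"
proof (cases "finite {i. \<alpha> i \<noteq> 0}")
  case True
  then have fin: "finite {\<beta>. \<beta> \<le> \<alpha>}" by (rule finite_mindex_le)
  have "coef (mconst a * b) \<alpha> = (\<Sum>\<beta> | \<beta> \<le> \<alpha>. if \<beta> = 0 then a * coef b (\<alpha> - \<beta>) else 0)"
    unfolding times_mps.rep_eq mconst.rep_eq by (rule sum.cong) auto
  also have "\<dots> = a * coef b (\<alpha> - 0)" using fin by (subst sum.delta) (auto simp: le_fun_def)
  finally show ?thesis by (simp add: fun_diff_def)
qed (simp add: coef_infinite)

lemma mconst_mult: "mconst (a * b) = mconst a * mconst b" for a b :: "'a::comm_ring_1"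
  by (rule mps_eqI) (simp add: coef_mconst)

lemma coef_mmonom_mult:
  fixes a :: "'a::comm_ring_1 mps"
  assumes "finite {i. \<beta> i \<noteq> 0}"
  shows "coef (mmonom \<beta> * a) \<alpha> = (if \<beta> \<le> \<alpha> then coef a (\<alpha> - \<beta>) else 0)"
proof (cases "finite {i. \<alpha> i \<noteq> 0}")
  case True
  then have fin: "finite {\<beta>. \<beta> \<le> \<alpha>}" by (rule finite_mindex_le)
  have "coef (mmonom \<beta> * a) \<alpha> = (\<Sum>\<gamma> | \<gamma> \<le> \<alpha>. if \<gamma> = \<beta> then coef a (\<alpha> - \<gamma>) else 0)"
    unfolding times_mps.rep_eq mmonom.rep_eq using assms by (intro sum.cong) auto
  also have "\<dots> = (if \<beta> \<le> \<alpha> then coef a (\<alpha> - \<beta>) else 0)" using fin by (subst sum.delta) auto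
  finally show ?thesis .
next
  case False
  have "coef a (\<alpha> - \<beta>) = 0"
    using infinite_support_diff[OF False, of \<beta>] assms coef_infinite by blast
  then show ?thesis using False by (simp add: coef_infinite)
qed

lemma mmonom_0: "mmonom 0 = (1 :: 'a::comm_ring_1 mps)"
  by (rule mps_eqI) (simp add: one_mps.rep_eq mmonom.rep_eq)

lemma mmonom_add:
  assumes "finite {i. \<beta> i \<noteq> 0}" "finite {i. \<gamma> i \<noteq> 0}"
  shows "mmonom (\<beta> + \<gamma>) = (mmonom \<beta> * mmonom \<gamma> :: 'a::comm_ring_1 mps)"
proof (rule mps_eqI)
  fix \<alpha> :: mindex
  have "finite {i. (\<beta> + \<gamma>) i \<noteq> 0}"
    by (rule finite_subset[OF _ finite_UnI[OF assms]]) auto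
  moreover have "\<beta> \<le> \<alpha> \<and> \<alpha> - \<beta> = \<gamma> \<longleftrightarrow> \<alpha> = \<beta> + \<gamma>"
    by (metis mindex_add_diff mindex_diff_add mindex_le_add)
  ultimately show "coef (mmonom (\<beta> + \<gamma>)) \<alpha> = coef (mmonom \<beta> * mmonom \<gamma> :: 'a mps) \<alpha>"
    using assms by (auto simp: coef_mmonom_mult mmonom.rep_eq)
qed

section \<open>Determinants and ideals\<close>

text \<open>Convergent series will be a subset of a type of formal series, so subrings are sets
  inside a ring type. Closure under differences yields zero, negatives and sums at once.\<close>

locale subring_on =
  fixes A :: "'a::comm_ring_1 set"
  assumes one_closed: "1 \<in> A"
    and diff_closed: "x \<in> A \<Longrightarrow> y \<in> A \<Longrightarrow> x - y \<in> A"
    and mult_closed: "x \<in> A \<Longrightarrow> y \<in> A \<Longrightarrow> x * y \<in> A"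
begin

lemma zero_closed: "0 \<in> A"
  using diff_closed[OF one_closed one_closed] by simp

lemma uminus_closed: "x \<in> A \<Longrightarrow> - x \<in> A"
  using diff_closed[OF zero_closed] by simp

lemma add_closed: "x \<in> A \<Longrightarrow> y \<in> A \<Longrightarrow> x + y \<in> A"
  using diff_closed[OF _ uminus_closed] by fastforce

lemma sum_closed: "(\<And>i. i \<in> S \<Longrightarrow> f i \<in> A) \<Longrightarrow> sum f S \<in> A"
  by (induction S rule: infinite_finite_induct) (auto simp: zero_closed add_closed)

lemma prod_closed: "(\<And>i. i \<in> S \<Longrightarrow> f i \<in> A) \<Longrightarrow> prod f S \<in> A"
  by (induction S rule: infinite_finite_induct) (auto simp: one_closed mult_closed)

lemma power_closed: "x \<in> A \<Longrightarrow> x ^ n \<in> A"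
  by (induction n) (auto simp: one_closed mult_closed)

lemma sign_closed: "of_int (sign \<pi>) \<in> A"
  by (cases rule: sign_cases[of \<pi>]) (auto simp: one_closed uminus_closed)

end

locale ideal_on = subring_on A for A :: "'a::comm_ring_1 set" +
  fixes I :: "'a set"
  assumes ideal_subset: "I \<subseteq> A"
    and ideal_zero: "0 \<in> I"
    and ideal_add: "x \<in> I \<Longrightarrow> y \<in> I \<Longrightarrow> x + y \<in> I"
    and ideal_mult: "a \<in> A \<Longrightarrow> x \<in> I \<Longrightarrow> a * x \<in> I"
begin

lemma ideal_sum: "(\<And>i. i \<in> S \<Longrightarrow> f i \<in> I) \<Longrightarrow> sum f S \<in> I"
  by (induction S rule: infinite_finite_induct) (auto simp: ideal_zero ideal_add)

text \<open>Exchange one factor at a time: each exchange alters the product by a multiple of some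
  \<open>f i - g i\<close>.\<close>

lemma ideal_prod_diff:
  assumes "finite S" "\<And>i. i \<in> S \<Longrightarrow> f i \<in> A" "\<And>i. i \<in> S \<Longrightarrow> g i \<in> A"
    and "\<And>i. i \<in> S \<Longrightarrow> f i - g i \<in> I"
  shows "prod f S - prod g S \<in> I"
  using assms
proof (induction S rule: finite_induct)
  case (insert i S)
  have "prod f (insert i S) - prod g (insert i S) = prod f S * (f i - g i) + g i * (prod f S - prod g S)"
    using insert by (simp add: algebra_simps)
  also have "\<dots> \<in> I"
    using insert by (intro ideal_add ideal_mult prod_closed) auto
  finally show ?case .
qed (simp add: ideal_zero)

end

section \<open>Leibniz determinants: multilinearity and vanishing\<close>

definition ldet :: "nat \<Rightarrow> (nat \<Rightarrow> nat \<Rightarrow> 'a::comm_ring_1) \<Rightarrow> 'a" where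
  "ldet m M = (\<Sum>\<pi> | \<pi> permutes {..<m}. of_int (sign \<pi>) * (\<Prod>i<m. M i (\<pi> i)))"

text \<open>Inverting the summation permutation exchanges rows and columns and preserves
  signs.\<close>

lemma ldet_transpose: "ldet m (\<lambda>i j. M j i) = ldet m M"
proof -
  have "ldet m M = (\<Sum>\<pi> | \<pi> permutes {..<m}. of_int (sign (inv_into UNIV \<pi>)) * (\<Prod>i<m. M i (inv_into UNIV \<pi> i)))"
    unfolding ldet_def by (rule sum_permutations_inverse)
  also have "\<dots> = (\<Sum>\<pi> | \<pi> permutes {..<m}. of_int (sign \<pi>) * (\<Prod>i<m. M (\<pi> i) i))"
  proof (rule sum.cong[OF refl])
    fix \<pi> assume "\<pi> \<in> {\<pi>. \<pi> permutes {..<m}}"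
    then have \<pi>: "\<pi> permutes {..<m}" by simp
    have "(\<Prod>i<m. M i (inv_into UNIV \<pi> i)) = (\<Prod>i<m. M (\<pi> i) i)"
      using prod.permute[OF \<pi>, of "\<lambda>i. M i (inv_into UNIV \<pi> i)"] by (simp add: o_def permutes_inverses[OF \<pi>])
    moreover have "sign (inv_into UNIV \<pi>) = sign \<pi>"
      using \<pi> by (intro sign_inverse) (auto simp: permutation_permutes)
    ultimately show "of_int (sign (inv_into UNIV \<pi>)) * (\<Prod>i<m. M i (inv_into UNIV \<pi> i)) = of_int (sign \<pi>) * (\<Prod>i<m. M (\<pi> i) i)"
      by simp
  qed
  finally show ?thesis unfolding ldet_def by simp
qed

text \<open>Composing with the transposition of \<open>j\<close> and \<open>k\<close> fixes every
  product but reverses every sign, so the determinant equals its own negative. The first assumption,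
  absence of 2-torsion, then makes it vanish.\<close>

lemma ldet_equal_columns:
  fixes M :: "nat \<Rightarrow> nat \<Rightarrow> 'a::comm_ring_1"
  assumes "\<And>x::'a. x + x = 0 \<Longrightarrow> x = 0"
    and "j < m" "k < m" "j \<noteq> k" "\<And>i. i < m \<Longrightarrow> M i j = M i k"
  shows "ldet m M = 0"
proof -
  let ?\<tau> = "Transposition.transpose j k"
  have \<tau>: "?\<tau> permutes {..<m}" using assms by (auto intro: permutes_swap_id)
  have "ldet m M = (\<Sum>\<pi> | \<pi> permutes {..<m}. of_int (sign (?\<tau> \<circ> \<pi>)) * (\<Prod>i<m. M i ((?\<tau> \<circ> \<pi>) i)))"
    unfolding ldet_def by (rule setum_permutations_compose_left[OF \<tau>])
  also have "\<dots> = (\<Sum>\<pi> | \<pi> permutes {..<m}. - (of_int (sign \<pi>) * (\<Prod>i<m. M i (\<pi> i))))"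
  proof (rule sum.cong[OF refl])
    fix \<pi> assume "\<pi> \<in> {\<pi>. \<pi> permutes {..<m}}"
    then have "permutation \<pi>" by (auto simp: permutation_permutes)
    then have "sign (?\<tau> \<circ> \<pi>) = - sign \<pi>"
      using assms by (subst sign_compose) (auto simp: sign_swap_id permutation_swap_id)
    moreover have "(\<Prod>i<m. M i ((?\<tau> \<circ> \<pi>) i)) = (\<Prod>i<m. M i (\<pi> i))"
      using assms by (intro prod.cong) (auto simp: Transposition.transpose_def)
    ultimately show "of_int (sign (?\<tau> \<circ> \<pi>)) * (\<Prod>i<m. M i ((?\<tau> \<circ> \<pi>) i)) = - (of_int (sign \<pi>) * (\<Prod>i<m. M i (\<pi> i)))"
      by simp
  qed
  also have "\<dots> = - ldet m M" unfolding ldet_def by (simp add: sum_negf)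
  finally have "ldet m M + ldet m M = 0" by simp
  then show ?thesis using assms(1) by blast
qed

lemma ldet_not_inj_columns:
  fixes M :: "nat \<Rightarrow> 'b \<Rightarrow> 'a::comm_ring_1"
  assumes "\<And>x::'a. x + x = 0 \<Longrightarrow> x = 0" and "\<not> inj_on c {..<m}"
  shows "ldet m (\<lambda>i j. M i (c j)) = 0"
proof -
  obtain j k where "j < m" "k < m" "j \<noteq> k" "c j = c k"
    using assms(2) unfolding inj_on_def by auto
  then show ?thesis using assms(1) by (intro ldet_equal_columns[of j m k]) auto
qed

lemma ldet_not_inj_rows:
  fixes M :: "'b \<Rightarrow> nat \<Rightarrow> 'a::comm_ring_1"
  assumes "\<And>x::'a. x + x = 0 \<Longrightarrow> x = 0" and "\<not> inj_on b {..<m}"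
  shows "ldet m (\<lambda>i j. M (b i) j) = 0"
  by (subst ldet_transpose[symmetric]) (rule ldet_not_inj_columns[OF assms])

text \<open>Multilinearity: \<kappa> chooses one summand from each row. Non-injective choices remain
  in the sum; they are disposed of by \<open>ldet_not_inj_rows\<close>.\<close>

lemma ldet_expand_rows:
  fixes P :: "nat \<Rightarrow> 'b \<Rightarrow> 'a::comm_ring_1"
  assumes "finite K"
  shows "ldet m (\<lambda>i j. \<Sum>k\<in>K. P i k * F k j) =
    (\<Sum>\<kappa>\<in>{..<m} \<rightarrow>\<^sub>E K. (\<Prod>i<m. P i (\<kappa> i)) * ldet m (\<lambda>i j. F (\<kappa> i) j))"
proof -
  have "ldet m (\<lambda>i j. \<Sum>k\<in>K. P i k * F k j) =
      (\<Sum>\<pi> | \<pi> permutes {..<m}. \<Sum>\<kappa>\<in>{..<m} \<rightarrow>\<^sub>E K.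
         of_int (sign \<pi>) * ((\<Prod>i<m. P i (\<kappa> i)) * (\<Prod>i<m. F (\<kappa> i) (\<pi> i))))"
    unfolding ldet_def using assms
    by (simp add: prod_sum_PiE sum_distrib_left prod.distrib)
  also have "\<dots> = (\<Sum>\<kappa>\<in>{..<m} \<rightarrow>\<^sub>E K. (\<Prod>i<m. P i (\<kappa> i)) * ldet m (\<lambda>i j. F (\<kappa> i) j))"
    unfolding ldet_def by (subst sum.swap) (simp add: sum_distrib_left mult.left_commute)
  finally show ?thesis .
qed

lemma ldet_expand_columns:
  fixes Q :: "'b \<Rightarrow> nat \<Rightarrow> 'a::comm_ring_1"
  assumes "finite L"
  shows "ldet m (\<lambda>i j. \<Sum>l\<in>L. F i l * Q l j) =
    (\<Sum>\<kappa>\<in>{..<m} \<rightarrow>\<^sub>E L. (\<Prod>j<m. Q (\<kappa> j) j) * ldet m (\<lambda>i j. F i (\<kappa> j)))"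
proof -
  have "ldet m (\<lambda>i j. \<Sum>l\<in>L. F i l * Q l j) = ldet m (\<lambda>i j. \<Sum>l\<in>L. Q l i * F j l)"
    by (subst ldet_transpose[symmetric]) (simp add: mult.commute)
  also have "\<dots> = (\<Sum>\<kappa>\<in>{..<m} \<rightarrow>\<^sub>E L. (\<Prod>j<m. Q (\<kappa> j) j) * ldet m (\<lambda>i j. F j (\<kappa> i)))"
    by (rule ldet_expand_rows[OF assms])
  also have "\<dots> = (\<Sum>\<kappa>\<in>{..<m} \<rightarrow>\<^sub>E L. (\<Prod>j<m. Q (\<kappa> j) j) * ldet m (\<lambda>i j. F i (\<kappa> j)))"
    by (subst ldet_transpose[symmetric]) simp
  finally show ?thesis .
qed

context subring_on
begin

lemma ldet_closed:
  assumes "\<And>i j. i < m \<Longrightarrow> j < m \<Longrightarrow> M i j \<in> A"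
  shows "ldet m M \<in> A"
  unfolding ldet_def
proof (intro sum_closed mult_closed sign_closed prod_closed)
  fix \<pi> i assume "\<pi> \<in> {\<pi>. \<pi> permutes {..<m}}" "i \<in> {..<m}"
  then show "M i (\<pi> i) \<in> A"
    using permutes_in_image[of \<pi> "{..<m}" i] assms by auto
qed

end

context ideal_on
begin

text \<open>The determinant is a polynomial in the entries with integer coefficients, so congruent
  entries give congruent determinants.\<close>

lemma ideal_ldet_diff:
  assumes "\<And>i j. i < m \<Longrightarrow> j < m \<Longrightarrow> M i j \<in> A" "\<And>i j. i < m \<Longrightarrow> j < m \<Longrightarrow> N i j \<in> A"
    and "\<And>i j. i < m \<Longrightarrow> j < m \<Longrightarrow> M i j - N i j \<in> I"
  shows "ldet m M - ldet m N \<in> I"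
proof -
  have "(\<Prod>i<m. M i (\<pi> i)) - (\<Prod>i<m. N i (\<pi> i)) \<in> I" if "\<pi> permutes {..<m}" for \<pi>
    using permutes_in_image[OF that] assms by (intro ideal_prod_diff) auto
  then show ?thesis
    unfolding ldet_def sum_subtractf[symmetric] right_diff_distrib[symmetric]
    by (intro ideal_sum ideal_mult sign_closed) auto
qed

text \<open>A Cauchy-Binet argument without collecting equal minors: expanding the columns and then
  the rows leaves a combination of minors of \<open>F\<close>. Injective choices of rows and columns
  are covered by the last assumption, and all others give determinant zero. Only membership in the
  ideal matters, so no exact formula is derived.\<close>

lemma ideal_ldet_product:
  fixes P :: "nat \<Rightarrow> 'b \<Rightarrow> 'a" and Q :: "'c \<Rightarrow> nat \<Rightarrow> 'a"
  assumes two: "\<And>x::'a. x + x = 0 \<Longrightarrow> x = 0" and fin: "finite K" "finite L"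
    and P: "\<And>i k. k \<in> K \<Longrightarrow> P i k \<in> A" and Q: "\<And>l j. l \<in> L \<Longrightarrow> Q l j \<in> A"
    and minors: "\<And>b c. inj_on b {..<m} \<Longrightarrow> b ` {..<m} \<subseteq> K \<Longrightarrow> inj_on c {..<m} \<Longrightarrow> c ` {..<m} \<subseteq> L
      \<Longrightarrow> ldet m (\<lambda>i j. F (b i) (c j)) \<in> I"
  shows "ldet m (\<lambda>i j. \<Sum>l\<in>L. (\<Sum>k\<in>K. P i k * F k l) * Q l j) \<in> I"
proof -
  have *: "ldet m (\<lambda>i j. F (b i) (c j)) \<in> I" if "b \<in> {..<m} \<rightarrow>\<^sub>E K" "c \<in> {..<m} \<rightarrow>\<^sub>E L" for b c
  proof (cases "inj_on b {..<m} \<and> inj_on c {..<m}")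
    case True
    then show ?thesis using that by (intro minors) auto
  next
    case False
    then have "ldet m (\<lambda>i j. F (b i) (c j)) = 0"
      using ldet_not_inj_rows[OF two, of b m "\<lambda>k j. F k (c j)"]
        ldet_not_inj_columns[OF two, of c m "\<lambda>i l. F (b i) l"] by blast
    then show ?thesis by (simp add: ideal_zero)
  qed
  have "(\<Prod>j<m. Q (c j) j) * ldet m (\<lambda>i j. \<Sum>k\<in>K. P i k * F k (c j)) \<in> I" if "c \<in> {..<m} \<rightarrow>\<^sub>E L" for c
    unfolding ldet_expand_rows[OF fin(1), of m P "\<lambda>k j. F k (c j)"]
    using that by (intro ideal_mult prod_closed ideal_sum P Q *) auto
  then show ?thesis
    unfolding ldet_expand_columns[OF fin(2), of m "\<lambda>i l. \<Sum>k\<in>K. P i k * F k l" Q]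
    by (intro ideal_sum)
qed

end

section \<open>Convergent power series\<close>

lemma MI_finite: "\<alpha> \<in> MI d \<Longrightarrow> finite {i. \<alpha> i \<noteq> 0}"
  by (rule finite_subset[of _ "{..<d}"]) (auto simp: MI_def intro: ccontr)

lemma MI_zero: "0 \<in> MI d" and MI_add_iff: "\<alpha> + \<beta> \<in> MI d \<longleftrightarrow> \<alpha> \<in> MI d \<and> \<beta> \<in> MI d"
  and MI_diff: "\<alpha> \<in> MI d \<Longrightarrow> \<alpha> - \<beta> \<in> MI d"
  by (auto simp: MI_def)

lemma MI_le: "\<beta> \<le> \<alpha> \<Longrightarrow> \<alpha> \<in> MI d \<Longrightarrow> \<beta> \<in> MI d"
  by (metis MI_add_iff mindex_add_diff)

lemma mdeg_add: "mdeg d (\<alpha> + \<beta>) = mdeg d \<alpha> + mdeg d \<beta>"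
  by (simp add: mdeg_def sum.distrib)

lemma mdeg_diff: "\<beta> \<le> \<alpha> \<Longrightarrow> mdeg d \<alpha> = mdeg d \<beta> + mdeg d (\<alpha> - \<beta>)"
  by (metis mdeg_add mindex_add_diff)

lemma mdeg_zero [simp]: "mdeg d 0 = 0"
  by (simp add: mdeg_def)

lemma mdeg_eq_0_iff:
  assumes "\<alpha> \<in> MI d"
  shows "mdeg d \<alpha> = 0 \<longleftrightarrow> \<alpha> = 0"
proof
  assume \<alpha>: "mdeg d \<alpha> = 0"
  show "\<alpha> = 0"
  proof (rule ext)
    fix i show "\<alpha> i = 0 i"
      using assms \<alpha> by (cases "i < d") (auto simp: mdeg_def MI_def)
  qed
qed simp

lemma finite_MI_mdeg: "finite {\<alpha> \<in> MI d. mdeg d \<alpha> \<le> n}"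
proof (rule finite_subset)
  show "finite ((\<lambda>g i. if i < d then g i else 0) ` ({..<d} \<rightarrow>\<^sub>E {..n}))"
    by (intro finite_imageI finite_PiE) auto
  show "{\<alpha> \<in> MI d. mdeg d \<alpha> \<le> n} \<subseteq> (\<lambda>g i. if i < d then g i else 0) ` ({..<d} \<rightarrow>\<^sub>E {..n})"
  proof
    fix \<alpha> assume \<alpha>: "\<alpha> \<in> {\<alpha> \<in> MI d. mdeg d \<alpha> \<le> n}"
    have "\<alpha> i \<le> n" if "i < d" for i
      using \<alpha> member_le_sum[of i "{..<d}" \<alpha>] that by (auto simp: mdeg_def)
    then have "restrict \<alpha> {..<d} \<in> {..<d} \<rightarrow>\<^sub>E {..n}" by auto
    moreover have "\<alpha> = (\<lambda>i. if i < d then restrict \<alpha> {..<d} i else 0)"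
      using \<alpha> by (auto simp: MI_def fun_eq_iff)
    ultimately show "\<alpha> \<in> (\<lambda>g i. if i < d then g i else 0) ` ({..<d} \<rightarrow>\<^sub>E {..n})"
      by (intro image_eqI)
  qed
qed

section \<open>Closure of the convergent series under the ring operations\<close>

lemma conv_series_MI: "c \<in> conv_series d \<Longrightarrow> \<alpha> \<notin> MI d \<Longrightarrow> c \<alpha> = 0"
  by (auto simp: conv_series_def)

lemma conv_seriesI:
  assumes "\<And>\<alpha>. \<alpha> \<notin> MI d \<Longrightarrow> c \<alpha> = 0" "0 < r" "(\<lambda>\<alpha>. norm (c \<alpha>) * r ^ mdeg d \<alpha>) summable_on UNIV"
  shows "c \<in> conv_series d"
  unfolding conv_series_def using assms by blast

lemma conv_summable_mono:
  fixes c :: pseries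
  assumes "(\<lambda>\<alpha>. norm (c \<alpha>) * r ^ mdeg d \<alpha>) summable_on UNIV" "0 < s" "s \<le> r"
  shows "(\<lambda>\<alpha>. norm (c \<alpha>) * s ^ mdeg d \<alpha>) summable_on UNIV"
  using assms
  by (intro summable_on_comparison_test[OF assms(1)] mult_left_mono power_mono) auto

lemma conv_series_common_radius:
  assumes "a \<in> conv_series d" "b \<in> conv_series d"
  obtains r where "0 < r" "(\<lambda>\<alpha>. norm (a \<alpha>) * r ^ mdeg d \<alpha>) summable_on UNIV"
    "(\<lambda>\<alpha>. norm (b \<alpha>) * r ^ mdeg d \<alpha>) summable_on UNIV"
proof -
  obtain r s where "0 < r" "(\<lambda>\<alpha>. norm (a \<alpha>) * r ^ mdeg d \<alpha>) summable_on UNIV"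
    "0 < s" "(\<lambda>\<alpha>. norm (b \<alpha>) * s ^ mdeg d \<alpha>) summable_on UNIV"
    using assms by (auto simp: conv_series_def)
  then show ?thesis
    by (intro that[of "min r s"]) (auto elim!: conv_summable_mono)
qed

lemma conv_series_finite:
  assumes "finite {\<alpha>. c \<alpha> \<noteq> 0}" "\<And>\<alpha>. c \<alpha> \<noteq> 0 \<Longrightarrow> \<alpha> \<in> MI d"
  shows "c \<in> conv_series d"
proof -
  have "(\<lambda>\<alpha>. norm (c \<alpha>) * 1 ^ mdeg d \<alpha>) summable_on UNIV"
    by (rule finite_nonzero_values_imp_summable_on) (use assms(1) in simp)
  then show ?thesis
    using assms(2) by (intro conv_seriesI[of d _ 1]) auto
qed

lemma conv_series_diff:
  assumes "a \<in> conv_series d" "b \<in> conv_series d"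
  shows "(\<lambda>\<alpha>. a \<alpha> - b \<alpha>) \<in> conv_series d"
proof -
  obtain r where r: "0 < r" "(\<lambda>\<alpha>. norm (a \<alpha>) * r ^ mdeg d \<alpha>) summable_on UNIV"
    "(\<lambda>\<alpha>. norm (b \<alpha>) * r ^ mdeg d \<alpha>) summable_on UNIV"
    using conv_series_common_radius[OF assms] .
  have "(\<lambda>\<alpha>. norm (a \<alpha> - b \<alpha>) * r ^ mdeg d \<alpha>) summable_on UNIV"
  proof (rule summable_on_comparison_test[OF summable_on_add[OF r(2,3)]])
    fix \<alpha>
    show "norm (a \<alpha> - b \<alpha>) * r ^ mdeg d \<alpha> \<le> norm (a \<alpha>) * r ^ mdeg d \<alpha> + norm (b \<alpha>) * r ^ mdeg d \<alpha>"
      unfolding distrib_right[symmetric] using r(1) by (intro mult_right_mono norm_triangle_ineq4) auto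
  qed (use r(1) in auto)
  then show ?thesis
    using r(1) by (intro conv_seriesI[of d _ r]) (auto simp: conv_series_MI[OF assms(1)] conv_series_MI[OF assms(2)])
qed

lemma ps_mult_coef: "ps_mult (coef a) (coef b) = coef (a * b)"
  by (simp add: ps_mult_def times_mps.rep_eq fun_diff_def)

text \<open>The norm \<Sum> |c_\<alpha>| r^|\<alpha>| is submultiplicative: partial sums for the
  product are bounded by the product of the two full sums at a common radius.\<close>

lemma conv_series_mult:
  assumes a: "coef a \<in> conv_series d" and b: "coef b \<in> conv_series d"
  shows "coef (a * b) \<in> conv_series d"
proof -
  obtain r where r: "0 < r" "(\<lambda>\<alpha>. norm (coef a \<alpha>) * r ^ mdeg d \<alpha>) summable_on UNIV"
    "(\<lambda>\<alpha>. norm (coef b \<alpha>) * r ^ mdeg d \<alpha>) summable_on UNIV"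
    using conv_series_common_radius[OF assms] .
  define p q where "p \<equiv> \<lambda>\<alpha>. norm (coef a \<alpha>) * r ^ mdeg d \<alpha>"
    and "q \<equiv> \<lambda>\<alpha>. norm (coef b \<alpha>) * r ^ mdeg d \<alpha>"
  have nonneg: "p \<alpha> \<ge> 0" "q \<alpha> \<ge> 0" for \<alpha> using r(1) by (auto simp: p_def q_def)
  have coeff: "norm (coef (a * b) \<alpha>) * r ^ mdeg d \<alpha> \<le> (\<Sum>\<beta> | \<beta> \<le> \<alpha>. p \<beta> * q (\<alpha> - \<beta>))" for \<alpha>
  proof -
    have "norm (coef (a * b) \<alpha>) * r ^ mdeg d \<alpha> \<le> (\<Sum>\<beta> | \<beta> \<le> \<alpha>. norm (coef a \<beta> * coef b (\<alpha> - \<beta>))) * r ^ mdeg d \<alpha>"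
      unfolding times_mps.rep_eq using r(1) by (intro mult_right_mono norm_sum) auto
    also have "\<dots> = (\<Sum>\<beta> | \<beta> \<le> \<alpha>. p \<beta> * q (\<alpha> - \<beta>))"
      unfolding sum_distrib_right
    proof (rule sum.cong[OF refl])
      fix \<beta> assume "\<beta> \<in> {\<beta>. \<beta> \<le> \<alpha>}"
      then have "mdeg d \<alpha> = mdeg d \<beta> + mdeg d (\<alpha> - \<beta>)" by (simp add: mdeg_diff)
      then show "norm (coef a \<beta> * coef b (\<alpha> - \<beta>)) * r ^ mdeg d \<alpha> = p \<beta> * q (\<alpha> - \<beta>)"
        by (simp add: p_def q_def norm_mult power_add)
    qed
    finally show ?thesis .
  qed
  have bound: "(\<Sum>\<alpha>\<in>F. norm (coef (a * b) \<alpha>) * r ^ mdeg d \<alpha>) \<le> infsum p UNIV * infsum q UNIV"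
    if "finite F" for F
  proof -
    \<comment> \<open>Indices of infinite support carry zero coefficients; dropping them makes all
      inner sums finite.\<close>
    define G where "G = {\<alpha>\<in>F. finite {i. \<alpha> i \<noteq> 0}}"
    define U where "U = (SIGMA \<alpha>:G. {\<beta>. \<beta> \<le> \<alpha>})"
    define h where "h = (\<lambda>(\<alpha>, \<beta>). (\<beta>, \<alpha> - \<beta>) :: mindex \<times> mindex)"
    have fin: "finite G" "\<And>\<alpha>. \<alpha> \<in> G \<Longrightarrow> finite {\<beta>. \<beta> \<le> \<alpha>}"
      using that by (auto simp: G_def intro: finite_mindex_le)
    then have finU: "finite U" by (auto simp: U_def)
    have inj: "inj_on h U"
    proof (rule inj_onI)
      fix x y assume xy: "x \<in> U" "y \<in> U" "h x = h y"
      obtain \<alpha> \<beta> \<alpha>' \<beta>' where eqs: "x = (\<alpha>, \<beta>)" "y = (\<alpha>', \<beta>')" by (metis surj_pair)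
      have le: "\<beta> \<le> \<alpha>" "\<beta>' \<le> \<alpha>'" using xy(1,2) unfolding eqs U_def by simp_all
      have eq: "\<beta> = \<beta>'" "\<alpha> - \<beta> = \<alpha>' - \<beta>'" using xy(3) unfolding eqs h_def by auto
      have "\<alpha> = \<beta> + (\<alpha> - \<beta>)" by (simp only: mindex_add_diff[OF le(1)])
      also have "\<dots> = \<beta>' + (\<alpha>' - \<beta>')" by (rule arg_cong2[of _ _ _ _ "(+)", OF eq])
      also have "\<dots> = \<alpha>'" by (simp only: mindex_add_diff[OF le(2)])
      finally show "x = y" unfolding eqs using eq(1) by simp
    qed
    have "(\<Sum>\<alpha>\<in>F. norm (coef (a * b) \<alpha>) * r ^ mdeg d \<alpha>) = (\<Sum>\<alpha>\<in>G. norm (coef (a * b) \<alpha>) * r ^ mdeg d \<alpha>)"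
      using that by (intro sum.mono_neutral_right) (auto simp: G_def coef_infinite)
    also have "\<dots> \<le> (\<Sum>\<alpha>\<in>G. \<Sum>\<beta> | \<beta> \<le> \<alpha>. p \<beta> * q (\<alpha> - \<beta>))"
      by (intro sum_mono coeff)
    also have "\<dots> = (\<Sum>(\<alpha>,\<beta>)\<in>U. p \<beta> * q (\<alpha> - \<beta>))"
      unfolding U_def using fin by (intro sum.Sigma) auto
    also have "\<dots> = (\<Sum>(\<beta>,\<gamma>)\<in>h ` U. p \<beta> * q \<gamma>)"
      by (subst sum.reindex[OF inj]) (simp add: h_def case_prod_unfold)
    \<comment> \<open>Enlarging the index set to a rectangle only adds nonnegative terms and lets
      the double sum factor.\<close>
    also have "\<dots> \<le> (\<Sum>(\<beta>,\<gamma>)\<in>fst ` h ` U \<times> snd ` h ` U. p \<beta> * q \<gamma>)"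
    proof (rule sum_mono2)
      show "finite (fst ` h ` U \<times> snd ` h ` U)" using finU by simp
      show "h ` U \<subseteq> fst ` h ` U \<times> snd ` h ` U" by (simp add: subset_fst_snd)
    qed (use nonneg in auto)
    also have "\<dots> = sum p (fst ` h ` U) * sum q (snd ` h ` U)"
      by (simp add: sum_product sum.cartesian_product)
    also have "\<dots> \<le> infsum p UNIV * infsum q UNIV"
      using finU nonneg r(2,3)
      by (intro mult_mono finite_sum_le_infsum infsum_nonneg sum_nonneg) (auto simp: p_def q_def)
    finally show ?thesis .
  qed
  have "(\<lambda>\<alpha>. norm (coef (a * b) \<alpha>) * r ^ mdeg d \<alpha>) summable_on UNIV"
    using r(1) bound by (intro nonneg_bdd_above_summable_on bdd_aboveI2[where M = "infsum p UNIV * infsum q UNIV"]) auto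
  moreover have "\<alpha> \<in> MI d" if "coef (a * b) \<alpha> \<noteq> 0" for \<alpha>
  proof -
    have "\<exists>\<beta>\<in>{\<beta>. \<beta> \<le> \<alpha>}. coef a \<beta> * coef b (\<alpha> - \<beta>) \<noteq> 0"
      using that unfolding times_mps.rep_eq by (metis (no_types, lifting) sum.neutral)
    then obtain \<beta> where \<beta>: "\<beta> \<le> \<alpha>" "coef a \<beta> \<noteq> 0" "coef b (\<alpha> - \<beta>) \<noteq> 0" by auto
    then have "\<beta> + (\<alpha> - \<beta>) \<in> MI d"
      unfolding MI_add_iff using conv_series_MI[OF a] conv_series_MI[OF b] by blast
    then show ?thesis by (simp only: mindex_add_diff[OF \<beta>(1)])
  qed
  ultimately show ?thesis
    using r(1) by (intro conv_seriesI[of d _ r]) auto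
qed

text \<open>Halving the radius absorbs the factor 2^|\<alpha>|. This serves both divided
  derivatives, whose binomial coefficients grow that fast, and division by a variable.\<close>

lemma conv_series_shift:
  assumes c: "c \<in> conv_series d" and le: "\<And>\<alpha>. norm (b \<alpha>) \<le> K * 2 ^ mdeg d \<alpha> * norm (c (\<alpha> + \<gamma>))" and "K \<ge> 0"
  shows "b \<in> conv_series d"
proof -
  obtain r where r: "0 < r" "(\<lambda>\<alpha>. norm (c \<alpha>) * r ^ mdeg d \<alpha>) summable_on UNIV"
    using c by (auto simp: conv_series_def)
  have "inj_on (\<lambda>\<alpha>. \<alpha> + \<gamma>) UNIV" by (simp add: inj_on_def)
  moreover have "(\<lambda>\<alpha>. norm (c \<alpha>) * r ^ mdeg d \<alpha>) summable_on range (\<lambda>\<alpha>. \<alpha> + \<gamma>)"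
    using summable_on_subset_banach[OF r(2)] by auto
  ultimately have "((\<lambda>\<alpha>. norm (c \<alpha>) * r ^ mdeg d \<alpha>) \<circ> (\<lambda>\<alpha>. \<alpha> + \<gamma>)) summable_on UNIV"
    by (subst summable_on_reindex[symmetric])
  then have "(\<lambda>\<alpha>. (K / r ^ mdeg d \<gamma>) * (norm (c (\<alpha> + \<gamma>)) * r ^ mdeg d (\<alpha> + \<gamma>))) summable_on UNIV"
    by (intro summable_on_cmult_right) (simp add: o_def)
  then have "(\<lambda>\<alpha>. norm (b \<alpha>) * (r / 2) ^ mdeg d \<alpha>) summable_on UNIV"
  proof (rule summable_on_comparison_test)
    fix \<alpha>
    have "norm (b \<alpha>) * (r / 2) ^ mdeg d \<alpha> \<le> (K * 2 ^ mdeg d \<alpha> * norm (c (\<alpha> + \<gamma>))) * (r / 2) ^ mdeg d \<alpha>"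
      using r(1) le by (intro mult_right_mono) auto
    also have "\<dots> = (K / r ^ mdeg d \<gamma>) * (norm (c (\<alpha> + \<gamma>)) * r ^ mdeg d (\<alpha> + \<gamma>))"
      using r(1) by (simp add: mdeg_add power_add power_divide)
    finally show "norm (b \<alpha>) * (r / 2) ^ mdeg d \<alpha> \<le> (K / r ^ mdeg d \<gamma>) * (norm (c (\<alpha> + \<gamma>)) * r ^ mdeg d (\<alpha> + \<gamma>))" .
  qed (use r(1) in auto)
  moreover have "\<alpha> \<in> MI d" if "b \<alpha> \<noteq> 0" for \<alpha>
  proof -
    have "c (\<alpha> + \<gamma>) \<noteq> 0" using le[of \<alpha>] that by auto
    then have "\<alpha> + \<gamma> \<in> MI d" using c conv_series_MI by blast
    then show ?thesis by (simp add: MI_add_iff)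
  qed
  ultimately show ?thesis
    using r(1) by (intro conv_seriesI[of d _ "r / 2"]) auto
qed

definition conv_mps :: "nat \<Rightarrow> complex mps set" where
  "conv_mps d = {a. coef a \<in> conv_series d}"

lemma coef_MPS: "c \<in> conv_series d \<Longrightarrow> coef (MPS c) = c"
  by (rule MPS_inverse) (use MI_finite conv_series_MI in blast)

lemma mconst_conv: "mconst a \<in> conv_mps d"
  unfolding conv_mps_def
  by (auto simp: coef_mconst MI_zero intro!: conv_series_finite split: if_splits)

interpretation conv: subring_on "conv_mps d" for d
proof
  show "1 \<in> conv_mps d" unfolding one_eq_mconst by (rule mconst_conv)
next
  fix x y assume "x \<in> conv_mps d" "y \<in> conv_mps d"
  then show "x - y \<in> conv_mps d" "x * y \<in> conv_mps d"
    by (simp_all add: conv_mps_def minus_mps.rep_eq conv_series_diff conv_series_mult)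
qed

section \<open>Variables, their translates, and division by variables\<close>

definition unit_mindex :: "nat \<Rightarrow> mindex" where
  "unit_mindex i = (\<lambda>j. if j = i then 1 else 0)"

abbreviation mvar :: "nat \<Rightarrow> 'a::comm_ring_1 mps" where
  "mvar i \<equiv> mmonom (unit_mindex i)"

lemma unit_mindex_finite: "finite {j. unit_mindex i j \<noteq> 0}"
  by (simp add: unit_mindex_def)

lemma unit_mindex_le_iff: "unit_mindex i \<le> \<alpha> \<longleftrightarrow> \<alpha> i \<noteq> 0"
  by (auto simp: unit_mindex_def le_fun_def Suc_le_eq)

lemma unit_mindex_MI: "i < d \<Longrightarrow> unit_mindex i \<in> MI d"
  by (simp add: unit_mindex_def MI_def)

lemma mvar_conv: "i < d \<Longrightarrow> mvar i \<in> conv_mps d"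
  unfolding conv_mps_def
  by (auto simp: mmonom.rep_eq unit_mindex_MI intro!: conv_series_finite split: if_splits)

text \<open>The inverse is the geometric series - \<Sum>_k x_i^k / c^(k+1). It will show that
  automorphisms send variables to series without constant term.\<close>

lemma mvar_minus_const_unit:
  assumes "i < d" "c \<noteq> 0"
  shows "\<exists>u\<in>conv_mps d. (mvar i - mconst c) * u = 1"
proof -
  define v where "v = (\<lambda>\<alpha>::mindex. if (\<forall>j. j \<noteq> i \<longrightarrow> \<alpha> j = 0) then - ((1 / c) ^ Suc (\<alpha> i)) else 0)"
  \<comment> \<open>At half the radius of convergence |c| the k-th term has absolute value (1/2)^k /
    |c|.\<close>
  define r where "r = norm c / 2"
  define S where "S = range (\<lambda>k. \<lambda>j. if j = i then k else (0::nat))"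
  have vS: "v \<alpha> = 0" if "\<alpha> \<notin> S" for \<alpha>
  proof (rule ccontr)
    assume "v \<alpha> \<noteq> 0"
    then have z: "\<alpha> j = 0" if "j \<noteq> i" for j using that unfolding v_def by meson
    have "\<alpha> = (\<lambda>j. if j = i then \<alpha> i else 0)" by (rule ext) (simp add: z)
    then show False using that unfolding S_def by blast
  qed
  have inj: "inj (\<lambda>k j. if j = i then k else (0::nat))"
  proof (rule injI)
    fix k l :: nat
    assume "(\<lambda>j. if j = i then k else 0) = (\<lambda>j. if j = i then l else 0)"
    from fun_cong[OF this, of i] show "k = l" by simp
  qed
  have "summable (\<lambda>k. norm (1 / c) * (1 / 2) ^ k :: real)"
    by (intro summable_mult summable_geometric) simp
  then have "(\<lambda>k. norm (1 / c) * (1 / 2) ^ k :: real) summable_on UNIV"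
    by (rule summable_nonneg_imp_summable_on) simp
  also have "(\<lambda>k. norm (1 / c) * (1 / 2) ^ k) = (\<lambda>\<alpha>. norm (v \<alpha>) * r ^ mdeg d \<alpha>) \<circ> (\<lambda>k j. if j = i then k else 0)"
  proof (rule ext)
    fix k
    have "mdeg d (\<lambda>j. if j = i then k else 0) = k"
      using assms(1) by (simp add: mdeg_def)
    then show "norm (1 / c) * (1 / 2) ^ k = ((\<lambda>\<alpha>. norm (v \<alpha>) * r ^ mdeg d \<alpha>) \<circ> (\<lambda>k j. if j = i then k else 0)) k"
      using assms(2) by (simp add: v_def r_def norm_mult norm_power norm_divide power_divide)
  qed
  finally have "(\<lambda>\<alpha>. norm (v \<alpha>) * r ^ mdeg d \<alpha>) summable_on S"
    unfolding S_def by (subst summable_on_reindex[OF inj])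
  then have "(\<lambda>\<alpha>. norm (v \<alpha>) * r ^ mdeg d \<alpha>) summable_on UNIV"
    using summable_on_cong_neutral[of UNIV S "\<lambda>\<alpha>. norm (v \<alpha>) * r ^ mdeg d \<alpha>" "\<lambda>\<alpha>. norm (v \<alpha>) * r ^ mdeg d \<alpha>"]
    by (simp add: vS)
  moreover have "\<alpha> \<in> MI d" if "v \<alpha> \<noteq> 0" for \<alpha>
  proof -
    have "\<alpha> \<in> S" using that vS by blast
    then show ?thesis using assms(1) unfolding S_def by (auto simp: MI_def)
  qed
  moreover have "r > 0" using assms(2) by (simp add: r_def)
  ultimately have v: "v \<in> conv_series d"
    by (intro conv_seriesI[of d _ r]) auto
  have "(mvar i - mconst c) * MPS v = 1"
  proof (rule mps_eqI)
    fix \<alpha> :: mindex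
    have eq: "coef ((mvar i - mconst c) * MPS v) \<alpha> = (if \<alpha> i \<noteq> 0 then v (\<alpha> - unit_mindex i) else 0) - c * v \<alpha>"
      by (simp only: left_diff_distrib coef_diff coef_mconst_mult coef_mmonom_mult[OF unit_mindex_finite]
          coef_MPS[OF v] unit_mindex_le_iff)
    have shift: "v (\<alpha> - unit_mindex i) = (if (\<forall>j. j \<noteq> i \<longrightarrow> \<alpha> j = 0) then - ((1 / c) ^ \<alpha> i) else 0)" if "\<alpha> i \<noteq> 0"
    proof -
      have "(\<forall>j. j \<noteq> i \<longrightarrow> (\<alpha> - unit_mindex i) j = 0) \<longleftrightarrow> (\<forall>j. j \<noteq> i \<longrightarrow> \<alpha> j = 0)"
        by (simp add: unit_mindex_def)
      moreover have "Suc ((\<alpha> - unit_mindex i) i) = \<alpha> i"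
        using that by (simp add: unit_mindex_def)
      ultimately show ?thesis unfolding v_def by (simp only:)
    qed
    have "\<alpha> = 0 \<longleftrightarrow> \<alpha> i = 0 \<and> (\<forall>j. j \<noteq> i \<longrightarrow> \<alpha> j = 0)"
      unfolding fun_eq_iff zero_fun_apply by metis
    then show "coef ((mvar i - mconst c) * MPS v) \<alpha> = coef 1 \<alpha>"
      unfolding eq one_mps.rep_eq using assms(2) shift
      by (cases "\<forall>j. j \<noteq> i \<longrightarrow> \<alpha> j = 0"; cases "\<alpha> i = 0") (simp_all add: v_def)
  qed
  moreover have "MPS v \<in> conv_mps d" by (simp add: conv_mps_def coef_MPS[OF v] v)
  ultimately show ?thesis by blast
qed

text \<open>Each nonconstant monomial is assigned to the variable of least index occurring in it;
  this quotient collects the monomials assigned to x_i, divided by x_i. The quotients thus involve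
  disjoint sets of monomials, and coefficients are only moved.\<close>

lift_definition var_quotient :: "nat \<Rightarrow> 'a::zero mps \<Rightarrow> 'a mps" is
  "\<lambda>i a \<alpha>. if (\<forall>j<i. \<alpha> j = 0) \<and> finite {j. \<alpha> j \<noteq> 0} then a (\<alpha> + unit_mindex i) else 0"
  by auto

lemma var_quotient_conv:
  assumes "a \<in> conv_mps d"
  shows "var_quotient i a \<in> conv_mps d"
proof -
  have bound: "norm (coef (var_quotient i a) \<alpha>) \<le> 1 * 2 ^ mdeg d \<alpha> * norm (coef a (\<alpha> + unit_mindex i))" for \<alpha>
  proof -
    have "norm (coef (var_quotient i a) \<alpha>) \<le> 1 * norm (coef a (\<alpha> + unit_mindex i))"
      by (simp add: var_quotient.rep_eq)
    also have "\<dots> \<le> 2 ^ mdeg d \<alpha> * norm (coef a (\<alpha> + unit_mindex i))"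
      by (intro mult_right_mono) auto
    finally show ?thesis by simp
  qed
  show ?thesis
    unfolding conv_mps_def mem_Collect_eq
  proof (rule conv_series_shift)
    show "coef a \<in> conv_series d" using assms by (simp add: conv_mps_def)
    show "norm (coef (var_quotient i a) \<alpha>) \<le> 1 * 2 ^ mdeg d \<alpha> * norm (coef a (\<alpha> + unit_mindex i))" for \<alpha>
      by (rule bound)
  qed simp
qed

text \<open>The variables generate the maximal ideal, with convergent quotients. This drives the
  induction behind the compatibility with Taylor expansion.\<close>

lemma conv_decomposition:
  assumes "a \<in> conv_mps d"
  shows "a = mconst (coef a 0) + (\<Sum>i<d. mvar i * var_quotient i a)"
proof (rule mps_eqI)
  fix \<alpha> :: mindex assume fin: "finite {i. \<alpha> i \<noteq> 0}"
  have coeff: "coef (mvar i * var_quotient i a) \<alpha> = (if \<alpha> i \<noteq> 0 \<and> (\<forall>j<i. \<alpha> j = 0) then coef a \<alpha> else 0)" for i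
  proof (cases "\<alpha> i = 0")
    case False
    then have "\<alpha> - unit_mindex i + unit_mindex i = \<alpha>"
      by (metis add.commute mindex_add_diff unit_mindex_le_iff)
    moreover have "finite {j. (\<alpha> - unit_mindex i) j \<noteq> 0}"
      by (rule finite_support_le[OF fin mindex_diff_le])
    moreover have "(\<forall>j<i. (\<alpha> - unit_mindex i) j = 0) \<longleftrightarrow> (\<forall>j<i. \<alpha> j = 0)"
      by (auto simp: unit_mindex_def)
    ultimately have "coef (var_quotient i a) (\<alpha> - unit_mindex i) = (if \<forall>j<i. \<alpha> j = 0 then coef a \<alpha> else 0)"
      by (simp only: var_quotient.rep_eq simp_thms)
    then show ?thesis using False
      by (simp only: coef_mmonom_mult[OF unit_mindex_finite] unit_mindex_le_iff simp_thms if_True)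
  qed (simp add: coef_mmonom_mult[OF unit_mindex_finite] unit_mindex_le_iff)
  show "coef a \<alpha> = coef (mconst (coef a 0) + (\<Sum>i<d. mvar i * var_quotient i a)) \<alpha>"
  proof (cases "\<alpha> = 0")
    case True
    show ?thesis unfolding True using coeff[unfolded True] by (simp add: coef_mconst)
  next
    case False
    then obtain i0 where "\<alpha> i0 \<noteq> 0" by (auto simp: fun_eq_iff)
    \<comment> \<open>At most one summand contributes to the coefficient at \<alpha>, namely the one
      for the least index in its support.\<close>
    define m where "m = (LEAST i. \<alpha> i \<noteq> 0)"
    have m: "\<alpha> m \<noteq> 0" unfolding m_def using \<open>\<alpha> i0 \<noteq> 0\<close> by (rule LeastI)
    have below: "\<alpha> j = 0" if "j < m" for j
      using that not_less_Least[of j "\<lambda>i. \<alpha> i \<noteq> 0"] unfolding m_def by simp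
    have "\<alpha> i \<noteq> 0 \<and> (\<forall>j<i. \<alpha> j = 0) \<longleftrightarrow> i = m" for i
      using m below by (metis linorder_neqE_nat)
    then have "coef (mconst (coef a 0) + (\<Sum>i<d. mvar i * var_quotient i a)) \<alpha> = (\<Sum>i<d. if i = m then coef a \<alpha> else 0)"
      using False by (simp add: coef_mconst coeff)
    also have "\<dots> = (if m < d then coef a \<alpha> else 0)" by simp
    also have "\<dots> = coef a \<alpha>"
    proof -
      \<comment> \<open>If the least index is at least d, then \<alpha> lies outside
        \<open>MI d\<close>, where series in d variables have zero coefficients.\<close>
      have "coef a \<alpha> = 0" if "\<not> m < d"
      proof (rule conv_series_MI[of "coef a" d])
        show "coef a \<in> conv_series d" using assms by (simp add: conv_mps_def)
        show "\<alpha> \<notin> MI d" using m that unfolding MI_def by (auto intro!: exI[of _ m])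
      qed
      then show ?thesis by simp
    qed
    finally show ?thesis by simp
  qed
qed

section \<open>Taylor expansion\<close>

text \<open>The product runs over the support of \<gamma>, so it does not refer to a number of
  variables; the remaining binomial factors equal 1.\<close>

definition mbinom :: "mindex \<Rightarrow> mindex \<Rightarrow> nat" where
  "mbinom \<delta> \<gamma> = (\<Prod>i | \<gamma> i \<noteq> 0. \<delta> i choose \<gamma> i)"

lemma mbinom_superset:
  assumes "finite S" "{i. \<gamma> i \<noteq> 0} \<subseteq> S"
  shows "mbinom \<delta> \<gamma> = (\<Prod>i\<in>S. \<delta> i choose \<gamma> i)"
  unfolding mbinom_def by (rule prod.mono_neutral_left[OF assms]) auto

lemma mbinom_0 [simp]: "mbinom \<delta> 0 = 1"
  by (simp add: mbinom_def)

lemma mbinom_eq_0: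
  assumes "finite {i. \<gamma> i \<noteq> 0}" "\<delta> i < \<gamma> i"
  shows "mbinom \<delta> \<gamma> = 0"
  unfolding mbinom_def using assms by (intro prod_zero bexI[of _ i]) auto

text \<open>Vandermonde's identity in every coordinate; expanding the product of sums turns
  coordinatewise choices into multi-indices below \<gamma>.\<close>

lemma mbinom_vandermonde:
  assumes fin: "finite {i. \<gamma> i \<noteq> 0}"
  shows "(\<Sum>\<gamma>' | \<gamma>' \<le> \<gamma>. mbinom \<delta> \<gamma>' * mbinom \<epsilon> (\<gamma> - \<gamma>')) = mbinom (\<delta> + \<epsilon>) \<gamma>"
proof -
  define S where "S = {i. \<gamma> i \<noteq> 0}"
  have finS: "finite S" using fin by (simp only: S_def)
  have supp: "{i. \<gamma>' i \<noteq> 0} \<subseteq> S" if "\<gamma>' \<le> \<gamma>" for \<gamma>'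
  proof
    fix i assume "i \<in> {i. \<gamma>' i \<noteq> 0}"
    then show "i \<in> S" using le_funD[OF that, of i] by (simp add: S_def)
  qed
  have "mbinom (\<delta> + \<epsilon>) \<gamma> = (\<Prod>i\<in>S. \<Sum>k\<in>{..\<gamma> i}. (\<delta> i choose k) * (\<epsilon> i choose (\<gamma> i - k)))"
    unfolding mbinom_def S_def by (simp add: vandermonde)
  also have "\<dots> = (\<Sum>g\<in>PiE S (\<lambda>i. {..\<gamma> i}). \<Prod>i\<in>S. (\<delta> i choose g i) * (\<epsilon> i choose (\<gamma> i - g i)))"
    by (rule prod_sum_PiE[OF finS]) simp
  also have "\<dots> = (\<Sum>\<gamma>' | \<gamma>' \<le> \<gamma>. mbinom \<delta> \<gamma>' * mbinom \<epsilon> (\<gamma> - \<gamma>'))"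
  proof (rule sum.reindex_bij_witness[of _ "\<lambda>\<gamma>'. restrict \<gamma>' S" "\<lambda>g i. if i \<in> S then g i else 0"], goal_cases)
    case (1 g)
    then show ?case by (intro ext) (auto simp: PiE_def extensional_def)
  next
    case (2 g)
    then have "(if i \<in> S then g i else 0) \<le> \<gamma> i" for i by (auto simp: PiE_def Pi_def)
    then show ?case by (auto intro!: le_funI)
  next
    case (3 \<gamma>')
    then have "restrict \<gamma>' S i = \<gamma>' i" if "i \<in> S" for i using that by simp
    moreover have "\<gamma>' i = 0" if "i \<notin> S" for i using supp[of \<gamma>'] 3 that by blast
    ultimately show ?case by (intro ext) simp
  next
    case (4 \<gamma>')
    then show ?case by (auto simp: le_funD)
  next
    case (5 g)
    let ?\<gamma>' = "\<lambda>i. if i \<in> S then g i else 0"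
    have "{i. ?\<gamma>' i \<noteq> 0} \<subseteq> S" by auto
    then have 1: "mbinom \<delta> ?\<gamma>' = (\<Prod>i\<in>S. \<delta> i choose ?\<gamma>' i)" by (rule mbinom_superset[OF finS])
    have 2: "mbinom \<epsilon> (\<gamma> - ?\<gamma>') = (\<Prod>i\<in>S. \<epsilon> i choose (\<gamma> - ?\<gamma>') i)"
      by (rule mbinom_superset[OF finS supp[OF mindex_diff_le]])
    show ?case unfolding 1 2 by (simp add: prod.distrib)
  qed
  finally show ?thesis by simp
qed

section \<open>Divided derivatives and the Taylor homomorphism\<close>

lemma coef_add_infinite:
  assumes "infinite {i. \<alpha> i \<noteq> 0} \<or> infinite {i. \<beta> i \<noteq> 0}"
  shows "coef a (\<alpha> + \<beta>) = 0"
proof (rule coef_infinite, rule notI)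
  assume "finite {i. (\<alpha> + \<beta>) i \<noteq> 0}"
  then have "finite {i. \<alpha> i \<noteq> 0}" "finite {i. \<beta> i \<noteq> 0}"
    using finite_support_le mindex_le_add add.commute by metis+
  then show False using assms by blast
qed

text \<open>The operator usually written \<partial>^\<gamma> / \<gamma>!. Binomial coefficients
  replace the division by \<gamma>!, so it exists over every commutative ring.\<close>

lift_definition hasse :: "mindex \<Rightarrow> 'a::comm_ring_1 mps \<Rightarrow> 'a mps" is
  "\<lambda>\<gamma> a \<alpha>. if finite {i. \<alpha> i \<noteq> 0} then of_nat (mbinom (\<alpha> + \<gamma>) \<gamma>) * a (\<alpha> + \<gamma>) else 0"
  by auto

lemma coef_hasse: "coef (hasse \<gamma> a) \<alpha> = of_nat (mbinom (\<alpha> + \<gamma>) \<gamma>) * coef a (\<alpha> + \<gamma>)"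
  using coef_add_infinite[of \<alpha> \<gamma> a] by (cases "finite {i. \<alpha> i \<noteq> 0}") (simp_all add: hasse.rep_eq)

text \<open>The expansion a(x + t): the outer multi-index belongs to t, the inner one to x.\<close>

definition taylor :: "'a::comm_ring_1 mps \<Rightarrow> 'a mps mps" where
  "taylor a = MPS (\<lambda>\<gamma>. hasse \<gamma> a)"

lemma coef_taylor: "coef (taylor a) \<gamma> = hasse \<gamma> a"
proof -
  have "hasse \<gamma> a = 0" if "infinite {i. \<gamma> i \<noteq> 0}" for \<gamma>
  proof (rule mps_eqI)
    fix \<alpha>
    have "coef a (\<alpha> + \<gamma>) = 0" by (rule coef_add_infinite) (rule disjI2, rule that)
    then show "coef (hasse \<gamma> a) \<alpha> = coef 0 \<alpha>" by (simp add: coef_hasse)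
  qed
  then show ?thesis unfolding taylor_def by (subst MPS_inverse) auto
qed

lemma hasse_0 [simp]: "hasse 0 a = a"
  by (rule mps_eqI) (simp add: coef_hasse)

lemma taylor_add: "taylor (a + b) = taylor a + taylor b"
  by (intro mps_eqI) (simp add: coef_taylor coef_hasse distrib_left)

lemma taylor_0 [simp]: "taylor 0 = 0"
  by (intro mps_eqI) (simp add: coef_taylor coef_hasse)

lemma taylor_sum: "taylor (sum f S) = (\<Sum>x\<in>S. taylor (f x))"
  by (induction S rule: infinite_finite_induct) (auto simp: taylor_add)

lemma mindex_add_eq_0_iff: "\<alpha> + \<gamma> = 0 \<longleftrightarrow> \<alpha> = 0 \<and> \<gamma> = 0" for \<alpha> \<gamma> :: mindex
  unfolding fun_eq_iff by auto

lemma taylor_mconst: "taylor (mconst c) = mconst (mconst c)"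
proof (intro mps_eqI)
  fix \<gamma> \<alpha> :: mindex
  show "coef (coef (taylor (mconst c)) \<gamma>) \<alpha> = coef (coef (mconst (mconst c)) \<gamma>) \<alpha>"
    by (cases "\<gamma> = 0"; cases "\<alpha> = 0") (simp_all add: coef_taylor coef_hasse coef_mconst mindex_add_eq_0_iff)
qed

lemma mindex_add_eq_unit_iff:
  "\<alpha> + \<gamma> = unit_mindex i \<longleftrightarrow> (\<alpha> = unit_mindex i \<and> \<gamma> = 0) \<or> (\<alpha> = 0 \<and> \<gamma> = unit_mindex i)"
proof
  assume *: "\<alpha> + \<gamma> = unit_mindex i"
  have j: "\<alpha> j = 0" "\<gamma> j = 0" if "j \<noteq> i" for j
    using fun_cong[OF *, of j] that by (simp_all add: unit_mindex_def)
  have i: "\<alpha> i + \<gamma> i = 1" using fun_cong[OF *, of i] by (simp add: unit_mindex_def)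
  show "(\<alpha> = unit_mindex i \<and> \<gamma> = 0) \<or> (\<alpha> = 0 \<and> \<gamma> = unit_mindex i)"
  proof (cases "\<alpha> i = 0")
    case True
    have "\<alpha> = 0" by (rule ext) (metis True j(1) zero_fun_apply)
    moreover then have "\<gamma> = unit_mindex i" using * by simp
    ultimately show ?thesis by simp
  next
    case False
    then have "\<gamma> i = 0" using i by simp
    then have "\<gamma> = 0" by (intro ext) (metis j(2) zero_fun_apply)
    moreover then have "\<alpha> = unit_mindex i" using * by simp
    ultimately show ?thesis by simp
  qed
qed auto

lemma unit_mindex_neq_0 [simp]: "unit_mindex i \<noteq> 0"
proof
  assume "unit_mindex i = 0"
  from fun_cong[OF this, of i] show False by (simp add: unit_mindex_def)
qed

lemma mbinom_unit: "mbinom (unit_mindex i) (unit_mindex i) = 1"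
  by (subst mbinom_superset[of "{i}"]) (auto simp: unit_mindex_def)

lemma taylor_mvar: "taylor (mvar i) = mconst (mvar i) + mmonom (unit_mindex i)"
proof (intro mps_eqI)
  fix \<gamma> \<alpha> :: mindex
  have "coef (coef (taylor (mvar i)) \<gamma>) \<alpha> = (if \<alpha> + \<gamma> = unit_mindex i then of_nat (mbinom (\<alpha> + \<gamma>) \<gamma>) else 0 :: 'a)"
    using unit_mindex_finite by (simp add: coef_taylor coef_hasse mmonom.rep_eq)
  also have "\<dots> = coef (coef (mconst (mvar i) + mmonom (unit_mindex i)) \<gamma>) \<alpha>"
    unfolding mindex_add_eq_unit_iff using unit_mindex_finite[of i]
    by (auto simp: coef_mconst mmonom.rep_eq mbinom_unit one_mps.rep_eq)
  finally show "coef (coef (taylor (mvar i)) \<gamma>) \<alpha> = (coef (coef (mconst (mvar i) + mmonom (unit_mindex i)) \<gamma>) \<alpha> :: 'a)" .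
qed

text \<open>This is the Leibniz rule for divided derivatives, in other words the fact that x
  \<mapsto> x + t respects products. On coefficients it reduces to Vandermonde's identity.\<close>

lemma taylor_mult: "taylor (a * b) = taylor a * taylor b"
proof (intro mps_eqI)
  fix \<gamma> \<alpha> :: mindex
  assume f\<gamma>: "finite {i. \<gamma> i \<noteq> 0}" and f\<alpha>: "finite {i. \<alpha> i \<noteq> 0}"
  have fin: "finite {\<beta>. \<beta> \<le> \<gamma>}" "finite {\<beta>. \<beta> \<le> \<alpha>}" "finite {\<delta>. \<delta> \<le> \<alpha> + \<gamma>}"
  proof -
    have "finite {i. (\<alpha> + \<gamma>) i \<noteq> 0}"
      by (rule finite_subset[OF _ finite_UnI[OF f\<alpha> f\<gamma>]]) auto
    then show "finite {\<delta>. \<delta> \<le> \<alpha> + \<gamma>}" by (rule finite_mindex_le)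
  qed (rule finite_mindex_le, fact)+
  define V where "V = {\<delta>. \<delta> \<le> \<alpha> + \<gamma>} \<times> {\<gamma>'. \<gamma>' \<le> \<gamma>}"
  \<comment> \<open>Outside \<open>V'\<close> one of the two binomials vanishes; inside, a pair
    (\<delta>, \<gamma>') amounts to splitting both \<gamma> and \<alpha>, with \<delta> - \<gamma>'
    as the part of \<alpha>.\<close>
  define V' where "V' = {(\<delta>, \<gamma>'). \<delta> \<le> \<alpha> + \<gamma> \<and> \<gamma>' \<le> \<gamma> \<and> \<gamma>' \<le> \<delta> \<and> \<delta> - \<gamma>' \<le> \<alpha>}"
  define t where "t = (\<lambda>(\<delta>, \<gamma>'). of_nat (mbinom \<delta> \<gamma>') * of_nat (mbinom (\<alpha> + \<gamma> - \<delta>) (\<gamma> - \<gamma>')) * (coef a \<delta> * coef b (\<alpha> + \<gamma> - \<delta>)))"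
  have "coef (coef (taylor (a * b)) \<gamma>) \<alpha> =
      (\<Sum>\<delta> | \<delta> \<le> \<alpha> + \<gamma>. of_nat (mbinom (\<alpha> + \<gamma>) \<gamma>) * (coef a \<delta> * coef b (\<alpha> + \<gamma> - \<delta>)))"
    by (simp add: coef_taylor coef_hasse times_mps.rep_eq sum_distrib_left)
  also have "\<dots> = (\<Sum>\<delta> | \<delta> \<le> \<alpha> + \<gamma>. \<Sum>\<gamma>' | \<gamma>' \<le> \<gamma>. t (\<delta>, \<gamma>'))"
  proof (rule sum.cong[OF refl])
    fix \<delta> assume "\<delta> \<in> {\<delta>. \<delta> \<le> \<alpha> + \<gamma>}"
    then have "mbinom (\<alpha> + \<gamma>) \<gamma> = (\<Sum>\<gamma>' | \<gamma>' \<le> \<gamma>. mbinom \<delta> \<gamma>' * mbinom (\<alpha> + \<gamma> - \<delta>) (\<gamma> - \<gamma>'))"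
      using mbinom_vandermonde[OF f\<gamma>, of \<delta> "\<alpha> + \<gamma> - \<delta>"] by (simp only: mindex_add_diff mem_Collect_eq)
    then show "of_nat (mbinom (\<alpha> + \<gamma>) \<gamma>) * (coef a \<delta> * coef b (\<alpha> + \<gamma> - \<delta>)) = (\<Sum>\<gamma>' | \<gamma>' \<le> \<gamma>. t (\<delta>, \<gamma>'))"
      unfolding t_def by (simp only: of_nat_sum of_nat_mult sum_distrib_right prod.case)
  qed
  also have "\<dots> = sum t V"
    unfolding V_def by (simp only: sum.cartesian_product) (simp only: case_prod_eta)
  also have "\<dots> = sum t V'"
  proof (rule sum.mono_neutral_right)
    show "finite V" unfolding V_def using fin by simp
    show "V' \<subseteq> V" unfolding V_def V'_def by auto
    show "\<forall>x\<in>V - V'. t x = 0"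
    proof
      fix x assume x: "x \<in> V - V'"
      obtain \<delta> \<gamma>' where [simp]: "x = (\<delta>, \<gamma>')" by (metis surj_pair)
      have le: "\<delta> \<le> \<alpha> + \<gamma>" "\<gamma>' \<le> \<gamma>" and or: "\<not> \<gamma>' \<le> \<delta> \<or> \<not> \<delta> - \<gamma>' \<le> \<alpha>"
        using x by (auto simp: V_def V'_def)
      have "mbinom \<delta> \<gamma>' = 0 \<or> mbinom (\<alpha> + \<gamma> - \<delta>) (\<gamma> - \<gamma>') = 0"
        using or
      proof
        assume "\<not> \<gamma>' \<le> \<delta>"
        then obtain i where "\<delta> i < \<gamma>' i" by (auto simp: le_fun_def not_le)
        then show ?thesis using mbinom_eq_0[of \<gamma>' \<delta> i] finite_support_le[OF f\<gamma> le(2)] by blast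
      next
        assume "\<not> \<delta> - \<gamma>' \<le> \<alpha>"
        then obtain i where "\<not> \<delta> i - \<gamma>' i \<le> \<alpha> i" unfolding le_fun_def mindex_diff_apply by blast
        moreover have "\<delta> i \<le> \<alpha> i + \<gamma> i" using le_funD[OF le(1), of i] by simp
        ultimately have "(\<alpha> + \<gamma> - \<delta>) i < (\<gamma> - \<gamma>') i" by simp
        then have "mbinom (\<alpha> + \<gamma> - \<delta>) (\<gamma> - \<gamma>') = 0"
          by (rule mbinom_eq_0[OF finite_support_le[OF f\<gamma> mindex_diff_le]])
        then show ?thesis by (rule disjI2)
      qed
      then show "t x = 0" by (auto simp: t_def)
    qed
  qed
  also have "\<dots> = (\<Sum>(\<gamma>',\<alpha>')\<in>{\<gamma>'. \<gamma>' \<le> \<gamma>} \<times> {\<alpha>'. \<alpha>' \<le> \<alpha>}.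
      coef (hasse \<gamma>' a) \<alpha>' * coef (hasse (\<gamma> - \<gamma>') b) (\<alpha> - \<alpha>'))"
  proof (rule sum.reindex_bij_witness[of _ "\<lambda>(\<gamma>',\<alpha>'). (\<gamma>' + \<alpha>', \<gamma>')" "\<lambda>(\<delta>,\<gamma>'). (\<gamma>', \<delta> - \<gamma>')"], goal_cases)
    case (1 x) then show ?case by (auto simp: V'_def mindex_add_diff)
  next
    case (2 x) then show ?case by (auto simp: V'_def)
  next
    case (3 x) then show ?case by (auto simp: mindex_diff_add)
  next
    case (4 x)
    then obtain \<gamma>' \<alpha>' where "x = (\<gamma>', \<alpha>')" "\<gamma>' \<le> \<gamma>" "\<alpha>' \<le> \<alpha>" by auto
    moreover from this have "\<gamma>' + \<alpha>' \<le> \<alpha> + \<gamma>"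
      by (metis add.commute le_funI le_funD add_mono plus_fun_apply)
    ultimately show ?case by (simp add: V'_def mindex_le_add mindex_diff_add)
  next
    case (5 x)
    then obtain \<delta> \<gamma>' where x: "x = (\<delta>, \<gamma>')" and le: "\<delta> \<le> \<alpha> + \<gamma>" "\<gamma>' \<le> \<gamma>" "\<gamma>' \<le> \<delta>" "\<delta> - \<gamma>' \<le> \<alpha>"
      by (auto simp: V'_def)
    have 1: "\<delta> - \<gamma>' + \<gamma>' = \<delta>" using mindex_add_diff[OF le(3)] by (simp only: add.commute)
    have 2: "\<alpha> - (\<delta> - \<gamma>') + (\<gamma> - \<gamma>') = \<alpha> + \<gamma> - \<delta>"
    proof (rule ext)
      fix i
      have "\<gamma>' i \<le> \<gamma> i" "\<gamma>' i \<le> \<delta> i" "\<delta> i - \<gamma>' i \<le> \<alpha> i"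
        using le_funD[OF le(2), of i] le_funD[OF le(3), of i] le_funD[OF le(4), of i] by simp_all
      then show "(\<alpha> - (\<delta> - \<gamma>') + (\<gamma> - \<gamma>')) i = (\<alpha> + \<gamma> - \<delta>) i" by simp
    qed
    show ?case unfolding x prod.case coef_hasse 1 2 t_def by (simp only: mult_ac)
  qed
  also have "\<dots> = coef (coef (taylor a * taylor b) \<gamma>) \<alpha>"
    unfolding times_mps.rep_eq coef_taylor coef_sum
    by (simp only: sum.cartesian_product)
  finally show "coef (coef (taylor (a * b)) \<gamma>) \<alpha> = coef (coef (taylor a * taylor b) \<gamma>) \<alpha>" .
qed

lemma dder_eq_hasse:
  assumes "\<gamma> \<in> MI d"
  shows "dder d \<gamma> (coef a) = coef (hasse \<gamma> a)"
proof (rule ext)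
  fix \<alpha>
  have "mbinom (\<alpha> + \<gamma>) \<gamma> = (\<Prod>i<d. (\<alpha> + \<gamma>) i choose \<gamma> i)"
    using assms by (intro mbinom_superset) (auto simp: MI_def not_less[symmetric])
  then show "dder d \<gamma> (coef a) \<alpha> = coef (hasse \<gamma> a) \<alpha>"
    by (simp add: dder_def coef_hasse plus_fun_def)
qed

lemma hasse_conv_not_MI:
  assumes "a \<in> conv_mps d" "\<gamma> \<notin> MI d"
  shows "hasse \<gamma> a = 0"
proof (rule mps_eqI)
  fix \<alpha>
  have "coef a (\<alpha> + \<gamma>) = 0"
    using assms by (intro conv_series_MI[of "coef a" d]) (auto simp: conv_mps_def MI_add_iff)
  then show "coef (hasse \<gamma> a) \<alpha> = coef 0 \<alpha>" by (simp add: coef_hasse)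
qed

text \<open>The product of binomials is at most 2^|\<alpha> + \<gamma>|, a growth that
  \<open>conv_series_shift\<close> tolerates.\<close>

lemma hasse_conv:
  assumes "a \<in> conv_mps d"
  shows "hasse \<gamma> a \<in> conv_mps d"
proof (cases "\<gamma> \<in> MI d")
  case True
  then have supp: "{i. \<gamma> i \<noteq> 0} \<subseteq> {..<d}" by (auto simp: MI_def not_less[symmetric])
  have bound: "norm (coef (hasse \<gamma> a) \<alpha>) \<le> 2 ^ mdeg d \<gamma> * 2 ^ mdeg d \<alpha> * norm (coef a (\<alpha> + \<gamma>))" for \<alpha>
  proof -
    have "mbinom (\<alpha> + \<gamma>) \<gamma> = (\<Prod>i<d. (\<alpha> + \<gamma>) i choose \<gamma> i)"
      by (rule mbinom_superset[OF _ supp]) simp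
    also have "\<dots> \<le> (\<Prod>i<d. 2 ^ (\<alpha> + \<gamma>) i)"
      by (intro prod_mono) (simp add: binomial_le_pow2)
    also have "\<dots> = 2 ^ mdeg d (\<alpha> + \<gamma>)"
      by (simp only: mdeg_def power_sum)
    finally have "real (mbinom (\<alpha> + \<gamma>) \<gamma>) \<le> 2 ^ mdeg d (\<alpha> + \<gamma>)"
      by (metis of_nat_le_iff of_nat_numeral of_nat_power)
    then have "real (mbinom (\<alpha> + \<gamma>) \<gamma>) * norm (coef a (\<alpha> + \<gamma>)) \<le> 2 ^ mdeg d (\<alpha> + \<gamma>) * norm (coef a (\<alpha> + \<gamma>))"
      by (rule mult_right_mono) simp
    then show ?thesis
      by (simp only: coef_hasse norm_mult norm_of_nat mdeg_add power_add mult.commute)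
  qed
  show ?thesis
    unfolding conv_mps_def mem_Collect_eq
  proof (rule conv_series_shift)
    show "coef a \<in> conv_series d" using assms by (simp add: conv_mps_def)
    show "norm (coef (hasse \<gamma> a) \<alpha>) \<le> 2 ^ mdeg d \<gamma> * 2 ^ mdeg d \<alpha> * norm (coef a (\<alpha> + \<gamma>))" for \<alpha>
      by (rule bound)
  qed simp
next
  case False
  then show ?thesis
    using hasse_conv_not_MI[OF assms] mconst_conv[of 0 d] by simp
qed

text \<open>Series in the d variables t with coefficients in the convergent series in x. They are
  formal in t, since only truncations in t matter.\<close>

definition conv_mps2 :: "nat \<Rightarrow> complex mps mps set" where
  "conv_mps2 d = {F. \<forall>\<gamma>. coef F \<gamma> \<in> conv_mps d \<and> (\<gamma> \<notin> MI d \<longrightarrow> coef F \<gamma> = 0)}"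

lemma taylor_conv: "a \<in> conv_mps d \<Longrightarrow> taylor a \<in> conv_mps2 d"
  by (simp add: conv_mps2_def coef_taylor hasse_conv hasse_conv_not_MI)

lemma mconst_conv2: "a \<in> conv_mps d \<Longrightarrow> mconst a \<in> conv_mps2 d"
  using MI_zero by (auto simp: conv_mps2_def coef_mconst conv.zero_closed)

interpretation conv2: subring_on "conv_mps2 d" for d
proof
  show "1 \<in> conv_mps2 d" by (subst one_eq_mconst) (rule mconst_conv2[OF conv.one_closed])
next
  fix F G assume FG: "F \<in> conv_mps2 d" "G \<in> conv_mps2 d"
  then show "F - G \<in> conv_mps2 d" by (simp add: conv_mps2_def conv.diff_closed)
  have "coef F \<beta> * coef G (\<gamma> - \<beta>) = 0" if "\<beta> \<le> \<gamma>" "\<gamma> \<notin> MI d" for \<beta> \<gamma>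
  proof -
    have "\<beta> \<notin> MI d \<or> \<gamma> - \<beta> \<notin> MI d"
      using that MI_add_iff[of \<beta> "\<gamma> - \<beta>" d] by (simp only: mindex_add_diff) blast
    then show ?thesis using FG by (auto simp: conv_mps2_def)
  qed
  then show "F * G \<in> conv_mps2 d"
    using FG by (auto simp: conv_mps2_def times_mps.rep_eq intro!: conv.sum_closed conv.mult_closed sum.neutral)
qed

lemma mmonom_conv2: "\<gamma> \<in> MI d \<Longrightarrow> mmonom \<gamma> \<in> conv_mps2 d"
  by (auto simp: conv_mps2_def mmonom.rep_eq conv.one_closed conv.zero_closed)

section \<open>Lifting an automorphism to Taylor expansions\<close>

text \<open>Congruence modulo (t)^(n+1). As \<open>mdeg d\<close> sees the first d entries only, the
  condition also covers multi-indices outside \<open>MI d\<close>; elements of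
  \<open>conv_mps2 d\<close> vanish there.\<close>

definition tcong :: "nat \<Rightarrow> nat \<Rightarrow> 'a::comm_ring_1 mps \<Rightarrow> 'a mps \<Rightarrow> bool" where
  "tcong d n F G \<longleftrightarrow> (\<forall>\<gamma>. mdeg d \<gamma> \<le> n \<longrightarrow> coef F \<gamma> = coef G \<gamma>)"

text \<open>The t-adic order is at least \<open>k\<close>.\<close>

definition tord :: "nat \<Rightarrow> nat \<Rightarrow> 'a::comm_ring_1 mps \<Rightarrow> bool" where
  "tord d k F \<longleftrightarrow> (\<forall>\<gamma>. mdeg d \<gamma> < k \<longrightarrow> coef F \<gamma> = 0)"

lemma tcong_refl: "tcong d n F F"
  by (simp add: tcong_def)

lemma tcong_sym: "tcong d n F G \<Longrightarrow> tcong d n G F"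
  by (simp add: tcong_def)

lemma tcong_trans: "tcong d n F G \<Longrightarrow> tcong d n G H \<Longrightarrow> tcong d n F H"
  by (simp add: tcong_def)

lemma tcong_diff: "tcong d n F F' \<Longrightarrow> tcong d n G G' \<Longrightarrow> tcong d n (F - G) (F' - G')"
  by (simp add: tcong_def)

lemma tcong_sum: "(\<And>x. x \<in> S \<Longrightarrow> tcong d n (f x) (g x)) \<Longrightarrow> tcong d n (sum f S) (sum g S)"
  by (simp add: tcong_def)

text \<open>Degrees add up in a Cauchy product, so a coefficient of degree at most n involves only
  coefficients of degree at most n.\<close>

lemma tcong_mult:
  assumes "tcong d n F F'" "tcong d n G G'"
  shows "tcong d n (F * G) (F' * G')"
  unfolding tcong_def times_mps.rep_eq
proof (intro allI impI sum.cong arg_cong2[of _ _ _ _ "(*)"] refl)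
  fix \<gamma> \<beta> :: mindex
  assume \<gamma>: "mdeg d \<gamma> \<le> n" and "\<beta> \<in> {\<beta>. \<beta> \<le> \<gamma>}"
  then have "mdeg d \<gamma> = mdeg d \<beta> + mdeg d (\<gamma> - \<beta>)" by (simp add: mdeg_diff)
  then have "mdeg d \<beta> \<le> n" "mdeg d (\<gamma> - \<beta>) \<le> n" using \<gamma> by simp_all
  then show "coef F \<beta> = coef F' \<beta>" "coef G (\<gamma> - \<beta>) = coef G' (\<gamma> - \<beta>)"
    using assms by (simp_all add: tcong_def)
qed

lemma tcong_prod: "(\<And>x. x \<in> S \<Longrightarrow> tcong d n (f x) (g x)) \<Longrightarrow> tcong d n (prod f S) (prod g S)"
  by (induction S rule: infinite_finite_induct) (auto simp: tcong_refl tcong_mult)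

lemma tcong_power: "tcong d n F G \<Longrightarrow> tcong d n (F ^ k) (G ^ k)"
  by (induction k) (auto simp: tcong_refl tcong_mult)

lemma tord_0: "tord d 0 F"
  by (simp add: tord_def)

lemma tord_mult:
  assumes "tord d k F" "tord d l G"
  shows "tord d (k + l) (F * G)"
  unfolding tord_def times_mps.rep_eq
proof (intro allI impI sum.neutral ballI)
  fix \<gamma> \<beta> :: mindex
  assume \<gamma>: "mdeg d \<gamma> < k + l" and "\<beta> \<in> {\<beta>. \<beta> \<le> \<gamma>}"
  then have "mdeg d \<gamma> = mdeg d \<beta> + mdeg d (\<gamma> - \<beta>)" by (simp add: mdeg_diff)
  then have "mdeg d \<beta> < k \<or> mdeg d (\<gamma> - \<beta>) < l" using \<gamma> by linarith
  then show "coef F \<beta> * coef G (\<gamma> - \<beta>) = 0"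
    using assms by (auto simp: tord_def)
qed

lemma tord_power: "tord d k F \<Longrightarrow> tord d (m * k) (F ^ m)"
  by (induction m) (auto simp: tord_0 tord_mult)

lemma tord_prod: "finite S \<Longrightarrow> (\<And>i. i \<in> S \<Longrightarrow> tord d (k i) (f i)) \<Longrightarrow> tord d (sum k S) (prod f S)"
  by (induction S rule: finite_induct) (auto simp: tord_0 tord_mult)

lemma mmonom_power:
  assumes "finite {i. \<beta> i \<noteq> 0}"
  shows "mmonom (\<lambda>i. k * \<beta> i) = (mmonom \<beta> ^ k :: 'a::comm_ring_1 mps)"
proof (induction k)
  case 0
  show ?case using mmonom_0 by (simp add: zero_fun_def)
next
  case (Suc k)
  have "finite {i. k * \<beta> i \<noteq> 0}" by (rule finite_subset[OF _ assms]) auto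
  moreover have "(\<lambda>i. Suc k * \<beta> i) = \<beta> + (\<lambda>i. k * \<beta> i)" by (simp add: plus_fun_def)
  ultimately have "mmonom (\<lambda>i. Suc k * \<beta> i) = (mmonom \<beta> * mmonom (\<lambda>i. k * \<beta> i) :: 'a mps)"
    using mmonom_add[OF assms] by (simp only:)
  then show ?case by (simp only: Suc power_Suc)
qed

lemma mmonom_eq_prod:
  assumes "\<beta> \<in> MI d"
  shows "mmonom \<beta> = (\<Prod>i<d. mvar i ^ \<beta> i :: 'a::comm_ring_1 mps)"
proof -
  define m where "m = (\<lambda>i j. \<beta> i * unit_mindex i j)"
  \<comment> \<open>Finiteness of the support is carried through the induction because
    \<open>mmonom_add\<close> requires it.\<close>
  have "finite {j. sum m S j \<noteq> 0} \<and> mmonom (sum m S) = (\<Prod>i\<in>S. mvar i ^ \<beta> i :: 'a mps)" if "finite S" for S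
    using that
  proof (induction S rule: finite_induct)
    case empty
    show ?case by (simp only: sum.empty prod.empty mmonom_0) simp
  next
    case (insert i S)
    have 1: "finite {j. m i j \<noteq> 0}"
      unfolding m_def by (rule finite_subset[OF _ unit_mindex_finite[of i]]) auto
    have 2: "finite {j. sum m S j \<noteq> 0}" using insert.IH by blast
    have 3: "sum m (insert i S) = m i + sum m S" using insert.hyps by (rule sum.insert)
    have "finite {j. (m i + sum m S) j \<noteq> 0}"
      by (rule finite_subset[OF _ finite_UnI[OF 1 2]]) auto
    moreover have "mmonom (m i) = (mvar i ^ \<beta> i :: 'a mps)"
      unfolding m_def by (rule mmonom_power[OF unit_mindex_finite])
    then have "mmonom (m i + sum m S) = (mvar i ^ \<beta> i * (\<Prod>i\<in>S. mvar i ^ \<beta> i) :: 'a mps)"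
      using insert.IH by (simp only: mmonom_add[OF 1 2])
    ultimately show ?case by (simp only: 3 prod.insert[OF insert.hyps] simp_thms)
  qed
  then have "mmonom (sum m {..<d}) = (\<Prod>i<d. mvar i ^ \<beta> i :: 'a mps)"
    by blast
  moreover have "sum m {..<d} = \<beta>"
  proof (rule ext)
    fix j
    have "sum m S j = (\<Sum>i\<in>S. m i j)" for S
      by (induction S rule: infinite_finite_induct) simp_all
    then have "sum m {..<d} j = (\<Sum>i<d. m i j)" .
    also have "\<dots> = (\<Sum>i<d. if i = j then \<beta> j else 0)"
      by (rule sum.cong) (auto simp: m_def unit_mindex_def)
    also have "\<dots> = \<beta> j" using assms by (auto simp: MI_def)
    finally show "sum m {..<d} j = \<beta> j" .
  qed
  ultimately show ?thesis by simp
qed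

text \<open>An algebra endomorphism of the convergent series; surjectivity enters later through
  preimages of the variables. \<open>hom_mvar\<close> makes the maximal ideal go into itself, and
  \<open>n_pos\<close> lets linear terms in t survive truncation.\<close>

locale conv_hom =
  fixes d n :: nat and \<phi> :: "complex mps \<Rightarrow> complex mps"
  assumes n_pos: "1 \<le> n"
    and hom_closed: "a \<in> conv_mps d \<Longrightarrow> \<phi> a \<in> conv_mps d"
    and hom_add: "a \<in> conv_mps d \<Longrightarrow> b \<in> conv_mps d \<Longrightarrow> \<phi> (a + b) = \<phi> a + \<phi> b"
    and hom_mult: "a \<in> conv_mps d \<Longrightarrow> b \<in> conv_mps d \<Longrightarrow> \<phi> (a * b) = \<phi> a * \<phi> b"
    and hom_mconst: "\<phi> (mconst c) = mconst c"
    and hom_mvar: "i < d \<Longrightarrow> coef (\<phi> (mvar i)) 0 = 0"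
begin

lemma hom_0: "\<phi> 0 = 0" and hom_1: "\<phi> 1 = 1"
  using hom_mconst[of 0] hom_mconst[of 1] by (simp_all add: one_eq_mconst[symmetric])

lemma hom_diff:
  assumes "a \<in> conv_mps d" "b \<in> conv_mps d"
  shows "\<phi> (a - b) = \<phi> a - \<phi> b"
  using hom_add[OF conv.diff_closed[OF assms] assms(2)] by simp

lemma hom_sum: "(\<And>x. x \<in> S \<Longrightarrow> f x \<in> conv_mps d) \<Longrightarrow> \<phi> (sum f S) = (\<Sum>x\<in>S. \<phi> (f x))"
  by (induction S rule: infinite_finite_induct) (auto simp: hom_0 hom_add conv.sum_closed)

lemma hom_prod: "(\<And>x. x \<in> S \<Longrightarrow> f x \<in> conv_mps d) \<Longrightarrow> \<phi> (prod f S) = (\<Prod>x\<in>S. \<phi> (f x))"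
  by (induction S rule: infinite_finite_induct) (auto simp: hom_1 hom_mult conv.prod_closed)

lemma hom_sign: "\<phi> (of_int (sign \<pi>)) = of_int (sign \<pi>)"
  using hom_diff[OF conv.zero_closed conv.one_closed]
  by (cases rule: sign_cases[of \<pi>]) (simp_all add: hom_0 hom_1)

lemma hom_ldet:
  assumes "\<And>i j. i < m \<Longrightarrow> j < m \<Longrightarrow> M i j \<in> conv_mps d"
  shows "\<phi> (ldet m M) = ldet m (\<lambda>i j. \<phi> (M i j))"
proof -
  have in_A: "M i (\<pi> i) \<in> conv_mps d" if "\<pi> permutes {..<m}" "i < m" for \<pi> i
    using permutes_in_image[OF that(1), of i] that assms by auto
  have "\<phi> (ldet m M) = (\<Sum>\<pi> | \<pi> permutes {..<m}. \<phi> (of_int (sign \<pi>) * (\<Prod>i<m. M i (\<pi> i))))"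
    unfolding ldet_def using in_A
    by (intro hom_sum conv.mult_closed conv.sign_closed conv.prod_closed) auto
  also have "\<dots> = ldet m (\<lambda>i j. \<phi> (M i j))"
    unfolding ldet_def
  proof (rule sum.cong[OF refl])
    fix \<pi> assume "\<pi> \<in> {\<pi>. \<pi> permutes {..<m}}"
    then have in_A': "\<And>i. i \<in> {..<m} \<Longrightarrow> M i (\<pi> i) \<in> conv_mps d" using in_A by auto
    show "\<phi> (of_int (sign \<pi>) * (\<Prod>i<m. M i (\<pi> i))) = of_int (sign \<pi>) * (\<Prod>i<m. \<phi> (M i (\<pi> i)))"
      by (simp only: hom_mult[OF conv.sign_closed conv.prod_closed[OF in_A']] hom_sign hom_prod[OF in_A'])
  qed
  finally show ?thesis .
qed

definition shift :: "nat \<Rightarrow> complex mps mps" where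
  "shift i = taylor (\<phi> (mvar i)) - mconst (\<phi> (mvar i))"

definition shift_pow :: "mindex \<Rightarrow> complex mps mps" where
  "shift_pow \<gamma> = (\<Prod>i<d. shift i ^ \<gamma> i)"

text \<open>The substitution t_i \<mapsto> s_i with \<phi> applied to the coefficients. Nothing is
  lost modulo (t)^(n+1) by stopping at degree n, since s^\<gamma> has t-order at least
  |\<gamma>|.\<close>

definition lift_hom :: "complex mps mps \<Rightarrow> complex mps mps" where
  "lift_hom F = (\<Sum>\<gamma> | \<gamma> \<in> MI d \<and> mdeg d \<gamma> \<le> n. mconst (\<phi> (coef F \<gamma>)) * shift_pow \<gamma>)"

lemma shift_conv2: "i < d \<Longrightarrow> shift i \<in> conv_mps2 d"
  unfolding shift_def
  by (intro conv2.diff_closed taylor_conv mconst_conv2 hom_closed mvar_conv)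

lemma shift_pow_conv2: "shift_pow \<gamma> \<in> conv_mps2 d"
  unfolding shift_pow_def by (intro conv2.prod_closed conv2.power_closed shift_conv2) simp

lemma tord_shift:
  assumes "i < d"
  shows "tord d 1 (shift i)"
  unfolding tord_def
proof (intro allI impI)
  fix \<gamma> assume "mdeg d \<gamma> < 1"
  \<comment> \<open>\<open>mdeg d\<close> ignores entries from d on, so degree zero forces \<gamma>
    = 0 only inside \<open>MI d\<close>; outside, membership in \<open>conv_mps2 d\<close> gives the
    zero coefficient.\<close>
  then have "\<gamma> \<in> MI d \<Longrightarrow> \<gamma> = 0" using mdeg_eq_0_iff by simp
  moreover have "coef (shift i) 0 = 0" by (simp add: shift_def coef_taylor coef_mconst)
  moreover have "\<gamma> \<notin> MI d \<Longrightarrow> coef (shift i) \<gamma> = 0"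
    using shift_conv2[OF assms] by (simp add: conv_mps2_def)
  ultimately show "coef (shift i) \<gamma> = 0" by blast
qed

lemma tord_shift_pow: "tord d (mdeg d \<gamma>) (shift_pow \<gamma>)"
proof -
  have "tord d (\<Sum>i<d. \<gamma> i * 1) (shift_pow \<gamma>)"
    unfolding shift_pow_def by (intro tord_prod tord_power tord_shift) simp_all
  then show ?thesis by (simp add: mdeg_def)
qed

lemma shift_pow_add: "shift_pow (\<gamma> + \<delta>) = shift_pow \<gamma> * shift_pow \<delta>"
  by (simp add: shift_pow_def power_add prod.distrib)

lemma shift_pow_0: "shift_pow 0 = 1"
  by (simp add: shift_pow_def)

lemma shift_pow_unit:
  assumes "i < d"
  shows "shift_pow (unit_mindex i) = shift i"
proof -
  have "shift_pow (unit_mindex i) = (\<Prod>j<d. if j = i then shift j else 1)"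
    unfolding shift_pow_def by (rule prod.cong) (auto simp: unit_mindex_def)
  then show ?thesis using assms by simp
qed

lemma conv2_coef: "F \<in> conv_mps2 d \<Longrightarrow> coef F \<gamma> \<in> conv_mps d"
  by (simp add: conv_mps2_def)

lemma lift_hom_add:
  assumes "F \<in> conv_mps2 d" "G \<in> conv_mps2 d"
  shows "lift_hom (F + G) = lift_hom F + lift_hom G"
  unfolding lift_hom_def coef_add
  by (simp only: hom_add[OF conv2_coef[OF assms(1)] conv2_coef[OF assms(2)]] mconst_add distrib_right sum.distrib)

lemma lift_hom_diff:
  assumes "F \<in> conv_mps2 d" "G \<in> conv_mps2 d"
  shows "lift_hom (F - G) = lift_hom F - lift_hom G"
  unfolding lift_hom_def coef_diff
  by (simp only: hom_diff[OF conv2_coef[OF assms(1)] conv2_coef[OF assms(2)]] mconst_diff left_diff_distrib sum_subtractf)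

lemma lift_hom_0: "lift_hom 0 = 0"
  by (simp add: lift_hom_def hom_0)

lemma lift_hom_sum:
  "(\<And>x. x \<in> S \<Longrightarrow> f x \<in> conv_mps2 d) \<Longrightarrow> lift_hom (sum f S) = (\<Sum>x\<in>S. lift_hom (f x))"
  by (induction S rule: infinite_finite_induct) (auto simp: lift_hom_0 lift_hom_add conv2.sum_closed)

lemma lift_hom_single:
  assumes "\<delta> \<in> MI d" "mdeg d \<delta> \<le> n" and F: "\<And>\<gamma>. \<gamma> \<noteq> \<delta> \<Longrightarrow> coef F \<gamma> = 0"
  shows "lift_hom F = mconst (\<phi> (coef F \<delta>)) * shift_pow \<delta>"
proof -
  have "lift_hom F = (\<Sum>\<gamma> | \<gamma> \<in> MI d \<and> mdeg d \<gamma> \<le> n. if \<gamma> = \<delta> then mconst (\<phi> (coef F \<delta>)) * shift_pow \<delta> else 0)"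
    unfolding lift_hom_def using F by (intro sum.cong) (auto simp: hom_0)
  then show ?thesis using assms(1,2) finite_MI_mdeg[of d n] by (simp add: sum.delta)
qed

lemma lift_hom_mconst: "lift_hom (mconst a) = mconst (\<phi> a)"
  using lift_hom_single[of 0 "mconst a"] by (simp add: MI_zero coef_mconst shift_pow_0)

text \<open>The reason for the choice of the s_i: x_i + t_i goes to \<phi>(x_i) + s_i, which is
  \<phi>(x_i)(x + t) by definition. The equality is exact, because n \<ge> 1 keeps the linear
  term.\<close>

lemma lift_hom_taylor_mvar:
  assumes "i < d"
  shows "lift_hom (taylor (mvar i)) = taylor (\<phi> (mvar i))"
proof -
  have 1: "mdeg d (unit_mindex i) = 1" using assms by (simp add: mdeg_def unit_mindex_def)
  have "lift_hom (mmonom (unit_mindex i)) = mconst (\<phi> (coef (mmonom (unit_mindex i)) (unit_mindex i))) * shift_pow (unit_mindex i)"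
    using n_pos 1 by (intro lift_hom_single unit_mindex_MI[OF assms]) (auto simp: mmonom.rep_eq)
  also have "\<dots> = shift i"
    using unit_mindex_finite[of i]
    by (simp add: mmonom.rep_eq hom_1 shift_pow_unit[OF assms] one_eq_mconst[symmetric])
  finally have "lift_hom (mmonom (unit_mindex i)) = shift i" .
  then show ?thesis
    unfolding taylor_mvar
    by (simp add: lift_hom_add mconst_conv2 mvar_conv mmonom_conv2 unit_mindex_MI assms lift_hom_mconst shift_def)
qed

text \<open>The product of the images contains all pairs (\<beta>, \<gamma>) of degree at most n
  each, the image of the product only those of total degree at most n. The surplus has t-order above
  n and disappears in the congruence.\<close>

lemma lift_hom_mult:
  assumes F: "F \<in> conv_mps2 d" and G: "G \<in> conv_mps2 d"
  shows "tcong d n (lift_hom (F * G)) (lift_hom F * lift_hom G)"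
proof -
  define N where "N = {\<gamma>. \<gamma> \<in> MI d \<and> mdeg d \<gamma> \<le> n}"
  define t where "t = (\<lambda>(\<beta>, \<gamma>). mconst (\<phi> (coef F \<beta>)) * mconst (\<phi> (coef G \<gamma>)) * shift_pow (\<beta> + \<gamma>))"
  define P where "P = {(\<beta>, \<gamma>) \<in> N \<times> N. mdeg d (\<beta> + \<gamma>) \<le> n}"
  have finN: "finite N" unfolding N_def by (rule finite_MI_mdeg)
  have finle: "finite {\<beta>. \<beta> \<le> \<gamma>}" if "\<gamma> \<in> N" for \<gamma>
    using that by (intro finite_mindex_le MI_finite[of _ d]) (simp add: N_def)
  have FG: "lift_hom F * lift_hom G = sum t (N \<times> N)"
    unfolding lift_hom_def N_def[symmetric] sum_product sum.cartesian_product
    by (rule sum.cong) (auto simp: t_def shift_pow_add mult_ac)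
  have "lift_hom (F * G) = (\<Sum>\<gamma>\<in>N. \<Sum>\<beta> | \<beta> \<le> \<gamma>. t (\<beta>, \<gamma> - \<beta>))"
    unfolding lift_hom_def N_def[symmetric]
  proof (rule sum.cong[OF refl])
    fix \<gamma>
    have "\<phi> (coef (F * G) \<gamma>) = (\<Sum>\<beta> | \<beta> \<le> \<gamma>. \<phi> (coef F \<beta>) * \<phi> (coef G (\<gamma> - \<beta>)))"
      unfolding times_mps.rep_eq
      by (simp only: hom_sum[OF conv.mult_closed[OF conv2_coef[OF F] conv2_coef[OF G]]]
          hom_mult[OF conv2_coef[OF F] conv2_coef[OF G]])
    moreover have "mconst (sum f S) = (\<Sum>x\<in>S. mconst (f x))" for f :: "mindex \<Rightarrow> complex mps" and S
      by (induction S rule: infinite_finite_induct) (simp_all add: mconst_add)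
    ultimately have "mconst (\<phi> (coef (F * G) \<gamma>)) * shift_pow \<gamma> =
        (\<Sum>\<beta> | \<beta> \<le> \<gamma>. mconst (\<phi> (coef F \<beta>)) * mconst (\<phi> (coef G (\<gamma> - \<beta>))) * shift_pow \<gamma>)"
      by (simp only: mconst_mult sum_distrib_right)
    also have "\<dots> = (\<Sum>\<beta> | \<beta> \<le> \<gamma>. t (\<beta>, \<gamma> - \<beta>))"
    proof (rule sum.cong[OF refl])
      fix \<beta> assume "\<beta> \<in> {\<beta>. \<beta> \<le> \<gamma>}"
      then have "\<beta> + (\<gamma> - \<beta>) = \<gamma>" by (simp add: mindex_add_diff)
      then show "mconst (\<phi> (coef F \<beta>)) * mconst (\<phi> (coef G (\<gamma> - \<beta>))) * shift_pow \<gamma> = t (\<beta>, \<gamma> - \<beta>)"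
        unfolding t_def prod.case by (simp only:)
    qed
    finally show "mconst (\<phi> (coef (F * G) \<gamma>)) * shift_pow \<gamma> = (\<Sum>\<beta> | \<beta> \<le> \<gamma>. t (\<beta>, \<gamma> - \<beta>))" .
  qed
  also have "\<dots> = (\<Sum>(\<gamma>,\<beta>)\<in>(SIGMA \<gamma>:N. {\<beta>. \<beta> \<le> \<gamma>}). t (\<beta>, \<gamma> - \<beta>))"
    using finN finle by (intro sum.Sigma) auto
  also have "\<dots> = sum t P"
  proof (rule sum.reindex_bij_witness[of _ "\<lambda>(\<beta>,\<gamma>). (\<beta> + \<gamma>, \<beta>)" "\<lambda>(\<gamma>,\<beta>). (\<beta>, \<gamma> - \<beta>)"], goal_cases)
    case (1 x) then show ?case by (auto simp: mindex_add_diff)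
  next
    case (2 x)
    then obtain \<gamma> \<beta> where x: "x = (\<gamma>, \<beta>)" and le: "\<beta> \<le> \<gamma>" and \<gamma>: "\<gamma> \<in> MI d" "mdeg d \<gamma> \<le> n"
      by (auto simp: N_def)
    have "\<beta> \<in> MI d" "\<gamma> - \<beta> \<in> MI d" using MI_le[OF le \<gamma>(1)] MI_diff[OF \<gamma>(1)] by simp_all
    moreover have "mdeg d \<beta> \<le> n" "mdeg d (\<gamma> - \<beta>) \<le> n" using mdeg_diff[OF le, of d] \<gamma>(2) by simp_all
    ultimately show ?case using \<gamma>(2) by (simp add: x P_def N_def mindex_add_diff[OF le])
  next
    case (3 x) then show ?case by (cases x) (simp add: mindex_diff_add)
  next
    case (4 x) then show ?case by (auto simp: P_def N_def MI_add_iff mindex_le_add)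
  next
    case (5 x) then show ?case by auto
  qed
  finally have FG': "lift_hom (F * G) = sum t P" .
  show ?thesis
    unfolding FG FG' tcong_def
  proof (intro allI impI)
    fix \<alpha> assume \<alpha>: "mdeg d \<alpha> \<le> n"
    have "(\<Sum>x\<in>N \<times> N. coef (t x) \<alpha>) = (\<Sum>x\<in>P. coef (t x) \<alpha>)"
    proof (rule sum.mono_neutral_right)
      show "finite (N \<times> N)" using finN by simp
      show "P \<subseteq> N \<times> N" by (auto simp: P_def)
      show "\<forall>x\<in>N \<times> N - P. coef (t x) \<alpha> = 0"
      proof
        fix x assume x: "x \<in> N \<times> N - P"
        obtain \<beta> \<gamma> where [simp]: "x = (\<beta>, \<gamma>)" by (metis surj_pair)
        have "mdeg d \<alpha> < mdeg d (\<beta> + \<gamma>)" using x \<alpha> by (auto simp: P_def)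
        then have "coef (shift_pow (\<beta> + \<gamma>)) \<alpha> = 0"
          using tord_shift_pow[of "\<beta> + \<gamma>"] unfolding tord_def by blast
        then show "coef (t x) \<alpha> = 0" by (simp add: t_def mult.assoc)
      qed
    qed
    then show "coef (sum t P) \<alpha> = coef (sum t (N \<times> N)) \<alpha>" by simp
  qed
qed

lemma lift_hom_1: "lift_hom 1 = 1"
  using lift_hom_mconst[of 1] by (simp add: hom_1 one_eq_mconst[symmetric])

lemma lift_hom_prod:
  "(\<And>x. x \<in> S \<Longrightarrow> f x \<in> conv_mps2 d) \<Longrightarrow> tcong d n (lift_hom (prod f S)) (\<Prod>x\<in>S. lift_hom (f x))"
proof (induction S rule: infinite_finite_induct)
  case (insert x S)
  then have "tcong d n (lift_hom (f x * prod f S)) (lift_hom (f x) * lift_hom (prod f S))"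
    by (intro lift_hom_mult conv2.prod_closed) auto
  moreover have "tcong d n (lift_hom (f x) * lift_hom (prod f S)) (lift_hom (f x) * (\<Prod>x\<in>S. lift_hom (f x)))"
    using insert by (intro tcong_mult tcong_refl) auto
  ultimately show ?case using insert.hyps tcong_trans by (auto simp: tcong_def)
qed (simp_all add: lift_hom_1 tcong_refl)

lemma lift_hom_power:
  assumes "F \<in> conv_mps2 d"
  shows "tcong d n (lift_hom (F ^ k)) (lift_hom F ^ k)"
  using lift_hom_prod[of "{..<k}" "\<lambda>_. F"] assms by simp

text \<open>The k-th power of the ideal (x, t), seen only in t-degrees up to n. This restriction
  makes it stable under \<open>tcong\<close>.\<close>

definition bifilter :: "nat \<Rightarrow> complex mps mps set" where
  "bifilter k = {F. \<forall>\<gamma> \<alpha>. mdeg d \<gamma> \<le> n \<longrightarrow> mdeg d \<gamma> + mdeg d \<alpha> < k \<longrightarrow> coef (coef F \<gamma>) \<alpha> = 0}"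

text \<open>A factor without constant term raises the total order by one: a term either contains the
  vanishing constant coefficient of \<open>X\<close> or leaves too small a degree for
  \<open>F\<close>.\<close>

lemma bifilter_mult:
  assumes F: "F \<in> bifilter k" and X: "X \<in> conv_mps2 d" "coef (coef X 0) 0 = 0"
  shows "X * F \<in> bifilter (Suc k)"
  unfolding bifilter_def mem_Collect_eq
proof (intro allI impI)
  fix \<gamma> \<alpha> :: mindex
  assume \<gamma>: "mdeg d \<gamma> \<le> n" and deg: "mdeg d \<gamma> + mdeg d \<alpha> < Suc k"
  have "coef (coef X \<beta> * coef F (\<gamma> - \<beta>)) \<alpha> = 0" if \<beta>: "\<beta> \<le> \<gamma>" for \<beta>
    unfolding times_mps.rep_eq
  proof (intro sum.neutral ballI)
    fix \<delta> assume "\<delta> \<in> {\<delta>. \<delta> \<le> \<alpha>}"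
    then have \<delta>: "mdeg d \<alpha> = mdeg d \<delta> + mdeg d (\<alpha> - \<delta>)" by (simp add: mdeg_diff)
    have \<beta>': "mdeg d \<gamma> = mdeg d \<beta> + mdeg d (\<gamma> - \<beta>)" using \<beta> by (rule mdeg_diff)
    show "coef (coef X \<beta>) \<delta> * coef (coef F (\<gamma> - \<beta>)) (\<alpha> - \<delta>) = 0"
    proof (cases "mdeg d \<beta> + mdeg d \<delta> = 0")
      case False
      then have "mdeg d (\<gamma> - \<beta>) + mdeg d (\<alpha> - \<delta>) < k" "mdeg d (\<gamma> - \<beta>) \<le> n"
        using deg \<gamma> \<delta> \<beta>' by linarith+
      then show ?thesis using F by (simp add: bifilter_def)
    next
      case True
      \<comment> \<open>Total degree zero makes both indices zero if they lie in
        \<open>MI d\<close>; otherwise the coefficient of \<open>X\<close> vanishes by membership in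
        \<open>conv_mps2 d\<close>.\<close>
      have "coef (coef X \<beta>) \<delta> = 0"
      proof (cases "\<beta> \<in> MI d \<and> \<delta> \<in> MI d")
        case True
        then have "\<beta> = 0" "\<delta> = 0" using \<open>mdeg d \<beta> + mdeg d \<delta> = 0\<close> mdeg_eq_0_iff by auto
        then show ?thesis using X(2) by simp
      next
        case False
        have "coef X \<beta> \<in> conv_mps d" "\<beta> \<notin> MI d \<Longrightarrow> coef X \<beta> = 0"
          using X(1) by (simp_all add: conv_mps2_def)
        then show ?thesis
          using False conv_series_MI[of "coef (coef X \<beta>)" d \<delta>] by (cases "\<beta> \<in> MI d") (simp_all add: conv_mps_def)
      qed
      then show ?thesis by simp
    qed
  qed
  then show "coef (coef (X * F) \<gamma>) \<alpha> = 0"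
    unfolding times_mps.rep_eq[of X F] coef_sum by (intro sum.neutral) simp
qed

lemma bifilter_sum: "(\<And>x. x \<in> S \<Longrightarrow> f x \<in> bifilter k) \<Longrightarrow> sum f S \<in> bifilter k"
  by (simp add: bifilter_def)

lemma bifilter_tcong: "F \<in> bifilter k \<Longrightarrow> tcong d n F G \<Longrightarrow> G \<in> bifilter k"
  by (simp add: bifilter_def tcong_def)

text \<open>A Krull intersection argument: writing \<open>y = y(0) + \<Sum>\<^sub>i x\<^sub>i y\<^sub>i\<close>, the defect of \<open>y\<close> is the
  combination of the defects of the \<open>y\<^sub>i\<close> with coefficients in the maximal ideal of \<open>\<complex>{x}[t]\<close>.\<close>

lemma lift_hom_taylor_bifilter:
  "y \<in> conv_mps d \<Longrightarrow> taylor (\<phi> y) - lift_hom (taylor y) \<in> bifilter k"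
proof (induction k arbitrary: y)
  case 0
  then show ?case by (simp add: bifilter_def)
next
  case (Suc k)
  define q where "q = (\<lambda>i. var_quotient i y)"
  have q: "q i \<in> conv_mps d" for i unfolding q_def by (rule var_quotient_conv[OF Suc.prems])
  have y: "y = mconst (coef y 0) + (\<Sum>i<d. mvar i * q i)"
    unfolding q_def by (rule conv_decomposition[OF Suc.prems])
  have xq: "mvar i * q i \<in> conv_mps d" if "i < d" for i
    using that by (intro conv.mult_closed mvar_conv q)
  have "\<phi> y = mconst (coef y 0) + (\<Sum>i<d. \<phi> (mvar i) * \<phi> (q i))"
  proof -
    have "\<phi> y = \<phi> (mconst (coef y 0) + (\<Sum>i<d. mvar i * q i))"
      by (rule arg_cong[OF y])
    also have "\<dots> = \<phi> (mconst (coef y 0)) + \<phi> (\<Sum>i<d. mvar i * q i)"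
      by (intro hom_add mconst_conv conv.sum_closed xq) simp
    also have "\<phi> (\<Sum>i<d. mvar i * q i) = (\<Sum>i<d. \<phi> (mvar i * q i))"
      by (rule hom_sum) (simp add: xq)
    also have "\<dots> = (\<Sum>i<d. \<phi> (mvar i) * \<phi> (q i))"
      by (intro sum.cong hom_mult mvar_conv q) simp_all
    finally show ?thesis unfolding hom_mconst .
  qed
  then have 1: "taylor (\<phi> y) = mconst (mconst (coef y 0)) + (\<Sum>i<d. taylor (\<phi> (mvar i)) * taylor (\<phi> (q i)))"
    by (simp only: taylor_add taylor_mconst taylor_sum taylor_mult)
  have "taylor (mconst (coef y 0) + (\<Sum>i<d. mvar i * q i)) =
      mconst (mconst (coef y 0)) + (\<Sum>i<d. taylor (mvar i) * taylor (q i))"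
    by (simp only: taylor_add taylor_mconst taylor_sum taylor_mult)
  with arg_cong[OF y, of taylor]
  have "taylor y = mconst (mconst (coef y 0)) + (\<Sum>i<d. taylor (mvar i) * taylor (q i))"
    by (rule trans)
  then have "lift_hom (taylor y) = lift_hom (mconst (mconst (coef y 0)) + (\<Sum>i<d. taylor (mvar i) * taylor (q i)))"
    by (rule arg_cong)
  also have "\<dots> = lift_hom (mconst (mconst (coef y 0))) + lift_hom (\<Sum>i<d. taylor (mvar i) * taylor (q i))"
    by (intro lift_hom_add mconst_conv2 mconst_conv conv2.sum_closed conv2.mult_closed taylor_conv mvar_conv q) simp
  also have "lift_hom (\<Sum>i<d. taylor (mvar i) * taylor (q i)) = (\<Sum>i<d. lift_hom (taylor (mvar i) * taylor (q i)))"
    by (intro lift_hom_sum conv2.mult_closed taylor_conv mvar_conv q) simp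
  finally have 2: "lift_hom (taylor y) = mconst (mconst (coef y 0)) + (\<Sum>i<d. lift_hom (taylor (mvar i) * taylor (q i)))"
    by (simp only: lift_hom_mconst hom_mconst)
  \<comment> \<open>By \<open>hom_mvar\<close> the multiplier has no constant term, which gains one
    step of the filtration over the defect of \<open>q i\<close>.\<close>
  have "taylor (\<phi> (mvar i)) * (taylor (\<phi> (q i)) - lift_hom (taylor (q i))) \<in> bifilter (Suc k)" if "i < d" for i
    using that by (intro bifilter_mult Suc.IH q taylor_conv hom_closed mvar_conv) (simp_all add: coef_taylor hom_mvar)
  then have "(\<Sum>i<d. taylor (\<phi> (mvar i)) * (taylor (\<phi> (q i)) - lift_hom (taylor (q i)))) \<in> bifilter (Suc k)"
    by (intro bifilter_sum) simp
  \<comment> \<open>The Taylor side expands exactly; \<open>lift_hom\<close> respects the products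
    only up to \<open>tcong\<close>, to which the filtration is insensitive.\<close>
  moreover have "tcong d n (\<Sum>i<d. taylor (\<phi> (mvar i)) * (taylor (\<phi> (q i)) - lift_hom (taylor (q i))))
      (taylor (\<phi> y) - lift_hom (taylor y))"
    unfolding 1 2 add_diff_add diff_self add_0 sum_subtractf[symmetric]
  proof (rule tcong_sum)
    fix i assume "i \<in> {..<d}"
    then have i: "i < d" by simp
    have "tcong d n (lift_hom (taylor (mvar i) * taylor (q i))) (taylor (\<phi> (mvar i)) * lift_hom (taylor (q i)))"
      using lift_hom_mult[OF taylor_conv[OF mvar_conv[OF i]] taylor_conv[OF q[of i]]]
      by (simp only: lift_hom_taylor_mvar[OF i])
    then show "tcong d n (taylor (\<phi> (mvar i)) * (taylor (\<phi> (q i)) - lift_hom (taylor (q i))))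
        (taylor (\<phi> (mvar i)) * taylor (\<phi> (q i)) - lift_hom (taylor (mvar i) * taylor (q i)))"
      unfolding right_diff_distrib by (rule tcong_diff[OF tcong_refl tcong_sym])
  qed
  ultimately show ?case by (rule bifilter_tcong)
qed

text \<open>Lying in all filtration steps kills every visible coefficient: take k one larger than
  the total degree of the coefficient in question.\<close>

lemma lift_hom_taylor:
  assumes "y \<in> conv_mps d"
  shows "tcong d n (lift_hom (taylor y)) (taylor (\<phi> y))"
  unfolding tcong_def
proof (intro allI impI mps_eqI)
  fix \<gamma> \<alpha> :: mindex
  assume "mdeg d \<gamma> \<le> n"
  then have "coef (coef (taylor (\<phi> y) - lift_hom (taylor y)) \<gamma>) \<alpha> = 0"
    using lift_hom_taylor_bifilter[OF assms, of "Suc (mdeg d \<gamma> + mdeg d \<alpha>)"] by (simp add: bifilter_def)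
  then show "coef (coef (lift_hom (taylor y)) \<gamma>) \<alpha> = coef (coef (taylor (\<phi> y)) \<gamma>) \<alpha>" by simp
qed

end

section \<open>Factorization of the Jacobian matrix\<close>

lemma finite_jac_rows: "finite (jac_rows d n)"
  unfolding jac_rows_def by (rule finite_MI_mdeg)

lemma finite_jac_cols: "finite (jac_cols d n)"
  unfolding jac_cols_def by (rule finite_subset[OF _ finite_MI_mdeg[of d n]]) auto

definition mjac :: "'a::comm_ring_1 mps \<Rightarrow> mindex \<Rightarrow> mindex \<Rightarrow> 'a mps" where
  "mjac f \<beta> \<alpha> = (if \<beta> < \<alpha> then hasse (\<alpha> - \<beta>) f else 0)"

lemma mjac_conv: "f \<in> conv_mps d \<Longrightarrow> mjac f \<beta> \<alpha> \<in> conv_mps d"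
  by (simp add: mjac_def hasse_conv conv.zero_closed)

text \<open>The diagonal is the delicate place: at \<beta> = \<alpha> the Taylor expansion alone
  would contribute f, whereas the Jacobian matrix has a zero; subtracting f corrects this.\<close>

lemma coef_taylor_increment:
  assumes "\<beta> \<le> \<alpha>"
  shows "coef (taylor f - mconst f) (\<alpha> - \<beta>) = mjac f \<beta> \<alpha>"
proof (cases "\<beta> = \<alpha>")
  case True
  have "\<alpha> - \<alpha> = 0" by (rule ext) simp
  then show ?thesis using True by (simp add: coef_taylor coef_mconst mjac_def)
next
  case False
  have "\<alpha> - \<beta> \<noteq> 0"
  proof
    assume "\<alpha> - \<beta> = 0"
    then have "\<alpha> = \<beta>" using mindex_add_diff[OF assms] by simp
    then show False using False by simp
  qed
  moreover have "\<beta> < \<alpha>" using assms False by (simp add: less_le)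
  ultimately show ?thesis by (simp add: coef_taylor coef_mconst mjac_def)
qed

lemma coef_mmonom_taylor_increment:
  assumes "finite {i. \<beta> i \<noteq> 0}"
  shows "coef (mmonom \<beta> * (taylor f - mconst f)) \<alpha> = mjac f \<beta> \<alpha>"
  using coef_taylor_increment[of \<beta> \<alpha> f]
  by (simp only: coef_mmonom_mult[OF assms] mjac_def) (auto simp: less_le)

text \<open>Multiples of f(x + t) - f(x) are combinations of rows of the Jacobian matrix. Rows of
  degree below n suffice: if |\<beta>| \<ge> n, then \<beta> \<le> \<gamma> and |\<gamma>| \<le> n
  force \<beta> = \<gamma>, where the entry is zero.\<close>

lemma coef_mult_taylor_increment:
  assumes \<gamma>: "\<gamma> \<in> jac_cols d n"
  shows "coef (W * (taylor f - mconst f)) \<gamma> = (\<Sum>\<beta>\<in>jac_rows d n. coef W \<beta> * mjac f \<beta> \<gamma>)"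
proof -
  have fin: "finite {\<beta>. \<beta> \<le> \<gamma>}"
    using \<gamma> by (intro finite_mindex_le MI_finite[of _ d]) (simp add: jac_cols_def)
  have "coef (W * (taylor f - mconst f)) \<gamma> = (\<Sum>\<beta> | \<beta> \<le> \<gamma>. coef W \<beta> * mjac f \<beta> \<gamma>)"
    unfolding times_mps.rep_eq by (rule sum.cong) (simp_all only: coef_taylor_increment mem_Collect_eq)
  also have "\<dots> = (\<Sum>\<beta>\<in>jac_rows d n \<inter> {\<beta>. \<beta> \<le> \<gamma>}. coef W \<beta> * mjac f \<beta> \<gamma>)"
  proof (rule sum.mono_neutral_right[OF fin])
    show "\<forall>\<beta>\<in>{\<beta>. \<beta> \<le> \<gamma>} - jac_rows d n \<inter> {\<beta>. \<beta> \<le> \<gamma>}. coef W \<beta> * mjac f \<beta> \<gamma> = 0"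
    proof
      fix \<beta> assume \<beta>: "\<beta> \<in> {\<beta>. \<beta> \<le> \<gamma>} - jac_rows d n \<inter> {\<beta>. \<beta> \<le> \<gamma>}"
      then have le: "\<beta> \<le> \<gamma>" by simp
      have "\<beta> \<in> MI d" using MI_le[OF le] \<gamma> by (simp add: jac_cols_def)
      then have "\<not> mdeg d \<beta> \<le> n - 1" using \<beta> by (auto simp: jac_rows_def)
      then have "mdeg d (\<gamma> - \<beta>) = 0"
        using \<gamma> mdeg_diff[OF le, of d] unfolding jac_cols_def mem_Collect_eq by linarith
      moreover have "\<gamma> - \<beta> \<in> MI d" using \<gamma> by (simp add: jac_cols_def MI_diff)
      ultimately have "\<gamma> - \<beta> = 0" using mdeg_eq_0_iff by blast
      then have "\<beta> = \<gamma>" using mindex_add_diff[OF le] by simp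
      then show "coef W \<beta> * mjac f \<beta> \<gamma> = 0" by (simp add: mjac_def)
    qed
  qed simp
  also have "\<dots> = (\<Sum>\<beta>\<in>jac_rows d n. coef W \<beta> * mjac f \<beta> \<gamma>)"
    by (rule sum.mono_neutral_left[OF finite_jac_rows]) (auto simp: mjac_def less_le)
  finally show ?thesis .
qed

context conv_hom
begin

text \<open>Modulo \<open>\<phi> f\<close>, the rows \<open>t\<^sup>\<beta> (g(x + t) - g(x))\<close> of the Jacobian matrix of \<open>g = u \<phi>(f)\<close> are the images
  under \<open>lift_hom\<close> of \<open>w\<^sub>\<beta> (f(x + t) - f(x))\<close>, where \<open>w\<^sub>\<beta>\<close> is a preimage of \<open>t\<^sup>\<beta> u(x + t)\<close>.\<close>

lemma mjac_factorization:
  assumes y: "\<And>i. i < d \<Longrightarrow> y i \<in> conv_mps d" "\<And>i. i < d \<Longrightarrow> \<phi> (y i) = mvar i"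
    and v: "v \<in> conv_mps d" and f: "f \<in> conv_mps d"
  shows "\<exists>P Q r. (\<forall>\<beta> \<beta>'. P \<beta> \<beta>' \<in> conv_mps d) \<and> (\<forall>\<gamma> \<alpha>. Q \<gamma> \<alpha> \<in> conv_mps d) \<and> (\<forall>\<beta> \<alpha>. r \<beta> \<alpha> \<in> conv_mps d) \<and>
    (\<forall>\<beta>\<in>jac_rows d n. \<forall>\<alpha>\<in>jac_cols d n. mjac (\<phi> v * \<phi> f) \<beta> \<alpha> =
      (\<Sum>\<gamma>\<in>jac_cols d n. (\<Sum>\<beta>'\<in>jac_rows d n. P \<beta> \<beta>' * \<phi> (mjac f \<beta>' \<gamma>)) * Q \<gamma> \<alpha>) + r \<beta> \<alpha> * \<phi> f)"
proof -
  define u where "u = \<phi> v"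
  \<comment> \<open>\<open>lift_hom\<close> sends the increment of \<open>y i\<close> to x_i + t_i -
    x_i = t_i modulo (t)^(n+1), so the product of powers yields t^\<beta>.\<close>
  define w where "w = (\<lambda>\<beta>. (\<Prod>i<d. (taylor (y i) - mconst (y i)) ^ \<beta> i) * taylor v)"
  define H where "H = taylor f - mconst f"
  define P where "P = (\<lambda>\<beta> \<beta>'. \<phi> (coef (w \<beta>) \<beta>'))"
  define Q where "Q = (\<lambda>\<gamma> \<alpha>. coef (shift_pow \<gamma>) \<alpha>)"
  define r where "r = (\<lambda>\<beta> \<alpha>. if \<beta> \<in> MI d then mjac u \<beta> \<alpha> else 0)"
  have ty: "taylor (y i) - mconst (y i) \<in> conv_mps2 d" if "i < d" for i
    using y(1)[OF that] by (intro conv2.diff_closed taylor_conv mconst_conv2)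
  have w: "w \<beta> \<in> conv_mps2 d" for \<beta>
    unfolding w_def by (intro conv2.mult_closed conv2.prod_closed conv2.power_closed ty taylor_conv v) simp
  have H: "H \<in> conv_mps2 d"
    unfolding H_def using f by (intro conv2.diff_closed taylor_conv mconst_conv2)
  have H0: "coef H 0 = 0" by (simp add: H_def coef_taylor coef_mconst)
  have lift_y: "tcong d n (lift_hom (taylor (y i) - mconst (y i))) (mmonom (unit_mindex i))" if "i < d" for i
  proof -
    have "lift_hom (taylor (y i) - mconst (y i)) = lift_hom (taylor (y i)) - mconst (mvar i)"
      using y[OF that] by (simp add: lift_hom_diff taylor_conv mconst_conv2 lift_hom_mconst)
    moreover have "tcong d n (lift_hom (taylor (y i))) (taylor (mvar i))"
      using lift_hom_taylor[OF y(1)[OF that]] y(2)[OF that] by simp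
    ultimately have "tcong d n (lift_hom (taylor (y i) - mconst (y i))) (taylor (mvar i) - mconst (mvar i))"
      by (simp only: tcong_diff tcong_refl)
    then show ?thesis by (simp only: taylor_mvar add_diff_cancel_left')
  qed
  have lift_w: "tcong d n (lift_hom (w \<beta>)) (mmonom \<beta> * taylor u)" if "\<beta> \<in> MI d" for \<beta>
  proof -
    have a1: "tcong d n (lift_hom (w \<beta>)) (lift_hom (\<Prod>i<d. (taylor (y i) - mconst (y i)) ^ \<beta> i) * lift_hom (taylor v))"
      unfolding w_def by (intro lift_hom_mult conv2.prod_closed conv2.power_closed ty taylor_conv v) simp
    have a2: "tcong d n (lift_hom (\<Prod>i<d. (taylor (y i) - mconst (y i)) ^ \<beta> i))
        (\<Prod>i<d. lift_hom ((taylor (y i) - mconst (y i)) ^ \<beta> i))"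
      by (intro lift_hom_prod conv2.power_closed ty) simp
    have a3: "tcong d n (\<Prod>i<d. lift_hom ((taylor (y i) - mconst (y i)) ^ \<beta> i)) (\<Prod>i<d. mvar i ^ \<beta> i)"
    proof (rule tcong_prod)
      fix i assume "i \<in> {..<d}"
      then have i: "i < d" by simp
      show "tcong d n (lift_hom ((taylor (y i) - mconst (y i)) ^ \<beta> i)) (mvar i ^ \<beta> i)"
        by (rule tcong_trans[OF lift_hom_power[OF ty[OF i]] tcong_power[OF lift_y[OF i]]])
    qed
    have a4: "(\<Prod>i<d. mvar i ^ \<beta> i) = (mmonom \<beta> :: complex mps mps)"
      by (rule mmonom_eq_prod[OF that, symmetric])
    have a5: "tcong d n (lift_hom (taylor v)) (taylor u)"
      unfolding u_def by (rule lift_hom_taylor[OF v])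
    show ?thesis
      using tcong_trans[OF a1 tcong_mult[OF tcong_trans[OF a2 a3] a5]] unfolding a4 .
  qed
  have lift_H: "tcong d n (lift_hom H) (taylor (\<phi> f) - mconst (\<phi> f))"
    unfolding H_def
    using f by (simp only: lift_hom_diff taylor_conv mconst_conv2 lift_hom_mconst)
      (intro tcong_diff tcong_refl lift_hom_taylor)
  have eq: "mjac (u * \<phi> f) \<beta> \<alpha> =
      (\<Sum>\<gamma>\<in>jac_cols d n. (\<Sum>\<beta>'\<in>jac_rows d n. P \<beta> \<beta>' * \<phi> (mjac f \<beta>' \<gamma>)) * Q \<gamma> \<alpha>) + r \<beta> \<alpha> * \<phi> f"
    if \<beta>: "\<beta> \<in> jac_rows d n" and \<alpha>: "\<alpha> \<in> jac_cols d n" for \<alpha> \<beta>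
  proof -
    have \<beta>': "\<beta> \<in> MI d" and \<alpha>': "mdeg d \<alpha> \<le> n" using \<alpha> \<beta> by (simp_all add: jac_cols_def jac_rows_def)
    note fin = MI_finite[OF \<beta>']
    \<comment> \<open>The product rule for increments splits off a multiple of \<phi> f, which
      becomes the error term with coefficient \<open>r\<close>.\<close>
    have "taylor (u * \<phi> f) - mconst (u * \<phi> f) =
        taylor u * (taylor (\<phi> f) - mconst (\<phi> f)) + mconst (\<phi> f) * (taylor u - mconst u)"
      by (simp add: taylor_mult mconst_mult algebra_simps)
    then have "mjac (u * \<phi> f) \<beta> \<alpha> =
        coef (mmonom \<beta> * (taylor u * (taylor (\<phi> f) - mconst (\<phi> f)) + mconst (\<phi> f) * (taylor u - mconst u))) \<alpha>"
      using coef_mmonom_taylor_increment[OF fin, of "u * \<phi> f" \<alpha>] by simp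
    also have "\<dots> = coef (mmonom \<beta> * taylor u * (taylor (\<phi> f) - mconst (\<phi> f))
        + mconst (\<phi> f) * (mmonom \<beta> * (taylor u - mconst u))) \<alpha>"
      by (simp only: distrib_left mult_ac)
    also have "\<dots> = coef (mmonom \<beta> * taylor u * (taylor (\<phi> f) - mconst (\<phi> f))) \<alpha> + \<phi> f * mjac u \<beta> \<alpha>"
      by (simp only: coef_add coef_mconst_mult coef_mmonom_taylor_increment[OF fin])
    also have "coef (mmonom \<beta> * taylor u * (taylor (\<phi> f) - mconst (\<phi> f))) \<alpha> = coef (lift_hom (w \<beta> * H)) \<alpha>"
    proof -
      have "tcong d n (lift_hom (w \<beta> * H)) (mmonom \<beta> * taylor u * (taylor (\<phi> f) - mconst (\<phi> f)))"
        by (rule tcong_trans[OF lift_hom_mult[OF w H] tcong_mult[OF lift_w[OF \<beta>'] lift_H]])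
      then show ?thesis using \<alpha>' by (simp add: tcong_def)
    qed
    also have "coef (lift_hom (w \<beta> * H)) \<alpha> = (\<Sum>\<gamma> | \<gamma> \<in> MI d \<and> mdeg d \<gamma> \<le> n. \<phi> (coef (w \<beta> * H) \<gamma>) * Q \<gamma> \<alpha>)"
      by (simp add: lift_hom_def Q_def)
    \<comment> \<open>\<open>H\<close> has no constant term in t, so \<gamma> = 0 contributes
      nothing and exactly the columns of degree 1 to n remain.\<close>
    also have "\<dots> = (\<Sum>\<gamma>\<in>jac_cols d n. \<phi> (coef (w \<beta> * H) \<gamma>) * Q \<gamma> \<alpha>)"
    proof (rule sum.mono_neutral_right)
      show "finite {\<gamma>. \<gamma> \<in> MI d \<and> mdeg d \<gamma> \<le> n}" by (rule finite_MI_mdeg)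
      show "jac_cols d n \<subseteq> {\<gamma>. \<gamma> \<in> MI d \<and> mdeg d \<gamma> \<le> n}" by (auto simp: jac_cols_def)
      show "\<forall>\<gamma>\<in>{\<gamma>. \<gamma> \<in> MI d \<and> mdeg d \<gamma> \<le> n} - jac_cols d n. \<phi> (coef (w \<beta> * H) \<gamma>) * Q \<gamma> \<alpha> = 0"
      proof
        fix \<gamma> assume "\<gamma> \<in> {\<gamma>. \<gamma> \<in> MI d \<and> mdeg d \<gamma> \<le> n} - jac_cols d n"
        then have "\<gamma> \<in> MI d" "mdeg d \<gamma> = 0" by (auto simp: jac_cols_def)
        then have "\<gamma> = 0" using mdeg_eq_0_iff by blast
        moreover have "{\<beta>. \<beta> \<le> (0::mindex)} = {0}" by (auto simp: le_fun_def)
        ultimately have "coef (w \<beta> * H) \<gamma> = 0" using H0 by (simp add: times_mps.rep_eq)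
        then show "\<phi> (coef (w \<beta> * H) \<gamma>) * Q \<gamma> \<alpha> = 0" by (simp add: hom_0)
      qed
    qed
    also have "\<dots> = (\<Sum>\<gamma>\<in>jac_cols d n. (\<Sum>\<beta>'\<in>jac_rows d n. P \<beta> \<beta>' * \<phi> (mjac f \<beta>' \<gamma>)) * Q \<gamma> \<alpha>)"
    proof (rule sum.cong[OF refl])
      fix \<gamma> assume "\<gamma> \<in> jac_cols d n"
      then have "\<phi> (coef (w \<beta> * H) \<gamma>) = \<phi> (\<Sum>\<beta>'\<in>jac_rows d n. coef (w \<beta>) \<beta>' * mjac f \<beta>' \<gamma>)"
        unfolding H_def by (simp only: coef_mult_taylor_increment)
      also have "\<dots> = (\<Sum>\<beta>'\<in>jac_rows d n. P \<beta> \<beta>' * \<phi> (mjac f \<beta>' \<gamma>))"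
        unfolding P_def
        by (simp only: hom_sum[OF conv.mult_closed[OF conv2_coef[OF w] mjac_conv[OF f]]]
            hom_mult[OF conv2_coef[OF w] mjac_conv[OF f]])
      finally show "\<phi> (coef (w \<beta> * H) \<gamma>) * Q \<gamma> \<alpha> = (\<Sum>\<beta>'\<in>jac_rows d n. P \<beta> \<beta>' * \<phi> (mjac f \<beta>' \<gamma>)) * Q \<gamma> \<alpha>"
        by (simp only:)
    qed
    finally show ?thesis using \<beta>' by (simp only: r_def if_True mult.commute)
  qed
  have "P \<beta> \<beta>' \<in> conv_mps d" "Q \<gamma> \<alpha> \<in> conv_mps d" "r \<beta> \<alpha> \<in> conv_mps d" for \<alpha> \<beta> \<beta>' \<gamma>
    unfolding P_def Q_def r_def u_def
    by (simp_all add: hom_closed conv2_coef[OF w] conv2_coef[OF shift_pow_conv2] mjac_conv[OF hom_closed[OF v]] conv.zero_closed)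
  with eq show ?thesis unfolding u_def by (intro exI[of _ P] exI[of _ Q] exI[of _ r]) blast
qed

text \<open>The error term lies in \<open>I\<close> entrywise, so modulo \<open>I\<close> the minor
  can be computed from the product of three matrices, whose determinant is a combination of images
  of minors of f.\<close>

lemma minors_in_ideal:
  assumes I: "ideal_on (conv_mps d) I"
    and y: "\<And>i. i < d \<Longrightarrow> y i \<in> conv_mps d" "\<And>i. i < d \<Longrightarrow> \<phi> (y i) = mvar i"
    and v: "v \<in> conv_mps d" and f: "f \<in> conv_mps d"
    and f_in: "\<phi> f \<in> I"
    and minors: "\<And>b c. inj_on b {..<m} \<Longrightarrow> b ` {..<m} \<subseteq> jac_rows d n \<Longrightarrow> inj_on c {..<m} \<Longrightarrow>
      c ` {..<m} \<subseteq> jac_cols d n \<Longrightarrow> \<phi> (ldet m (\<lambda>i j. mjac f (b i) (c j))) \<in> I"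
    and b: "b ` {..<m} \<subseteq> jac_rows d n" and c: "c ` {..<m} \<subseteq> jac_cols d n"
  shows "ldet m (\<lambda>i j. mjac (\<phi> v * \<phi> f) (b i) (c j)) \<in> I"
proof -
  interpret I: ideal_on "conv_mps d" I by (rule I)
  have "\<exists>P Q r. (\<forall>\<beta> \<beta>'. P \<beta> \<beta>' \<in> conv_mps d) \<and> (\<forall>\<gamma> \<alpha>. Q \<gamma> \<alpha> \<in> conv_mps d) \<and> (\<forall>\<beta> \<alpha>. r \<beta> \<alpha> \<in> conv_mps d) \<and>
    (\<forall>\<beta>\<in>jac_rows d n. \<forall>\<alpha>\<in>jac_cols d n. mjac (\<phi> v * \<phi> f) \<beta> \<alpha> =
      (\<Sum>\<gamma>\<in>jac_cols d n. (\<Sum>\<beta>'\<in>jac_rows d n. P \<beta> \<beta>' * \<phi> (mjac f \<beta>' \<gamma>)) * Q \<gamma> \<alpha>) + r \<beta> \<alpha> * \<phi> f)"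
    by (rule mjac_factorization[OF y v f])
  then obtain P Q r
    where "\<forall>\<beta> \<beta>'. P \<beta> \<beta>' \<in> conv_mps d" "\<forall>\<gamma> \<alpha>. Q \<gamma> \<alpha> \<in> conv_mps d" "\<forall>\<beta> \<alpha>. r \<beta> \<alpha> \<in> conv_mps d"
      and eq: "\<forall>\<beta>\<in>jac_rows d n. \<forall>\<alpha>\<in>jac_cols d n. mjac (\<phi> v * \<phi> f) \<beta> \<alpha> =
      (\<Sum>\<gamma>\<in>jac_cols d n. (\<Sum>\<beta>'\<in>jac_rows d n. P \<beta> \<beta>' * \<phi> (mjac f \<beta>' \<gamma>)) * Q \<gamma> \<alpha>) + r \<beta> \<alpha> * \<phi> f"
    by (elim exE conjE)
  then have PQr: "\<And>\<beta> \<beta>'. P \<beta> \<beta>' \<in> conv_mps d" "\<And>\<gamma> \<alpha>. Q \<gamma> \<alpha> \<in> conv_mps d" "\<And>\<beta> \<alpha>. r \<beta> \<alpha> \<in> conv_mps d"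
    by blast+
  define S where "S = (\<lambda>\<beta> \<alpha>. \<Sum>\<gamma>\<in>jac_cols d n. (\<Sum>\<beta>'\<in>jac_rows d n. P \<beta> \<beta>' * \<phi> (mjac f \<beta>' \<gamma>)) * Q \<gamma> \<alpha>)"
  have S: "S \<beta> \<alpha> \<in> conv_mps d" for \<alpha> \<beta>
    unfolding S_def by (intro conv.sum_closed conv.mult_closed PQr hom_closed mjac_conv f)
  \<comment> \<open>Absence of 2-torsion, for determinants with repeated rows or columns.\<close>
  have two: "x = 0" if "x + x = 0" for x :: "complex mps"
  proof (rule mps_eqI)
    fix \<alpha>
    have "coef x \<alpha> + coef x \<alpha> = 0"
      using arg_cong[OF that, of "\<lambda>z. coef z \<alpha>"] by (simp only: coef_add coef_zero)
    then show "coef x \<alpha> = coef 0 \<alpha>" by simp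
  qed
  have "ldet m (\<lambda>i j. S (b i) (c j)) \<in> I"
    unfolding S_def
  proof (rule I.ideal_ldet_product[OF two finite_jac_rows finite_jac_cols])
    fix b' c' assume "inj_on b' {..<m}" "b' ` {..<m} \<subseteq> jac_rows d n" "inj_on c' {..<m}" "c' ` {..<m} \<subseteq> jac_cols d n"
    then have "\<phi> (ldet m (\<lambda>i j. mjac f (b' i) (c' j))) \<in> I" by (rule minors)
    then show "ldet m (\<lambda>i j. \<phi> (mjac f (b' i) (c' j))) \<in> I"
      by (subst (asm) hom_ldet) (rule mjac_conv[OF f])
  qed (simp_all only: PQr)
  moreover have "ldet m (\<lambda>i j. mjac (\<phi> v * \<phi> f) (b i) (c j)) - ldet m (\<lambda>i j. S (b i) (c j)) \<in> I"
  proof (rule I.ideal_ldet_diff)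
    fix i j assume ij: "i < m" "j < m"
    show "mjac (\<phi> v * \<phi> f) (b i) (c j) \<in> conv_mps d"
      by (intro mjac_conv conv.mult_closed hom_closed v f)
    show "S (b i) (c j) \<in> conv_mps d" by (rule S)
    have "b i \<in> jac_rows d n" "c j \<in> jac_cols d n" using b c ij by auto
    then have "mjac (\<phi> v * \<phi> f) (b i) (c j) - S (b i) (c j) = r (b i) (c j) * \<phi> f"
      unfolding S_def by (simp add: eq)
    then show "mjac (\<phi> v * \<phi> f) (b i) (c j) - S (b i) (c j) \<in> I"
      by (simp add: I.ideal_mult PQr(3) f_in)
  qed
  ultimately have "(ldet m (\<lambda>i j. mjac (\<phi> v * \<phi> f) (b i) (c j)) - ldet m (\<lambda>i j. S (b i) (c j)))
      + ldet m (\<lambda>i j. S (b i) (c j)) \<in> I"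
    by (intro I.ideal_add)
  then show ?thesis by simp
qed

end

section \<open>Transfer to the ring of convergent power series\<close>

lemma MPS_conv: "x \<in> conv_series d \<Longrightarrow> MPS x \<in> conv_mps d"
  unfolding conv_mps_def mem_Collect_eq by (simp only: coef_MPS)

lemma coef_conv [simp]: "a \<in> conv_mps d \<Longrightarrow> coef a \<in> conv_series d"
  by (simp only: conv_mps_def mem_Collect_eq)

lemma conv_series_obtain:
  assumes "x \<in> conv_series d"
  obtains a where "a \<in> conv_mps d" "x = coef a"
proof (rule that[of "MPS x"])
  show "MPS x \<in> conv_mps d" by (rule MPS_conv[OF assms])
  show "x = coef (MPS x)" by (rule coef_MPS[OF assms, symmetric])
qed

lemma cst_eq_coef: "cst a = coef (mconst a)"
  unfolding cst_def mconst.rep_eq zero_fun_def by (rule refl)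

lemma Cx_carrier [simp]: "carrier (Cx d) = conv_series d"
  by (simp add: Cx_def)

lemma Cx_mult: "coef a \<otimes>\<^bsub>Cx d\<^esub> coef b = coef (a * b)"
  by (simp add: Cx_def ps_mult_coef)

lemma Cx_add: "coef a \<oplus>\<^bsub>Cx d\<^esub> coef b = coef (a + b)"
  by (simp add: Cx_def plus_mps.rep_eq)

lemma Cx_zero: "\<zero>\<^bsub>Cx d\<^esub> = coef 0"
  by (simp add: Cx_def zero_mps.rep_eq)

lemma Cx_one: "\<one>\<^bsub>Cx d\<^esub> = coef 1"
  by (simp only: one_eq_mconst cst_eq_coef[symmetric]) (simp add: Cx_def)

lemma cring_Cx: "cring (Cx d)"
proof (rule cringI)
  show "abelian_group (Cx d)"
  proof (rule abelian_groupI, unfold Cx_carrier)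
    fix x assume "x \<in> conv_series d"
    then obtain a where a: "a \<in> conv_mps d" "x = coef a" by (rule conv_series_obtain)
    show "\<zero>\<^bsub>Cx d\<^esub> \<oplus>\<^bsub>Cx d\<^esub> x = x" by (simp add: a Cx_zero Cx_add)
    show "\<exists>y\<in>conv_series d. y \<oplus>\<^bsub>Cx d\<^esub> x = \<zero>\<^bsub>Cx d\<^esub>"
      using a by (intro bexI[of _ "coef (- a)"]) (simp_all add: Cx_zero Cx_add conv.uminus_closed)
    fix y assume "y \<in> conv_series d"
    then obtain b where b: "b \<in> conv_mps d" "y = coef b" by (rule conv_series_obtain)
    show "x \<oplus>\<^bsub>Cx d\<^esub> y \<in> conv_series d" by (simp only: a b Cx_add coef_conv conv.add_closed)
    show "x \<oplus>\<^bsub>Cx d\<^esub> y = y \<oplus>\<^bsub>Cx d\<^esub> x" by (simp only: a b Cx_add add.commute)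
    fix z assume "z \<in> conv_series d"
    then obtain c where c: "c \<in> conv_mps d" "z = coef c" by (rule conv_series_obtain)
    show "x \<oplus>\<^bsub>Cx d\<^esub> y \<oplus>\<^bsub>Cx d\<^esub> z = x \<oplus>\<^bsub>Cx d\<^esub> (y \<oplus>\<^bsub>Cx d\<^esub> z)"
      by (simp only: a b c Cx_add add.assoc)
  next
    show "\<zero>\<^bsub>Cx d\<^esub> \<in> conv_series d" by (simp add: Cx_zero conv.zero_closed)
  qed
  show "comm_monoid (Cx d)"
  proof (rule comm_monoidI, unfold Cx_carrier)
    fix x assume "x \<in> conv_series d"
    then obtain a where a: "a \<in> conv_mps d" "x = coef a" by (rule conv_series_obtain)
    show "\<one>\<^bsub>Cx d\<^esub> \<otimes>\<^bsub>Cx d\<^esub> x = x" by (simp add: a Cx_one Cx_mult)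
    fix y assume "y \<in> conv_series d"
    then obtain b where b: "b \<in> conv_mps d" "y = coef b" by (rule conv_series_obtain)
    show "x \<otimes>\<^bsub>Cx d\<^esub> y \<in> conv_series d" by (simp only: a b Cx_mult coef_conv conv.mult_closed)
    show "x \<otimes>\<^bsub>Cx d\<^esub> y = y \<otimes>\<^bsub>Cx d\<^esub> x" by (simp only: a b Cx_mult mult.commute)
    fix z assume "z \<in> conv_series d"
    then obtain c where c: "c \<in> conv_mps d" "z = coef c" by (rule conv_series_obtain)
    show "x \<otimes>\<^bsub>Cx d\<^esub> y \<otimes>\<^bsub>Cx d\<^esub> z = x \<otimes>\<^bsub>Cx d\<^esub> (y \<otimes>\<^bsub>Cx d\<^esub> z)"
      by (simp only: a b c Cx_mult mult.assoc)
  next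
    show "\<one>\<^bsub>Cx d\<^esub> \<in> conv_series d" by (simp add: Cx_one conv.one_closed)
  qed
  fix x y z assume "x \<in> carrier (Cx d)" "y \<in> carrier (Cx d)" "z \<in> carrier (Cx d)"
  then obtain a b c where "x = coef a" "y = coef b" "z = coef c"
    unfolding Cx_carrier by (metis conv_series_obtain)
  then show "(x \<oplus>\<^bsub>Cx d\<^esub> y) \<otimes>\<^bsub>Cx d\<^esub> z = x \<otimes>\<^bsub>Cx d\<^esub> z \<oplus>\<^bsub>Cx d\<^esub> y \<otimes>\<^bsub>Cx d\<^esub> z"
    by (simp only: Cx_add Cx_mult distrib_right)
qed

interpretation Cx: cring "Cx d" for d
  by (rule cring_Cx)

lemma Cx_uminus: "a \<in> conv_mps d \<Longrightarrow> \<ominus>\<^bsub>Cx d\<^esub> coef a = coef (- a)"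
  by (rule Cx.minus_equality) (simp_all add: Cx_add Cx_zero conv.uminus_closed)

lemma Cx_finsum:
  assumes "finite S" "\<And>x. x \<in> S \<Longrightarrow> f x \<in> conv_mps d"
  shows "(\<Oplus>\<^bsub>Cx d\<^esub>x\<in>S. coef (f x)) = coef (sum f S)"
  using assms
proof (induction S rule: finite_induct)
  case (insert x S)
  then have "(\<lambda>x. coef (f x)) \<in> S \<rightarrow> carrier (Cx d)" "coef (f x) \<in> carrier (Cx d)" by simp_all
  then have "(\<Oplus>\<^bsub>Cx d\<^esub>x\<in>insert x S. coef (f x)) = coef (f x) \<oplus>\<^bsub>Cx d\<^esub> (\<Oplus>\<^bsub>Cx d\<^esub>x\<in>S. coef (f x))"
    by (rule Cx.finsum_insert[OF insert.hyps])
  also have "(\<Oplus>\<^bsub>Cx d\<^esub>x\<in>S. coef (f x)) = coef (sum f S)"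
    using insert.prems by (intro insert.IH) simp
  finally show ?case by (simp only: Cx_add sum.insert[OF insert.hyps])
qed (simp add: Cx_zero)

lemma Cx_finprod:
  assumes "finite S" "\<And>x. x \<in> S \<Longrightarrow> f x \<in> conv_mps d"
  shows "(\<Otimes>\<^bsub>Cx d\<^esub>x\<in>S. coef (f x)) = coef (prod f S)"
  using assms
proof (induction S rule: finite_induct)
  case (insert x S)
  then have "(\<lambda>x. coef (f x)) \<in> S \<rightarrow> carrier (Cx d)" "coef (f x) \<in> carrier (Cx d)" by simp_all
  then have "(\<Otimes>\<^bsub>Cx d\<^esub>x\<in>insert x S. coef (f x)) = coef (f x) \<otimes>\<^bsub>Cx d\<^esub> (\<Otimes>\<^bsub>Cx d\<^esub>x\<in>S. coef (f x))"
    by (rule Cx.finprod_insert[OF insert.hyps])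
  also have "(\<Otimes>\<^bsub>Cx d\<^esub>x\<in>S. coef (f x)) = coef (prod f S)"
    using insert.prems by (intro insert.IH) simp
  finally show ?case by (simp only: Cx_mult prod.insert[OF insert.hyps])
qed (simp add: Cx_one)

lemma rdet_Cx:
  assumes M: "\<And>i j. i < m \<Longrightarrow> j < m \<Longrightarrow> N i j = coef (M i j)" "\<And>i j. M i j \<in> conv_mps d"
  shows "rdet (Cx d) m N = coef (ldet m M)"
proof -
  have fin: "finite {\<pi>. \<pi> permutes {..<m}}" by (rule finite_permutations) simp
  have prod: "(\<Otimes>\<^bsub>Cx d\<^esub>i\<in>{..<m}. N i (\<pi> i)) = coef (\<Prod>i<m. M i (\<pi> i))" if "\<pi> permutes {..<m}" for \<pi>
  proof -
    have "(\<Otimes>\<^bsub>Cx d\<^esub>i\<in>{..<m}. N i (\<pi> i)) = (\<Otimes>\<^bsub>Cx d\<^esub>i\<in>{..<m}. coef (M i (\<pi> i)))"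
      using permutes_in_image[OF that] M by (intro Cx.finprod_cong') auto
    also have "\<dots> = coef (\<Prod>i<m. M i (\<pi> i))" using M(2) by (intro Cx_finprod) simp_all
    finally show ?thesis .
  qed
  have in_A: "of_int (sign \<pi>) * (\<Prod>i<m. M i (\<pi> i)) \<in> conv_mps d" for \<pi>
    by (intro conv.mult_closed conv.sign_closed conv.prod_closed M(2))
  \<comment> \<open>The case distinction in \<open>rdet\<close> is multiplication by the sign of
    \<pi>.\<close>
  have summand: "(if sign \<pi> = 1 then (\<lambda>x. x) else a_inv (Cx d)) (\<Otimes>\<^bsub>Cx d\<^esub>i\<in>{..<m}. N i (\<pi> i)) =
      coef (of_int (sign \<pi>) * (\<Prod>i<m. M i (\<pi> i)))" if "\<pi> permutes {..<m}" for \<pi>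
    using conv.prod_closed[of "{..<m}" "\<lambda>i. M i (\<pi> i)" d, OF M(2)]
    by (cases rule: sign_cases[of \<pi>]) (simp_all add: prod[OF that] Cx_uminus)
  have "rdet (Cx d) m N = (\<Oplus>\<^bsub>Cx d\<^esub>\<pi>\<in>{\<pi>. \<pi> permutes {..<m}}. coef (of_int (sign \<pi>) * (\<Prod>i<m. M i (\<pi> i))))"
    unfolding rdet_def using in_A summand by (intro Cx.finsum_cong') auto
  also have "\<dots> = coef (ldet m M)"
    unfolding ldet_def by (rule Cx_finsum[OF fin in_A])
  finally show ?thesis .
qed

lemma Jac_eq_mjac: "\<alpha> \<in> MI d \<Longrightarrow> Jac d (coef f) \<beta> \<alpha> = coef (mjac f \<beta> \<alpha>)"
  using dder_eq_hasse[OF MI_diff, of \<alpha> d \<beta> f]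
  by (simp add: Jac_def mjac_def fun_diff_def zero_mps.rep_eq)

text \<open>Columns have to lie in \<open>MI d\<close>, because \<open>dder\<close> takes its
  binomials over the first d coordinates, whereas \<open>hasse\<close> uses the whole
  support.\<close>

lemma rdet_Jac:
  assumes "f \<in> conv_mps d" "c ` {..<m} \<subseteq> jac_cols d n"
  shows "rdet (Cx d) m (\<lambda>i j. Jac d (coef f) (b i) (c j)) = coef (ldet m (\<lambda>i j. mjac f (b i) (c j)))"
proof (rule rdet_Cx)
  fix i j assume "j < m"
  then have "c j \<in> MI d" using assms(2) by (auto simp: jac_cols_def)
  then show "Jac d (coef f) (b i) (c j) = coef (mjac f (b i) (c j))" by (rule Jac_eq_mjac)
qed (rule mjac_conv[OF assms(1)])

section \<open>The ideals of the quotients and their transport under an automorphism\<close>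

definition jac_quot_ideal :: "nat \<Rightarrow> nat \<Rightarrow> pseries \<Rightarrow> pseries set" where
  "jac_quot_ideal d n f = genideal (Cx d) (insert f (Jn_ideal d n f))"

lemma max_minors_carrier:
  assumes "f \<in> conv_series d"
  shows "max_minors d n f \<subseteq> carrier (Cx d)"
proof
  obtain a where a: "a \<in> conv_mps d" "f = coef a" using assms by (rule conv_series_obtain)
  fix x assume "x \<in> max_minors d n f"
  then obtain b c where x: "x = rdet (Cx d) (card (jac_rows d n)) (\<lambda>i j. Jac d (coef a) (b i) (c j))"
    and c: "c ` {..<card (jac_rows d n)} \<subseteq> jac_cols d n"
    unfolding max_minors_def a(2) by blast
  show "x \<in> carrier (Cx d)"
    unfolding x rdet_Jac[OF a(1) c] by (simp add: conv.ldet_closed mjac_conv a(1))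
qed

lemma Jn_ideal_ideal: "f \<in> conv_series d \<Longrightarrow> ideal (Jn_ideal d n f) (Cx d)"
  unfolding Jn_ideal_def by (intro Cx.genideal_ideal max_minors_carrier)

lemma jac_quot_gens: "f \<in> conv_series d \<Longrightarrow> insert f (Jn_ideal d n f) \<subseteq> carrier (Cx d)"
  using additive_subgroup.a_subset[OF ideal.axioms(1)[OF Jn_ideal_ideal]] by simp

lemma jac_quot_ideal: "f \<in> conv_series d \<Longrightarrow> ideal (jac_quot_ideal d n f) (Cx d)"
  unfolding jac_quot_ideal_def by (intro Cx.genideal_ideal jac_quot_gens)

lemma jac_quot_ideal_contains:
  assumes "f \<in> conv_series d"
  shows "f \<in> jac_quot_ideal d n f" "max_minors d n f \<subseteq> jac_quot_ideal d n f"
  using Cx.genideal_self[OF jac_quot_gens[OF assms, of n]] Cx.genideal_self[OF max_minors_carrier[OF assms, of n]]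
  unfolding jac_quot_ideal_def Jn_ideal_def by blast+

lemma jac_quot_ideal_minimal:
  assumes "ideal K (Cx d)" "f \<in> K" "max_minors d n f \<subseteq> K"
  shows "jac_quot_ideal d n f \<subseteq> K"
  unfolding jac_quot_ideal_def Jn_ideal_def
  using assms by (intro Cx.genideal_minimal) (simp_all add: Cx.genideal_minimal)

lemma alg_aut_closed: "alg_aut d \<phi> \<Longrightarrow> x \<in> conv_series d \<Longrightarrow> \<phi> x \<in> conv_series d"
  unfolding alg_aut_def using ring_iso_memE(1)[of \<phi> "Cx d" "Cx d" x] by simp

lemma coef_mult_0: "coef (a * b) 0 = coef a 0 * coef b 0"
proof -
  have "{\<beta>. \<beta> \<le> (0::mindex)} = {0}" by (auto simp: le_fun_def)
  then show ?thesis by (simp add: times_mps.rep_eq fun_diff_def zero_fun_def)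
qed

text \<open>An automorphism cannot send a variable \<open>x\<^sub>i\<close> to a series with constant term \<open>c \<noteq> 0\<close>, because
  \<open>x\<^sub>i - c\<close> is a unit.\<close>

lemma alg_aut_conv_hom:
  assumes \<phi>: "alg_aut d \<phi>" and n: "1 \<le> n"
  shows "conv_hom d n (\<lambda>a. MPS (\<phi> (coef a)))"
proof -
  define h where "h = (\<lambda>a. MPS (\<phi> (coef a)))"
  have iso: "\<phi> \<in> ring_iso (Cx d) (Cx d)" and cst: "\<phi> (cst a) = cst a" for a
    using \<phi> by (simp_all add: alg_aut_def)
  have closed: "\<phi> (coef a) \<in> conv_series d" if "a \<in> conv_mps d" for a
    using alg_aut_closed[OF \<phi>] that by simp
  have coef_h: "coef (h a) = \<phi> (coef a)" if "a \<in> conv_mps d" for a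
    unfolding h_def by (rule coef_MPS[OF closed[OF that]])
  have h_closed: "h a \<in> conv_mps d" if "a \<in> conv_mps d" for a
    unfolding h_def by (rule MPS_conv[OF closed[OF that]])
  have h_add: "h (a + b) = h a + h b" if "a \<in> conv_mps d" "b \<in> conv_mps d" for a b
  proof -
    have "coef (h (a + b)) = \<phi> (coef a \<oplus>\<^bsub>Cx d\<^esub> coef b)"
      using that by (simp only: coef_h conv.add_closed Cx_add)
    also have "\<dots> = coef (h a) \<oplus>\<^bsub>Cx d\<^esub> coef (h b)"
      using that ring_iso_memE(3)[OF iso] by (simp only: Cx_carrier coef_h coef_conv)
    finally show ?thesis by (simp only: Cx_add coef_inject)
  qed
  have h_mult: "h (a * b) = h a * h b" if "a \<in> conv_mps d" "b \<in> conv_mps d" for a b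
  proof -
    have "coef (h (a * b)) = \<phi> (coef a \<otimes>\<^bsub>Cx d\<^esub> coef b)"
      using that by (simp only: coef_h conv.mult_closed Cx_mult)
    also have "\<dots> = coef (h a) \<otimes>\<^bsub>Cx d\<^esub> coef (h b)"
      using that ring_iso_memE(2)[OF iso] by (simp only: Cx_carrier coef_h coef_conv)
    finally show ?thesis by (simp only: Cx_mult coef_inject)
  qed
  have h_mconst: "h (mconst c) = mconst c" for c
  proof -
    have "coef (h (mconst c)) = coef (mconst c)"
      by (simp only: coef_h[OF mconst_conv] cst[of c, unfolded cst_eq_coef])
    then show ?thesis by (simp only: coef_inject)
  qed
  have h_mvar: "coef (h (mvar i)) 0 = 0" if i: "i < d" for i
  proof (rule ccontr)
    assume nz: "coef (h (mvar i)) 0 \<noteq> 0"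
    define c where "c = coef (h (mvar i)) 0"
    obtain u where u: "u \<in> conv_mps d" "(mvar i - mconst c) * u = 1"
      using mvar_minus_const_unit[OF i, of c] nz unfolding c_def by blast
    define x where "x = mvar i - mconst c"
    have x: "x \<in> conv_mps d" unfolding x_def by (intro conv.diff_closed mvar_conv i mconst_conv)
    have "h (mvar i) = h (x + mconst c)" by (simp add: x_def)
    also have "\<dots> = h x + mconst c" by (simp only: h_add[OF x mconst_conv] h_mconst)
    finally have "coef (h (mvar i)) 0 = coef (h x + mconst c) 0" by (rule arg_cong)
    then have "c = coef (h x) 0 + c" by (simp only: coef_add coef_mconst c_def[symmetric] simp_thms if_True)
    then have "coef (h x) 0 = 0" by simp
    \<comment> \<open>A unit has nonzero constant term, yet the unit x_i - c has been sent to a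
      series with constant term zero.\<close>
    moreover have "h x * h u = 1"
      using h_mult[OF x u(1)] u(2) h_mconst[of 1] unfolding x_def[symmetric] one_eq_mconst[symmetric] by simp
    ultimately have "coef 1 (0::mindex) = (0::complex)"
      using coef_mult_0[of "h x" "h u"] by simp
    then show False by (simp add: one_mps.rep_eq)
  qed
  show ?thesis
    unfolding h_def[symmetric]
    by (rule conv_hom.intro[OF n h_closed h_add h_mult h_mconst h_mvar])
qed

lemma alg_aut_ring_hom_ring: "alg_aut d \<phi> \<Longrightarrow> ring_hom_ring (Cx d) (Cx d) \<phi>"
  by (intro ring_hom_ringI2 Cx.ring_axioms) (simp add: alg_aut_def ring_iso_def)

text \<open>By minimality it suffices that the preimage under \<psi> of the ideal of f is an ideal
  containing g and its maximal minors. \<psi> is passed with both inverse laws, so that the lemma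
  can be applied a second time with the roles of f and g exchanged.\<close>

lemma jac_quot_ideal_transport:
  assumes \<phi>: "alg_aut d \<phi>" and \<psi>: "alg_aut d \<psi>"
    and inv: "\<And>x. x \<in> conv_series d \<Longrightarrow> \<phi> (\<psi> x) = x" "\<And>x. x \<in> conv_series d \<Longrightarrow> \<psi> (\<phi> x) = x"
    and n: "1 \<le> n" and f: "f \<in> conv_series d" and u: "u \<in> conv_series d"
    and g: "g = u \<otimes>\<^bsub>Cx d\<^esub> \<phi> f"
  shows "jac_quot_ideal d n g \<subseteq> {x \<in> conv_series d. \<psi> x \<in> jac_quot_ideal d n f}"
proof -
  define m where "m = card (jac_rows d n)"
  define K where "K = {x \<in> conv_series d. \<psi> x \<in> jac_quot_ideal d n f}"
  have K: "ideal K (Cx d)"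
    using ring_hom_ring.ideal_vimage[OF alg_aut_ring_hom_ring[OF \<psi>] jac_quot_ideal[OF f, of n]]
    by (simp add: K_def)
  interpret K: ideal K "Cx d" by (rule K)
  define h where "h = (\<lambda>a. MPS (\<phi> (coef a)))"
  interpret conv_hom d n h
    unfolding h_def by (rule alg_aut_conv_hom[OF \<phi> n])
  have coef_h: "coef (h a) = \<phi> (coef a)" if "a \<in> conv_mps d" for a
    unfolding h_def using that by (intro coef_MPS[of _ d] alg_aut_closed[OF \<phi>]) simp
  \<comment> \<open>The same ideal, viewed inside the type of formal series.\<close>
  define I where "I = {a \<in> conv_mps d. coef a \<in> K}"
  have I: "ideal_on (conv_mps d) I"
  proof
    show "I \<subseteq> conv_mps d" by (auto simp: I_def)
    show "0 \<in> I" using K.zero_closed by (simp add: I_def Cx_zero conv.zero_closed)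
    show "a + b \<in> I" if "a \<in> I" "b \<in> I" for a b
      using that K.a_closed[of "coef a" "coef b"] by (simp add: I_def Cx_add conv.add_closed)
    show "a * b \<in> I" if "a \<in> conv_mps d" "b \<in> I" for a b
      using that K.I_l_closed[of "coef b" "coef a"] by (simp add: I_def Cx_mult conv.mult_closed)
  qed
  have I_h: "h a \<in> I" if "a \<in> conv_mps d" "coef a \<in> jac_quot_ideal d n f" for a
    using that alg_aut_closed[OF \<phi>] by (simp add: I_def K_def coef_h hom_closed inv(2))
  define f' where "f' = MPS f"
  \<comment> \<open>Preimages under \<phi>: here \<phi>(v) = u and \<phi>(y_i) = x_i, as the
    factorization of the Jacobian matrix requires.\<close>
  define v where "v = MPS (\<psi> u)"
  define y where "y = (\<lambda>i. MPS (\<psi> (coef (mvar i))))"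
  have f': "f' \<in> conv_mps d" "coef f' = f" using f by (simp_all add: f'_def MPS_conv coef_MPS)
  have v: "v \<in> conv_mps d" "coef v = \<psi> u"
    using alg_aut_closed[OF \<psi> u] by (simp_all add: v_def MPS_conv coef_MPS)
  have y: "y i \<in> conv_mps d" "h (y i) = mvar i" if "i < d" for i
  proof -
    have x: "coef (mvar i) \<in> conv_series d" using mvar_conv[OF that] by simp
    show yc: "y i \<in> conv_mps d" unfolding y_def by (intro MPS_conv alg_aut_closed[OF \<psi>] x)
    have "coef (y i) = \<psi> (coef (mvar i))" unfolding y_def by (intro coef_MPS[of _ d] alg_aut_closed[OF \<psi>] x)
    then have "coef (h (y i)) = coef (mvar i)" using coef_h[OF yc] inv(1)[OF x] by simp
    then show "h (y i) = mvar i" by (simp only: coef_inject)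
  qed
  have g': "g = coef (h v * h f')"
  proof -
    have "g = coef (h v) \<otimes>\<^bsub>Cx d\<^esub> coef (h f')"
      by (simp only: g coef_h[OF v(1)] coef_h[OF f'(1)] v(2) f'(2) inv(1)[OF u])
    then show ?thesis by (simp only: Cx_mult)
  qed
  have hf: "h f' \<in> I" using f' jac_quot_ideal_contains(1)[OF f] by (intro I_h) simp_all
  have "h (ldet m (\<lambda>i j. mjac f' (b i) (c j))) \<in> I"
    if b: "inj_on b {..<m}" "b ` {..<m} \<subseteq> jac_rows d n" and c: "inj_on c {..<m}" "c ` {..<m} \<subseteq> jac_cols d n" for b c
  proof (rule I_h)
    show "ldet m (\<lambda>i j. mjac f' (b i) (c j)) \<in> conv_mps d" by (intro conv.ldet_closed mjac_conv f')
    \<comment> \<open>An injective choice of m among m rows is a bijection, so the determinant is a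
      maximal minor.\<close>
    have "b ` {..<m} = jac_rows d n"
      using b by (intro card_subset_eq finite_jac_rows) (simp_all add: card_image m_def)
    then have "bij_betw b {..<m} (jac_rows d n)" using b by (simp add: bij_betw_def)
    then have "rdet (Cx d) m (\<lambda>i j. Jac d f (b i) (c j)) \<in> max_minors d n f"
      unfolding max_minors_def m_def[symmetric] mem_Collect_eq
      using c by (intro exI[of _ b] exI[of _ c] conjI refl)
    then show "coef (ldet m (\<lambda>i j. mjac f' (b i) (c j))) \<in> jac_quot_ideal d n f"
      using jac_quot_ideal_contains(2)[OF f] rdet_Jac[OF f'(1) c(2), of b] f'(2) by auto
  qed
  note minors = minors_in_ideal[OF I y v(1) f'(1) hf this]
  have hvf: "h v * h f' \<in> conv_mps d" by (intro conv.mult_closed hom_closed v f')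
  have "max_minors d n g \<subseteq> K"
  proof
    fix x assume "x \<in> max_minors d n g"
    then obtain b c where x: "x = rdet (Cx d) m (\<lambda>i j. Jac d g (b i) (c j))"
      and b: "bij_betw b {..<m} (jac_rows d n)" and c: "c ` {..<m} \<subseteq> jac_cols d n"
      unfolding max_minors_def m_def by blast
    have "ldet m (\<lambda>i j. mjac (h v * h f') (b i) (c j)) \<in> I"
      using b c by (intro minors) (auto simp: bij_betw_def)
    then show "x \<in> K" unfolding x g' rdet_Jac[OF hvf c] by (simp add: I_def)
  qed
  moreover have "g \<in> K"
    using ideal_on.ideal_mult[OF I hom_closed[OF v(1)] hf] by (simp add: g' I_def)
  ultimately show ?thesis
    using jac_quot_ideal_minimal[OF K] by (simp only: K_def)
qed

text \<open>The first isomorphism theorem for x \<mapsto> J + \<phi>(x), which is surjective with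
  kernel I; constants are respected because \<phi> fixes them.\<close>

lemma quot_alg_iso_transport:
  assumes \<phi>: "alg_aut d \<phi>" and I: "ideal I (Cx d)" and J: "ideal J (Cx d)"
    and IJ: "\<And>x. x \<in> conv_series d \<Longrightarrow> \<phi> x \<in> J \<longleftrightarrow> x \<in> I"
  shows "quot_alg_iso d I J"
proof -
  interpret I: ideal I "Cx d" by (rule I)
  interpret J: ideal J "Cx d" by (rule J)
  define h where "h = (\<lambda>x. J +>\<^bsub>Cx d\<^esub> \<phi> x)"
  have iso: "\<phi> \<in> ring_iso (Cx d) (Cx d)" using \<phi> by (simp add: alg_aut_def)
  have "(\<lambda>x. J +>\<^bsub>Cx d\<^esub> x) \<circ> \<phi> \<in> ring_hom (Cx d) (Cx d Quot J)"
    using iso by (intro ring_hom_trans[OF _ J.rcos_ring_hom]) (simp add: ring_iso_def)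
  then have "h \<in> ring_hom (Cx d) (Cx d Quot J)" by (simp add: h_def o_def)
  then interpret h: ring_hom_ring "Cx d" "Cx d Quot J" h
    by (intro ring_hom_ringI2 Cx.ring_axioms J.quotient_is_ring)
  have surj: "\<phi> ` conv_series d = conv_series d"
    using ring_iso_memE(5)[OF iso] by (simp add: bij_betw_def)
  have "h ` carrier (Cx d) = (\<lambda>x. J +>\<^bsub>Cx d\<^esub> x) ` (\<phi> ` conv_series d)"
    by (simp add: h_def image_image)
  also have "\<dots> = carrier (Cx d Quot J)"
    unfolding surj FactRing_def A_RCOSETS_def' by auto
  finally have im: "h ` carrier (Cx d) = carrier (Cx d Quot J)" .
  have coset: "J +>\<^bsub>Cx d\<^esub> x = J \<longleftrightarrow> x \<in> J" if "x \<in> conv_series d" for x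
    using that J.a_rcos_self[of x] Cx.a_coset_join2[OF _ J.a_subgroup, of x] by auto
  have "a_kernel (Cx d) (Cx d Quot J) h = {x \<in> conv_series d. J +>\<^bsub>Cx d\<^esub> \<phi> x = J}"
    by (simp add: a_kernel_def' h_def FactRing_def)
  also have "\<dots> = I"
    using I.Icarr IJ coset alg_aut_closed[OF \<phi>] by auto
  finally have ker: "a_kernel (Cx d) (Cx d Quot J) h = I" .
  have "(\<lambda>X. the_elem (h ` X)) \<in> ring_iso (Cx d Quot I) (Cx d Quot J)"
    using h.FactRing_iso_set[OF im] unfolding ker .
  moreover have "the_elem (h ` (I +>\<^bsub>Cx d\<^esub> cst a)) = J +>\<^bsub>Cx d\<^esub> cst a" for a
  proof -
    have "cst a \<in> carrier (Cx d)" using mconst_conv by (simp add: cst_eq_coef)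
    from h.the_elem_simp[OF this] have "the_elem (h ` (I +>\<^bsub>Cx d\<^esub> cst a)) = h (cst a)"
      unfolding ker .
    then show ?thesis using \<phi> by (simp add: h_def alg_aut_def)
  qed
  ultimately show ?thesis unfolding quot_alg_iso_def by blast
qed

theorem theorem2p24:
  fixes d :: nat and f g :: pseries
  assumes "is_poly d f" and "is_poly d g"
    and "f (\<lambda>_. 0) = 0" and "g (\<lambda>_. 0) = 0"
    and "contact_equiv d f g"
  shows "\<forall>n\<ge>1. quot_alg_iso d
            (genideal (Cx d) (insert f (Jn_ideal d n f)))
            (genideal (Cx d) (insert g (Jn_ideal d n g)))"
proof (intro allI impI)
  fix n :: nat assume n: "1 \<le> n"
  have f: "f \<in> conv_series d" and g: "g \<in> conv_series d"
    using assms(1,2) by (simp_all add: is_poly_def)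
  obtain \<phi> u where \<phi>: "alg_aut d \<phi>" and u: "u \<in> Units (Cx d)" and guf: "g = u \<otimes>\<^bsub>Cx d\<^esub> \<phi> f"
    using assms(5) by (auto simp: contact_equiv_def)
  define \<psi> where "\<psi> = inv_into (carrier (Cx d)) \<phi>"
  have iso: "\<phi> \<in> ring_iso (Cx d) (Cx d)" and cst: "\<And>a. \<phi> (cst a) = cst a"
    using \<phi> by (simp_all add: alg_aut_def)
  have bij: "bij_betw \<phi> (conv_series d) (conv_series d)" using ring_iso_memE(5)[OF iso] by simp
  have inv: "\<phi> (\<psi> x) = x" "\<psi> (\<phi> x) = x" if "x \<in> conv_series d" for x
    using bij_betw_inv_into_right[OF bij that] bij_betw_inv_into_left[OF bij that] by (simp_all add: \<psi>_def)
  have \<psi>: "alg_aut d \<psi>"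
    unfolding alg_aut_def
  proof (intro conjI allI)
    show "\<psi> \<in> ring_iso (Cx d) (Cx d)"
      unfolding \<psi>_def by (rule ring_iso_set_sym[OF Cx.ring_axioms iso])
    have "cst a \<in> conv_series d" for a using mconst_conv by (simp add: cst_eq_coef)
    then show "\<psi> (cst a) = cst a" for a using inv(2)[of "cst a"] cst[of a] by simp
  qed
  \<comment> \<open>Applying \<psi> to \<phi>(f) = u^(-1) g gives f = w \<psi>(g); this is where the
    invertibility of u enters.\<close>
  define w where "w = \<psi> (inv\<^bsub>Cx d\<^esub> u)"
  have uc: "u \<in> conv_series d" "inv\<^bsub>Cx d\<^esub> u \<in> conv_series d"
    using Cx.Units_closed[OF u] Cx.Units_inv_closed[OF u] by simp_all
  have w: "w \<in> conv_series d" unfolding w_def by (rule alg_aut_closed[OF \<psi> uc(2)])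
  have \<phi>f: "\<phi> f \<in> conv_series d" by (rule alg_aut_closed[OF \<phi> f])
  have "inv\<^bsub>Cx d\<^esub> u \<otimes>\<^bsub>Cx d\<^esub> g = \<phi> f"
    unfolding guf using uc \<phi>f u by (simp add: Cx.m_assoc[symmetric])
  then have "\<psi> (inv\<^bsub>Cx d\<^esub> u \<otimes>\<^bsub>Cx d\<^esub> g) = f" using inv(2)[OF f] by simp
  moreover have "\<psi> (inv\<^bsub>Cx d\<^esub> u \<otimes>\<^bsub>Cx d\<^esub> g) = w \<otimes>\<^bsub>Cx d\<^esub> \<psi> g"
    using ring_iso_memE(2)[of \<psi> "Cx d" "Cx d"] \<psi> uc(2) g by (simp add: alg_aut_def w_def)
  ultimately have fwg: "f = w \<otimes>\<^bsub>Cx d\<^esub> \<psi> g" by simp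
  have "jac_quot_ideal d n g \<subseteq> {x \<in> conv_series d. \<psi> x \<in> jac_quot_ideal d n f}"
    by (rule jac_quot_ideal_transport[OF \<phi> \<psi> inv n f uc(1) guf])
  moreover have "jac_quot_ideal d n f \<subseteq> {x \<in> conv_series d. \<phi> x \<in> jac_quot_ideal d n g}"
    by (rule jac_quot_ideal_transport[OF \<psi> \<phi> inv(2) inv(1) n g w fwg])
  \<comment> \<open>If \<phi> x lies in the ideal of g, the first inclusion puts \<psi> (\<phi> x) =
    x into the ideal of f; the second inclusion is the converse.\<close>
  ultimately have "\<phi> x \<in> jac_quot_ideal d n g \<longleftrightarrow> x \<in> jac_quot_ideal d n f" if "x \<in> conv_series d" for x
    using inv(2)[OF that] by auto
  then have "quot_alg_iso d (jac_quot_ideal d n f) (jac_quot_ideal d n g)"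
    by (rule quot_alg_iso_transport[OF \<phi> jac_quot_ideal[OF f] jac_quot_ideal[OF g]])
  then show "quot_alg_iso d (genideal (Cx d) (insert f (Jn_ideal d n f)))
      (genideal (Cx d) (insert g (Jn_ideal d n g)))"
    by (simp only: jac_quot_ideal_def)
qed

end
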